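(* The following holds for rotational axisymmetric $(-\alpha)$-homogeneous solutions without swirl of the stationary incompressible Euler equations. (i) For $1\leq\alpha\leq 2$, no such solutions $(u,p)\in C^{1}(\mathbb{R}^{3}\setminus\{0\})$ exist. (ii) For $-2<\alpha<1$, no such solutions $(u,p)\in C^{2}(\mathbb{R}^{3}\setminus\{0\})$ exist. For $\alpha=-2$, no such solutions $(u,p)\in C^{2}(\mathbb{R}^{3}\setminus\{0\})$ exist provided that $(\nabla\times u\cdot e_{\phi})/r$ vanishes on the $z$-axis. (iii) For every $\alpha>2$, such solutions $(u,p)\in C^{2}(\mathbb{R}^{3}\setminus\{0\})$ exist. (iv) For every $\alpha<-2$, such solutions $(u,p)\in C^{1}(\mathbb{R}^{3}\setminus\{0\})\cap C(\mathbb{R}^{3})$ (in the distributional sense in $\mathbb{R}^3$) exist.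
   Context: The stationary Euler equations are $u\cdot\nabla u+\nabla p=0$, $\nabla\cdot u=0$ for $u=(u^1,u^2,u^3)$ and scalar $p$. A pair $(u,p)$ is a $(-\alpha)$-homogeneous solution ($\alpha\in\mathbb{R}$) if it solves these equations and, for all $\lambda>0$, $u(x)=\lambda^{\alpha}u(\lambda x)$ and $p(x)=\lambda^{2\alpha}p(\lambda x)$. Solutions $(u,p)\in C^1(\mathbb{R}^3\setminus\{0\})$ or $C^2(\mathbb{R}^3\setminus\{0\})$ satisfy the equations classically in $\mathbb{R}^3\setminus\{0\}$ (no continuity at $0$ is assumed). Solutions $(u,p)\in C(\mathbb{R}^3)$, considered for $\alpha<0$, satisfy the equations in $\mathbb{R}^3$ in the distributional sense (with $u\cdot\nabla u=\nabla\cdot(u\otimes u)$). A solution is irrotational if $\nabla\times u=0$, and rotational if it is not irrotational. Cylindrical coordinates: $x_1=r\cos\phi$, $x_2=r\sin\phi$, $x_3=z$, with the frame $e_r=(\cos\phi,\sin\phi,0)$, $e_\phi=(-\sin\phi,\cos\phi,0)$, $e_z=(0,0,1)$. A solution is axisymmetric if $u=u^re_r+u^\phi e_\phi+u^ze_z$ with $u^r,u^\phi,u^z,p$ independent of $\phi$; it is without swirl if $u^\phi=0$. For an axisymmetric $C^2$ solution without swirl, $(\nabla\times u\cdot e_\phi)/r$ extends continuously to the $z$-axis minus the origin, and its value there is understood in this sense. *)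

theory Defs
  imports "HOL-Analysis.Analysis"
begin

definition partial :: "'n::finite \<Rightarrow> (real^'n \<Rightarrow> 'b::real_normed_vector) \<Rightarrow> real^'n \<Rightarrow> 'b" where
  "partial i f x = frechet_derivative f (at x) (axis i 1)"

text \<open>The class \<open>C\<^sup>k\<close> on an open set; both clauses only concern the values of \<open>f\<close> on \<open>S\<close>.\<close>

primrec Ck_on :: "nat \<Rightarrow> (real^'n::finite \<Rightarrow> 'b::real_normed_vector) \<Rightarrow> (real^'n) set \<Rightarrow> bool" where
  "Ck_on 0 f S \<longleftrightarrow> continuous_on S f"
| "Ck_on (Suc k) f S \<longleftrightarrow> (\<forall>x\<in>S. f differentiable (at x)) \<and> (\<forall>i. Ck_on k (partial i f) S)"

definition test_function :: "(real^'n::finite \<Rightarrow> 'b::real_normed_vector) \<Rightarrow> bool" where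
  "test_function f \<longleftrightarrow> (\<forall>k. Ck_on k f UNIV) \<and> compact (closure {x. f x \<noteq> 0})"

definition grad :: "(real^3 \<Rightarrow> real) \<Rightarrow> real^3 \<Rightarrow> real^3" where
  "grad p x = (\<chi> i. partial i p x)"

definition divergence :: "(real^3 \<Rightarrow> real^3) \<Rightarrow> real^3 \<Rightarrow> real" where
  "divergence u x = (\<Sum>i\<in>UNIV. partial i u x $ i)"

definition curl :: "(real^3 \<Rightarrow> real^3) \<Rightarrow> real^3 \<Rightarrow> real^3" where
  "curl u x = vector
     [partial 2 u x $ 3 - partial 3 u x $ 2,
      partial 3 u x $ 1 - partial 1 u x $ 3,
      partial 1 u x $ 2 - partial 2 u x $ 1]"

definition convection :: "(real^3 \<Rightarrow> real^3) \<Rightarrow> real^3 \<Rightarrow> real^3" where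
  "convection u x = (\<Sum>j\<in>UNIV. u x $ j *\<^sub>R partial j u x)"

definition euler_classical :: "(real^3) set \<Rightarrow> (real^3 \<Rightarrow> real^3) \<Rightarrow> (real^3 \<Rightarrow> real) \<Rightarrow> bool" where
  "euler_classical S u p \<longleftrightarrow>
     (\<forall>x\<in>S. convection u x + grad p x = 0 \<and> divergence u x = 0)"

text \<open>The equations \<open>\<nabla>\<cdot>(u \<otimes> u) + \<nabla>p = 0\<close>, \<open>\<nabla>\<cdot>u = 0\<close> tested against compactly supported smooth
  functions on the whole space. For continuous \<open>u\<close>, \<open>p\<close> all integrands are continuous with
  compact support, hence integrable.\<close>

definition euler_distributional :: "(real^3 \<Rightarrow> real^3) \<Rightarrow> (real^3 \<Rightarrow> real) \<Rightarrow> bool" where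
  "euler_distributional u p \<longleftrightarrow>
     (\<forall>v :: real^3 \<Rightarrow> real^3. test_function v \<longrightarrow>
        (LINT x|lborel. (\<Sum>i\<in>UNIV. \<Sum>j\<in>UNIV. u x $ i * u x $ j * (partial j v x $ i))
                          + p x * divergence v x) = 0) \<and>
     (\<forall>g :: real^3 \<Rightarrow> real. test_function g \<longrightarrow>
        (LINT x|lborel. u x \<bullet> grad g x) = 0)"

text \<open>\<open>(-\<alpha>)\<close>-homogeneity of the pair: the pressure has degree \<open>-2\<alpha>\<close>.\<close>

definition homogeneous_on ::
  "(real^3) set \<Rightarrow> real \<Rightarrow> (real^3 \<Rightarrow> real^3) \<Rightarrow> (real^3 \<Rightarrow> real) \<Rightarrow> bool" where
  "homogeneous_on S \<alpha> u p \<longleftrightarrow>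
     (\<forall>x\<in>S. \<forall>t>0. u x = (t powr \<alpha>) *\<^sub>R u (t *\<^sub>R x) \<and>
                    p x = (t powr (2 * \<alpha>)) * p (t *\<^sub>R x))"

definition rotational :: "(real^3 \<Rightarrow> real^3) \<Rightarrow> bool" where
  "rotational u \<longleftrightarrow> \<not> (\<forall>x. x \<noteq> 0 \<longrightarrow> curl u x = 0)"

definition cyl :: "real \<Rightarrow> real \<Rightarrow> real \<Rightarrow> real^3" where
  "cyl r \<phi> z = vector [r * cos \<phi>, r * sin \<phi>, z]"

definition e_r :: "real \<Rightarrow> real^3" where
  "e_r \<phi> = vector [cos \<phi>, sin \<phi>, 0]"

definition e_phi :: "real \<Rightarrow> real^3" where
  "e_phi \<phi> = vector [- sin \<phi>, cos \<phi>, 0]"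

definition e_z :: "real^3" where
  "e_z = vector [0, 0, 1]"

text \<open>The frame is only defined off the \<open>z\<close>-axis, so the next two conditions are imposed for
  \<open>r > 0\<close>; for continuous \<open>(u, p)\<close> this determines the values on the axis.\<close>

definition axisymmetric :: "(real^3 \<Rightarrow> real^3) \<Rightarrow> (real^3 \<Rightarrow> real) \<Rightarrow> bool" where
  "axisymmetric u p \<longleftrightarrow>
     (\<exists>(ur :: real \<Rightarrow> real \<Rightarrow> real) u\<phi> uz q. \<forall>r>0. \<forall>\<phi> z.
        u (cyl r \<phi> z) = ur r z *\<^sub>R e_r \<phi> + u\<phi> r z *\<^sub>R e_phi \<phi> + uz r z *\<^sub>R e_z \<and>
        p (cyl r \<phi> z) = q r z)"

definition without_swirl :: "(real^3 \<Rightarrow> real^3) \<Rightarrow> bool" where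
  "without_swirl u \<longleftrightarrow> (\<forall>r>0. \<forall>\<phi> z. u (cyl r \<phi> z) \<bullet> e_phi \<phi> = 0)"

text \<open>\<open>(\<nabla>\<times>u\<cdot>e\<^sub>\<phi>)/r\<close> vanishes on the \<open>z\<close>-axis minus the origin, in the sense of its (unique)
  continuous extension \<open>W\<close> to the punctured space.\<close>

definition vorticity_over_r_vanishes_on_axis :: "(real^3 \<Rightarrow> real^3) \<Rightarrow> bool" where
  "vorticity_over_r_vanishes_on_axis u \<longleftrightarrow>
     (\<exists>W :: real^3 \<Rightarrow> real. continuous_on (- {0}) W \<and>
        (\<forall>r>0. \<forall>\<phi> z. W (cyl r \<phi> z) = (curl u (cyl r \<phi> z) \<bullet> e_phi \<phi>) / r) \<and>
        (\<forall>z. z \<noteq> 0 \<longrightarrow> W (vector [0, 0, z]) = 0))"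

text \<open>Rotational axisymmetric \<open>(-\<alpha>)\<close>-homogeneous solutions without swirl that are of class \<open>C\<^sup>k\<close>
  on the punctured space (used for \<open>k \<ge> 1\<close>). The values of \<open>u\<close> and \<open>p\<close> at the origin are
  irrelevant here.\<close>

definition punctured_solution ::
  "nat \<Rightarrow> real \<Rightarrow> (real^3 \<Rightarrow> real^3) \<Rightarrow> (real^3 \<Rightarrow> real) \<Rightarrow> bool" where
  "punctured_solution k \<alpha> u p \<longleftrightarrow>
     Ck_on k u (- {0}) \<and> Ck_on k p (- {0}) \<and>
     euler_classical (- {0}) u p \<and> homogeneous_on (- {0}) \<alpha> u p \<and>
     axisymmetric u p \<and> without_swirl u \<and> rotational u"

end

theory Submission
  imports Defs "HOL-Complex_Analysis.Great_Picard"
begin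

text \<open>Non-existence. Restrict the flow to the line \<open>x\<^sub>1 = 1\<close>, \<open>x\<^sub>2 = 0\<close> and put \<open>a = u\<^sup>1\<close>, \<open>b = u\<^sup>3\<close>,
  \<open>w = b - z a\<close> (stream function), \<open>H = p + (a\<^sup>2 + b\<^sup>2) / 2\<close> (Bernoulli function) and
  \<open>G = a' + \<alpha> b + z b'\<close> (vorticity over \<open>r\<close>). The Euler equations give \<open>w' = (\<alpha> - 2) a\<close>,
  \<open>2 \<alpha> H = w G\<close> and \<open>H' = a G\<close>, and \<open>w G' = (\<alpha> + 2) a G\<close> if the flow is \<open>C\<^sup>2\<close>. So
  \<open>\<bar>w\<bar>\<^bsup>2\<alpha>/(2-\<alpha>)\<^esup> H\<close> for \<open>0 < \<alpha> < 2\<close> and \<open>\<bar>w\<bar>\<^bsup>(\<alpha>+2)/(2-\<alpha>)\<^esup> G\<close> for \<open>-2 < \<alpha> < 2\<close> are locally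
  constant off the zero set of \<open>w\<close>, hence constant, and they tend to \<open>0\<close> at the axis. For \<open>\<alpha> = -2\<close>
  the function \<open>G\<close> itself is constant.

  Existence. Let \<open>\<kappa> = (\<alpha> - 2) (\<alpha> - 1)\<close> and \<open>q = (\<alpha> + 2) / (\<alpha> - 2)\<close>. In terms of \<open>t = x\<^sub>3 / \<bar>x\<bar>\<close>, a
  solution of \<open>(1 - t\<^sup>2) w'' + \<kappa> w + \<mu> (1 - t\<^sup>2) \<bar>w\<bar>\<^bsup>q-1\<^esup> w = 0\<close>, \<open>w(\<plusminus>1) = 0\<close>, is the angular part
  of a stream function, and the flow is rotational if \<open>\<mu> w \<noteq> 0\<close>. Such a \<open>w\<close> minimises
  \<open>\<integral> w'\<^sup>2 - \<kappa> w\<^sup>2 / (1 - t\<^sup>2)\<close> subject to \<open>\<integral> \<bar>w\<bar>\<^bsup>q+1\<^esup> = 1\<close>, with \<open>\<mu>\<close> the minimum. For \<open>\<kappa> > 2\<close> the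
  trial function \<open>1 - t\<^sup>2\<close> shows \<open>\<mu> < 0\<close>; for \<open>\<kappa> \<le> 2\<close> one minimises over odd functions, and \<open>\<mu> = 0\<close> is
  impossible because the linear equation has no odd solution. Defining \<open>\<integral> w'\<^sup>2\<close> as a supremum over
  dyadic grids makes it lower semicontinuous under pointwise convergence and exactly quadratic along
  piecewise affine perturbations. For \<open>\<alpha> < -2\<close> the flow is \<open>C\<^sup>1\<close> even at the origin, so the
  distributional equations follow by integrating a divergence.\<close>

section \<open>Calculus of \<open>C\<^sup>k\<close> functions\<close>

text \<open>The exponent \<open>q\<close> is forced. Where \<open>w \<noteq> 0\<close>, the laws for
  w' and G' make \<open>G\<close> a local multiple of |w| to the power (\<alpha> + 2) / (\<alpha> -
  2). For |\<alpha>| < 2 this power is negative and the behaviour at the axis excludes every nonzero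
  multiple; for |\<alpha>| > 2 it is positive, and prescribing such a multiple as vorticity closes
  the equation for the stream function. The threshold 2 for \<kappa> is the lowest eigenvalue of w''
  + \<lambda> w / (1 - t^2) = 0, w(1) = w(-1) = 0, with eigenfunction 1 - t^2. At \<alpha> = 3 one
  has \<kappa> = 2, and the even minimiser would be this eigenfunction with \<mu> = 0, an
  irrotational flow; odd functions, whose lowest eigenvalue is 6, avoid the resonance. The equation
  is singular at t = 1 and t = -1, where the axis meets the sphere. The velocity there is governed
  by w / (1 - t^2), so it is this quotient whose smoothness up to the endpoints has to be proved.
  For \<alpha> < -2 one has 0 < q < 1; the nonlinearity is then continuous but not differentiable at
  zeros of w, whence class C^1 instead of C^2.\<close>

lemma partial_eqI: "(f has_derivative f') (at x) \<Longrightarrow> partial i f x = f' (axis i 1)"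
  unfolding partial_def by (metis frechet_derivative_at)

lemma partial_cong_open:
  assumes "open S" "x \<in> S" "\<And>y. y \<in> S \<Longrightarrow> f y = g y" "f differentiable (at x)"
  shows "partial i f x = partial i g x"
proof -
  obtain f' where f': "(f has_derivative f') (at x)" using assms(4)
      by (auto simp: differentiable_def)
  then have "(g has_derivative f') (at x)"
    using has_derivative_transform_within_open[OF f' assms(1,2)] assms(3) by metis
  with f' show ?thesis by (simp add: partial_eqI)
qed

lemma differentiable_cong_open:
  assumes "open S" "x \<in> S" "\<And>y. y \<in> S \<Longrightarrow> f y = g y" "f differentiable (at x)"
  shows "g differentiable (at x)"
  using assms has_derivative_transform_within_open unfolding differentiable_def by metis

text \<open>A formula for \<open>partial i f\<close> is available only where \<open>f\<close> is
  differentiable, that is on \<open>S\<close>. Since \<open>S\<close> is open, equality on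
  \<open>S\<close> passes to derivatives, so such a formula may replace \<open>partial i f\<close>
  in an induction on the order.\<close>

lemma Ck_on_cong:
  "open S \<Longrightarrow> (\<And>y. y \<in> S \<Longrightarrow> f y = g y) \<Longrightarrow> Ck_on k f S \<Longrightarrow> Ck_on k g S"
proof (induction k arbitrary: f g)
  case 0
  then show ?case using continuous_on_cong[of S S f g] by simp
next
  case (Suc k)
  have "Ck_on k (partial i g) S" for i
    by (rule Suc.IH[of "partial i f"]) (use Suc.prems in \<open>auto intro!: partial_cong_open\<close>)
  moreover have "g differentiable (at x)" if "x \<in> S" for x
    using differentiable_cong_open[OF Suc.prems(1) that Suc.prems(2)] Suc.prems(3) that by auto
  ultimately show ?case by simp
qed

lemma Ck_on_SucD: "Ck_on (Suc k) f S \<Longrightarrow> Ck_on k f S"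
proof (induction k arbitrary: f)
  case 0
  then show ?case
    by (auto intro!: continuous_at_imp_continuous_on differentiable_imp_continuous_within)
next
  case (Suc k)
  show ?case using Suc.prems Suc.IH by simp
qed

lemma Ck_on_const:
  fixes S :: "(real^'n::finite) set"
  shows "open S \<Longrightarrow> Ck_on k (\<lambda>x. c) S"
proof (induction k arbitrary: c)
  case (Suc k)
  have "partial i (\<lambda>x::real^'n. c) = (\<lambda>x. 0)" for i
    by (rule ext) (simp add: partial_eqI[OF has_derivative_const])
  with Suc show ?case by simp
qed simp

lemma Ck_on_Suc_nth:
  fixes S :: "(real^'n::finite) set"
  assumes "open S"
  shows "Ck_on (Suc l) (\<lambda>x. x $ j) S"
proof -
  have d: "((\<lambda>x. x $ j) has_derivative (\<lambda>v. v $ j)) (at x)" for x :: "real^'n"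
    by (rule bounded_linear_imp_has_derivative[OF bounded_linear_vec_nth])
  have p: "partial i (\<lambda>x::real^'n. x $ j) = (\<lambda>x. axis i 1 $ j)" for i
    by (rule ext) (rule partial_eqI[OF d])
  have "Ck_on l (partial i (\<lambda>x::real^'n. x $ j)) S" for i
    unfolding p by (rule Ck_on_const[OF \<open>open S\<close>])
  moreover have "(\<lambda>x. x $ j) differentiable (at x)" for x :: "real^'n"
    using d by (rule differentiableI)
  ultimately show ?thesis unfolding Ck_on.simps by blast
qed

lemma Ck_on_nth:
  fixes S :: "(real^'n::finite) set"
  assumes "open S"
  shows "Ck_on k (\<lambda>x. x $ j) S"
  by (rule Ck_on_SucD[OF Ck_on_Suc_nth[OF assms]])

lemma partial_add:
  assumes "f differentiable (at x)" "g differentiable (at x)"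
  shows "partial i (\<lambda>x. f x + g x) x = partial i f x + partial i g x"
  using partial_eqI[OF has_derivative_add[OF assms[unfolded frechet_derivative_works]]]
  by (simp add: partial_def)

lemma partial_bilinear:
  assumes "bounded_bilinear B" "f differentiable (at x)" "g differentiable (at x)"
  shows "partial i (\<lambda>x. B (f x) (g x)) x = B (f x) (partial i g x) + B (partial i f x) (g x)"
proof -
  interpret bounded_bilinear B by fact
  have "((\<lambda>x. B (f x) (g x)) has_derivative
     (\<lambda>h. B (f x) (frechet_derivative g (at x) h) + B (frechet_derivative f (at x) h) (g x))) (at
         x)"
    by (rule FDERIV) (use assms frechet_derivative_works in auto)
  from partial_eqI[OF this] show ?thesis by (simp add: partial_def)
qed

lemma Ck_on_add: "open S \<Longrightarrow> Ck_on k f S \<Longrightarrow> Ck_on k g S \<Longrightarrow> Ck_on k (\<lambda>x. f x + g x) S"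
proof (induction k arbitrary: f g)
  case 0 then show ?case by (simp, intro continuous_intros)
next
  case (Suc k)
  have "Ck_on k (\<lambda>x. partial i f x + partial i g x) S" for i
    by (rule Suc.IH) (use Suc.prems in auto)
  note * = this
  have "Ck_on k (partial i (\<lambda>x. f x + g x)) S" for i
    by (rule Ck_on_cong[OF \<open>open S\<close> _ *[of i]]) (use Suc.prems in \<open>simp add: partial_add\<close>)
  with Suc.prems show ?case by (simp add: differentiable_add)
qed

text \<open>Leibniz rule, by induction on the order; the undifferentiated factor is lowered by
  \<open>Ck_on_SucD\<close>. The bilinear form lets products, scalar multiples and inner products
  share one proof.\<close>

lemma Ck_on_bilinear:
  assumes "bounded_bilinear B" "open S"
  shows "Ck_on k f S \<Longrightarrow> Ck_on k g S \<Longrightarrow> Ck_on k (\<lambda>x. B (f x) (g x)) S"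
proof (induction k arbitrary: f g)
  case 0 then show ?case using bounded_bilinear.continuous_on[OF assms(1)] by simp
next
  case (Suc k)
  have "Ck_on k (partial i (\<lambda>x. B (f x) (g x))) S" for i
  proof (rule Ck_on_cong[of S "\<lambda>x. B (f x) (partial i g x) + B (partial i f x) (g x)"])
    show "Ck_on k (\<lambda>x. B (f x) (partial i g x) + B (partial i f x) (g x)) S"
      using Suc.prems Ck_on_SucD[OF Suc.prems(1)] Ck_on_SucD[OF Suc.prems(2)]
      by (intro Ck_on_add Suc.IH assms) auto
  qed (use Suc.prems assms in \<open>auto simp: partial_bilinear[OF assms(1)]\<close>)
  moreover have "(\<lambda>x. B (f x) (g x)) differentiable (at x)" if "x \<in> S" for x
  proof -
    have "f differentiable (at x)" "g differentiable (at x)" using Suc.prems that by auto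
    then have "((\<lambda>x. B (f x) (g x)) has_derivative
       (\<lambda>h. B (f x) (frechet_derivative g (at x) h) + B (frechet_derivative f (at x) h) (g x)))
           (at x)"
      by (intro bounded_bilinear.FDERIV[OF assms(1)] frechet_derivative_works[THEN iffD1])
    then show ?thesis by (rule differentiableI)
  qed
  ultimately show ?case by simp
qed

lemmas Ck_on_mult = Ck_on_bilinear[OF bounded_bilinear_mult]
lemmas Ck_on_scaleR = Ck_on_bilinear[OF bounded_bilinear_scaleR]

lemma Ck_on_sum:
  assumes "open S"
  shows "(\<And>i. i \<in> I \<Longrightarrow> Ck_on k (f i) S) \<Longrightarrow> Ck_on k (\<lambda>x. \<Sum>i\<in>I. f i x) S"
proof (induction I rule: infinite_finite_induct)
  case (insert j I)
  then show ?case using Ck_on_add[OF assms, of k "f j" "\<lambda>x. \<Sum>i\<in>I. f i x"] by simp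
qed (use Ck_on_const[OF assms] in simp_all)

text \<open>The list \<open>\<Phi>\<close> of successive derivatives witnesses that the function of one variable \<open>\<Phi> 0\<close>
  is of class \<open>C\<^sup>k\<close>.\<close>

lemma Ck_on_compose:
  fixes f :: "real^'n::finite \<Rightarrow> real" and \<Phi> :: "nat \<Rightarrow> real \<Rightarrow> real"
  assumes "open S" "open T"
  shows "Ck_on k f S \<Longrightarrow> f ` S \<subseteq> T \<Longrightarrow>
    (\<And>j y. j < k \<Longrightarrow> y \<in> T \<Longrightarrow> (\<Phi> j has_real_derivative \<Phi> (Suc j) y) (at y)) \<Longrightarrow>
    continuous_on T (\<Phi> k) \<Longrightarrow> Ck_on k (\<lambda>x. \<Phi> 0 (f x)) S"
proof (induction k arbitrary: \<Phi>)
  case 0 then show ?case using continuous_on_compose2[of T "\<Phi> 0" S f] by simp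
next
  case (Suc k)
  have d: "((\<lambda>x. \<Phi> 0 (f x)) has_derivative (\<lambda>h. \<Phi> 1 (f x) * frechet_derivative f (at x) h)) (at x)"
    if "x \<in> S" for x
  proof -
    have "(\<Phi> 0 has_derivative (*) (\<Phi> 1 (f x))) (at (f x))"
      using Suc.prems(3)[of 0 "f x"] Suc.prems(2) that by (auto simp: has_field_derivative_def)
    moreover have "(f has_derivative frechet_derivative f (at x)) (at x)"
      using Suc.prems(1) that frechet_derivative_works[of f "at x"] by simp
    ultimately show ?thesis using has_derivative_compose[of f _ x UNIV "\<Phi> 0"] by simp
  qed
  have "Ck_on k (\<lambda>x. \<Phi> (Suc 0) (f x)) S"
    by (rule Suc.IH[of "\<lambda>j. \<Phi> (Suc j)"]) (use Suc.prems Ck_on_SucD[OF Suc.prems(1)] in auto)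
  then have *: "Ck_on k (\<lambda>x. \<Phi> (Suc 0) (f x) * partial i f x) S" for i
    by (rule Ck_on_mult[OF assms(1)]) (use Suc.prems(1) in auto)
  have "Ck_on k (partial i (\<lambda>x. \<Phi> 0 (f x))) S" for i
    by (rule Ck_on_cong[OF assms(1) _ *[of i]]) (simp add: partial_eqI[OF d], simp add: partial_def)
  moreover have "(\<lambda>x. \<Phi> 0 (f x)) differentiable (at x)" if "x \<in> S" for x
    using d[OF that] by (rule differentiableI)
  ultimately show ?case by simp
qed

lemma Ck_on_componentwise:
  fixes f :: "real^'n::finite \<Rightarrow> real^3"
  assumes "open S" "\<And>i. Ck_on k (\<lambda>x. f x $ i) S"
  shows "Ck_on k f S"
proof -
  have "Ck_on k (\<lambda>x. \<Sum>i\<in>UNIV. f x $ i *\<^sub>R axis i (1::real)) S"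
    by (intro Ck_on_sum Ck_on_scaleR Ck_on_const assms)
  then show ?thesis
    by (rule Ck_on_cong[OF assms(1), rotated])
      (simp add: vec_eq_iff axis_def if_distrib[where f="\<lambda>y. _ * y"] cong: if_cong)
qed

lemma has_real_derivative_abs:
  assumes "x \<noteq> (0::real)"
  shows "((\<lambda>x. \<bar>x\<bar>) has_real_derivative sgn x) (at x)"
proof (rule has_field_derivative_transform_within_open)
  show "((\<lambda>y. sgn x * y) has_real_derivative sgn x) (at x)"
    by (auto intro!: derivative_eq_intros)
  show "open {y. sgn x * y > 0}" by (intro open_Collect_less continuous_intros)
qed (use assms in \<open>auto simp: sgn_if split: if_splits\<close>)

lemma axis_3_nth [simp]:
  "axis 1 (c::real) $ (2::3) = 0" "axis 1 c $ (3::3) = 0"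
  "axis 2 c $ (1::3) = 0" "axis 2 c $ (3::3) = 0"
  "axis 3 c $ (1::3) = 0" "axis 3 c $ (2::3) = 0"
  by (simp_all add: axis_def)

lemma differentiable_nth:
  "f differentiable (at x) \<Longrightarrow> (\<lambda>y. f y $ j) differentiable (at x)"
  unfolding differentiable_def
  by (blast intro: bounded_linear.has_derivative[OF bounded_linear_vec_nth])

lemma partial_nth:
  assumes "f differentiable (at x)"
  shows "partial i (\<lambda>y. f y $ j) x = partial i f x $ j"
  using partial_eqI[OF bounded_linear.has_derivative[OF bounded_linear_vec_nth
        assms[unfolded frechet_derivative_works]]]
  by (simp add: partial_def)

lemma cyl_nth [simp]:
  "cyl r \<phi> z $ 1 = r * cos \<phi>" "cyl r \<phi> z $ 2 = r * sin \<phi>" "cyl r \<phi> z $ 3 = z"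
  by (simp_all add: cyl_def)

lemma e_nth [simp]:
  "e_r \<phi> $ 1 = cos \<phi>" "e_r \<phi> $ 2 = sin \<phi>" "e_r \<phi> $ 3 = 0"
  "e_phi \<phi> $ 1 = - sin \<phi>" "e_phi \<phi> $ 2 = cos \<phi>" "e_phi \<phi> $ 3 = 0"
  "e_z $ 1 = 0" "e_z $ 2 = 0" "e_z $ 3 = 1"
  by (simp_all add: e_r_def e_phi_def e_z_def)

lemma vec3_eq_iff: "x = (y::'a^3) \<longleftrightarrow> x $ 1 = y $ 1 \<and> x $ 2 = y $ 2 \<and> x $ 3 = y $ 3"
  by (simp add: vec_eq_iff forall_3)

lemma inner_3: "(x::real^3) \<bullet> y = x $ 1 * y $ 1 + x $ 2 * y $ 2 + x $ 3 * y $ 3"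
  by (simp add: inner_vec_def sum_3)

lemma partial_has_vector_derivative:
  assumes "f differentiable (at x)"
  shows "((\<lambda>t. f (x + t *\<^sub>R axis i 1)) has_vector_derivative partial i f x) (at 0)"
proof -
  define F where "F = frechet_derivative f (at x)"
  have F: "(f has_derivative F) (at (x + 0 *\<^sub>R axis i 1))"
    using assms frechet_derivative_works unfolding F_def by auto
  have "((\<lambda>t. x + t *\<^sub>R axis i 1) has_derivative (\<lambda>t. t *\<^sub>R axis i 1)) (at 0)"
    by (auto intro!: derivative_eq_intros)
  from has_derivative_compose[OF this F]
  have "((\<lambda>t. f (x + t *\<^sub>R axis i 1)) has_derivative (\<lambda>t. F (t *\<^sub>R axis i 1))) (at 0)" .
  moreover have "F (t *\<^sub>R axis i 1) = t *\<^sub>R F (axis i 1)" for t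
    using has_derivative_linear[OF F] by (simp add: linear_cmul)
  ultimately show ?thesis by (simp add: has_vector_derivative_def partial_def F_def)
qed

section \<open>Non-existence\<close>

lemma cyl_surj:
  fixes x :: "real^3"
  assumes "(x$1)\<^sup>2 + (x$2)\<^sup>2 > 0"
  obtains \<phi> where "x = cyl (sqrt ((x$1)\<^sup>2 + (x$2)\<^sup>2)) \<phi> (x$3)"
proof -
  define r where "r = sqrt ((x$1)\<^sup>2 + (x$2)\<^sup>2)"
  have r: "r > 0" "r\<^sup>2 = (x$1)\<^sup>2 + (x$2)\<^sup>2" using assms by (auto simp: r_def)
  have "(x$1 / r)\<^sup>2 + (x$2 / r)\<^sup>2 = 1"
    unfolding power_divide add_divide_distrib[symmetric] r(2)[symmetric] using r(1) by simp
  then obtain \<phi> where "x$1 / r = cos \<phi>" "x$2 / r = sin \<phi>" using sincos_total_2pi by metis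
  then have "x = cyl r \<phi> (x$3)" using r by (simp add: vec3_eq_iff field_simps)
  then show ?thesis using that by (simp add: r_def)
qed

text \<open>Rotating by \<open>- \<phi>\<close> and scaling by \<open>1 / r\<close> moves any point
  off the axis to the line x_1 = 1, x_2 = 0, so functions of one variable carry the whole flow. The
  first two components have a different power of \<open>R\<close> because they are written as
  multiples of \<open>x$1\<close> and \<open>x$2\<close> instead of cosine and sine.\<close>

lemma axisymmetric_profile:
  assumes "axisymmetric u p" "without_swirl u" "homogeneous_on (- {0}) \<alpha> u p"
    and R: "R = (x$1)\<^sup>2 + (x$2)\<^sup>2" "R > 0"
  shows "u x $ 1 = R powr (-(\<alpha>+1)/2) * u (vector [1, 0, x$3 / sqrt R]) $ 1 * x$1"
    and "u x $ 2 = R powr (-(\<alpha>+1)/2) * u (vector [1, 0, x$3 / sqrt R]) $ 1 * x$2"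
    and "u x $ 3 = R powr (-\<alpha>/2) * u (vector [1, 0, x$3 / sqrt R]) $ 3"
    and "p x = R powr (-\<alpha>) * p (vector [1, 0, x$3 / sqrt R])"
proof -
  obtain ur u\<phi> uz q where form: "\<And>r \<phi> z. r > 0 \<Longrightarrow>
        u (cyl r \<phi> z) = ur r z *\<^sub>R e_r \<phi> + u\<phi> r z *\<^sub>R e_phi \<phi> + uz r z *\<^sub>R e_z \<and>
        p (cyl r \<phi> z) = q r z"
    using assms(1) unfolding axisymmetric_def by blast
  define r where "r = sqrt R"
  have r: "r > 0" "R = r\<^sup>2" using R by (auto simp: r_def)
  obtain \<phi> where x: "x = cyl r \<phi> (x$3)" using cyl_surj[of x] R by (auto simp: r_def)
  define z where "z = x$3 / r"
  have u\<phi>: "u\<phi> 1 z = 0"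
  proof -
    have "u (cyl 1 \<phi> z) \<bullet> e_phi \<phi> = 0" using assms(2) by (simp add: without_swirl_def)
    moreover have "cos \<phi> * (cos \<phi> * y) + sin \<phi> * (sin \<phi> * y) = y" for y :: real
      by (simp only: mult.assoc[symmetric] distrib_right[symmetric] sin_cos_squared_add3 mult_1)
    ultimately show ?thesis
      by (simp only: form[of 1] zero_less_one inner_3) (simp add: algebra_simps)
  qed
  have c0: "cyl 1 0 z = vector [1, 0, z]" by (simp add: vec3_eq_iff)
  have f0: "u (vector [1, 0, z]) $ 1 = ur 1 z" "u (vector [1, 0, z]) $ 3 = uz 1 z"
    "p (vector [1, 0, z]) = q 1 z"
    using form[of 1 0 z] by (simp_all add: c0)
  have "x \<in> - {0}" "0 < 1/r" using R r by auto
  note hom = assms(3)[unfolded homogeneous_on_def, rule_format, OF this]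
  have "(1/r) *\<^sub>R x = cyl 1 \<phi> z"
    by (subst x) (use r in \<open>simp add: vec3_eq_iff z_def\<close>)
  note hom = hom[unfolded this]
  have ux: "u x = ((1/r) powr \<alpha>) *\<^sub>R (ur 1 z *\<^sub>R e_r \<phi> + uz 1 z *\<^sub>R e_z)"
    and px: "p x = ((1/r) powr (2*\<alpha>)) * q 1 z"
    using hom form[of 1 \<phi> z] u\<phi> by simp_all
  have x12: "x$1 = r * cos \<phi>" "x$2 = r * sin \<phi>" by (subst x; simp)+
  have pw: "R powr (s/2) = r powr s" for s
    using r by (simp add: powr_powr flip: powr_numeral)
  have pw1: "R powr (-(\<alpha>+1)/2) * r = (1/r) powr \<alpha>"
  proof -
    have "r powr (-(\<alpha>+1)) * r = r powr (-(\<alpha>+1) + 1)" using r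
        by (simp only: powr_add powr_one less_imp_le)
    then show ?thesis unfolding pw using r by (simp add: powr_minus powr_divide divide_simps)
  qed
  have pw2: "R powr (-\<alpha>/2) = (1/r) powr \<alpha>"
    unfolding pw using r by (simp add: powr_minus powr_divide divide_simps)
  have pw3: "R powr (-\<alpha>) = (1/r) powr (2 * \<alpha>)"
    using pw[of "-2*\<alpha>"] r by (simp add: powr_minus powr_divide divide_simps)
  have zz: "x$3 / sqrt R = z" by (simp add: z_def r_def)
  show "u x $ 1 = R powr (-(\<alpha>+1)/2) * u (vector [1, 0, x$3 / sqrt R]) $ 1 * x$1"
    unfolding zz f0 ux x12 using pw1 by (simp add: algebra_simps)
  show "u x $ 2 = R powr (-(\<alpha>+1)/2) * u (vector [1, 0, x$3 / sqrt R]) $ 1 * x$2"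
    unfolding zz f0 ux x12 using pw1 by (simp add: algebra_simps)
  show "u x $ 3 = R powr (-\<alpha>/2) * u (vector [1, 0, x$3 / sqrt R]) $ 3"
    unfolding zz f0 ux using pw2 by (simp add: algebra_simps)
  show "p x = R powr (-\<alpha>) * p (vector [1, 0, x$3 / sqrt R])"
    unfolding zz f0 px pw3 by simp
qed

lemma has_derivative_profile:
  fixes x :: "real^3"
  assumes R: "R = (x$1)\<^sup>2 + (x$2)\<^sup>2" "R > 0"
    and f: "(f has_real_derivative f') (at (x$3 / sqrt R))"
  shows "((\<lambda>y. ((y$1)\<^sup>2 + (y$2)\<^sup>2) powr s * f (y$3 / sqrt ((y$1)\<^sup>2 + (y$2)\<^sup>2))) has_derivative
     (\<lambda>v. (2 * x$1 * v$1 + 2 * x$2 * v$2) *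
         (s * R powr (s - 1) * f (x$3 / sqrt R) - R powr s * f' * x$3 / (2 * R * sqrt R)) +
       v$3 * (R powr s * f' / sqrt R))) (at x)"
proof -
  let ?R = "\<lambda>y::real^3. (y$1)\<^sup>2 + (y$2)\<^sup>2" and ?R' = "\<lambda>v. 2 * x$1 * v$1 + 2 * x$2 * v$2"
  have n: "((\<lambda>y. y $ j) has_derivative (\<lambda>v. v $ j)) (at x)" for j :: 3
    by (rule bounded_linear_imp_has_derivative[OF bounded_linear_vec_nth])
  have R': "(?R has_derivative ?R') (at x)"
    using has_derivative_add[OF has_derivative_power[OF n[of 1], of 2] has_derivative_power[OF
        n[of 2], of 2]]
    by (simp add: algebra_simps)
  have pw: "((\<lambda>y. ?R y powr s) has_derivative (\<lambda>v. ?R' v * (s * R powr (s - 1)))) (at x)"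
    using DERIV_compose_FDERIV[OF has_real_derivative_powr[of R s, OF R(2), unfolded R(1)] R'] R(1)
    by simp
  have "((\<lambda>r. inverse (sqrt r)) has_real_derivative - 1 / (2 * R * sqrt R)) (at R)"
    using R(2) by (auto intro!: derivative_eq_intros simp: field_simps)
  from DERIV_compose_FDERIV[OF this[unfolded R(1)] R']
  have "((\<lambda>y. inverse (sqrt (?R y))) has_derivative (\<lambda>v. ?R' v * (- 1 / (2 * R * sqrt R)))) (at x)"
    using R(1) by simp
  from has_derivative_mult[OF n[of 3] this]
  have z: "((\<lambda>y. y$3 / sqrt (?R y)) has_derivative
      (\<lambda>v. x$3 * (?R' v * (- 1 / (2 * R * sqrt R))) + v$3 * inverse (sqrt R))) (at x)"
    by (simp add: R(1) divide_inverse)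
  have "((\<lambda>y. f (y$3 / sqrt (?R y))) has_derivative
      (\<lambda>v. (x$3 * (?R' v * (- 1 / (2 * R * sqrt R))) + v$3 * inverse (sqrt R)) * f')) (at x)"
    using DERIV_compose_FDERIV[OF f[unfolded R(1)] z] by (simp add: R(1))
  note D = has_derivative_mult[OF pw this]
  have aux: "A * ((z * (r * (- 1 / (2 * R * k))) + v * inverse k) * f') + r * (s * B) * C =
      r * (s * B * C - A * f' * z / (2 * R * k)) + v * (A * f' / k)"
    if "R > 0" "k > 0" for A z r R k v B C :: real
    using that by (simp add: field_simps)
  from D show ?thesis
  proof (rule has_derivative_eq_rhs)
    show "(\<lambda>h. ?R x powr s * ((x$3 * (?R' h * (- 1 / (2 * R * sqrt R))) + h$3 * inverse (sqrt R))
        * f') +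
        ?R' h * (s * R powr (s - 1)) * f (x$3 / sqrt (?R x))) = (\<lambda>v. ?R' v *
         (s * R powr (s - 1) * f (x$3 / sqrt R) - R powr s * f' * x$3 / (2 * R * sqrt R)) +
       v$3 * (R powr s * f' / sqrt R))"
      unfolding R(1)[symmetric] by (rule ext, rule aux) (use R(2) in auto)
  qed
qed

section \<open>The equations on the line through (1, 0, 0) parallel to the axis\<close>

locale axisymmetric_flow =
  fixes \<alpha> :: real and u :: "real^3 \<Rightarrow> real^3" and p :: "real^3 \<Rightarrow> real"
  assumes C1: "Ck_on 1 u (- {0})" "Ck_on 1 p (- {0})"
    and euler: "euler_classical (- {0}) u p"
    and hom: "homogeneous_on (- {0}) \<alpha> u p"
    and axi: "axisymmetric u p" "without_swirl u"
begin

definition a where "a z = u (vector [1, 0, z]) $ 1"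
definition b where "b z = u (vector [1, 0, z]) $ 3"
definition q where "q z = p (vector [1, 0, z])"
definition a' where "a' z = partial 3 u (vector [1, 0, z]) $ 1"
definition b' where "b' z = partial 3 u (vector [1, 0, z]) $ 3"
definition q' where "q' z = partial 3 p (vector [1, 0, z])"

lemma differentiable: "x \<noteq> 0 \<Longrightarrow> u differentiable (at x)" "x \<noteq> 0 \<Longrightarrow> p differentiable (at x)"
  using C1 by auto

lemma vec_line: "vector [1, 0, z] + t *\<^sub>R axis 3 1 = (vector [1, 0, z + t] :: real^3)"
  by (simp add: vec3_eq_iff)

lemma vec_nz: "vector [1, 0, z] \<noteq> (0 :: real^3)"
  by (simp add: vec3_eq_iff)

lemma deriv_a: "(a has_real_derivative a' z) (at z)"
  and deriv_b: "(b has_real_derivative b' z) (at z)"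
  and deriv_q: "(q has_real_derivative q' z) (at z)"
proof -
  have "((\<lambda>t. u (vector [1, 0, z + t])) has_vector_derivative partial 3 u (vector [1, 0, z])) (at
      0)"
    using partial_has_vector_derivative[OF differentiable(1)[OF vec_nz], of z 3]
        by (simp only: vec_line)
  from bounded_linear.has_vector_derivative[OF bounded_linear_vec_nth this]
  have "((\<lambda>t. u (vector [1, 0, t + z]) $ j) has_real_derivative partial 3 u (vector [1, 0, z]) $
      j) (at 0)" for j
    by (simp only: has_real_derivative_iff_has_vector_derivative add.commute[of _ z])
  then have *: "((\<lambda>t. u (vector [1, 0, t]) $ j) has_real_derivative partial 3 u (vector [1, 0, z])
      $ j) (at z)" for j
    using DERIV_shift[of "\<lambda>t. u (vector [1, 0, t]) $ j" _ 0 z] by simp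
  have e: "a = (\<lambda>z. u (vector [1, 0, z]) $ 1)" "b = (\<lambda>z. u (vector [1, 0, z]) $ 3)"
    "q = (\<lambda>z. p (vector [1, 0, z]))" by (simp_all add: fun_eq_iff a_def b_def q_def)
  show "(a has_real_derivative a' z) (at z)" "(b has_real_derivative b' z) (at z)"
    using *[of 1] *[of 3] unfolding e a'_def b'_def by simp_all
  have "((\<lambda>t. p (vector [1, 0, t + z])) has_real_derivative partial 3 p (vector [1, 0, z])) (at 0)"
    using partial_has_vector_derivative[OF differentiable(2)[OF vec_nz], of z 3]
    by (simp only: vec_line has_real_derivative_iff_has_vector_derivative add.commute[of _ z])
  then show "(q has_real_derivative q' z) (at z)"
    unfolding e q'_def using DERIV_shift[of "\<lambda>t. p (vector [1, 0, t])" _ 0 z] by simp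
qed

lemma open_off_axis: "open {y::real^3. (y$1)\<^sup>2 + (y$2)\<^sup>2 > 0}"
  by (intro open_Collect_less continuous_intros)

lemma partial_profile:
  fixes F :: "real^3 \<Rightarrow> real"
  assumes R: "R = (x$1)\<^sup>2 + (x$2)\<^sup>2" "R > 0"
    and f: "(f has_real_derivative f') (at (x$3 / sqrt R))"
    and F: "\<And>y. (y$1)\<^sup>2 + (y$2)\<^sup>2 > 0 \<Longrightarrow>
      F y = ((y$1)\<^sup>2 + (y$2)\<^sup>2) powr s * f (y$3 / sqrt ((y$1)\<^sup>2 + (y$2)\<^sup>2))"
  shows "(F has_derivative (\<lambda>v. (2 * x$1 * v$1 + 2 * x$2 * v$2) *
         (s * R powr (s - 1) * f (x$3 / sqrt R) - R powr s * f' * x$3 / (2 * R * sqrt R)) +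
       v$3 * (R powr s * f' / sqrt R))) (at x)"
  by (rule has_derivative_transform_within_open[OF has_derivative_profile[OF R f] open_off_axis])
    (use R F in auto)

text \<open>The horizontal velocity is \<open>g\<close> times (x_1, x_2). \<open>gR\<close> and
  \<open>gz\<close> are the derivatives of this factor in \<open>R\<close> and x_3, and
  \<open>hR\<close> and \<open>hz\<close> are those of the vertical component; the factors
  \<open>2 * x$1\<close> and \<open>2 * x$2\<close> come from differentiating
  \<open>R\<close>.\<close>

lemma partial_u:
  assumes R: "R = (x$1)\<^sup>2 + (x$2)\<^sup>2" "R > 0" and \<zeta>: "\<zeta> = x$3 / sqrt R"
    and gR: "gR = (-(\<alpha>+1)/2) * R powr (-(\<alpha>+1)/2 - 1) * a \<zeta> - R powr (-(\<alpha>+1)/2) * a' \<zeta> * x$3 / (2 *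
        R * sqrt R)"
    and gz: "gz = R powr (-(\<alpha>+1)/2) * a' \<zeta> / sqrt R"
    and hR: "hR = (-\<alpha>/2) * R powr (-\<alpha>/2 - 1) * b \<zeta> - R powr (-\<alpha>/2) * b' \<zeta> * x$3 / (2 * R * sqrt R)"
    and hz: "hz = R powr (-\<alpha>/2) * b' \<zeta> / sqrt R"
    and g: "g = R powr (-(\<alpha>+1)/2) * a \<zeta>"
  shows "partial 1 u x = vector [g + 2 * x$1 * gR * x$1, 2 * x$1 * gR * x$2, 2 * x$1 * hR]"
    and "partial 2 u x = vector [2 * x$2 * gR * x$1, g + 2 * x$2 * gR * x$2, 2 * x$2 * hR]"
    and "partial 3 u x = vector [gz * x$1, gz * x$2, hz]"
proof -
  have x: "x \<noteq> 0" using R by auto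
  define P where "P = (\<lambda>y::real^3. ((y$1)\<^sup>2 + (y$2)\<^sup>2) powr (-(\<alpha>+1)/2) * a (y$3 / sqrt ((y$1)\<^sup>2 +
      (y$2)\<^sup>2)))"
  note pr = axisymmetric_profile[OF axi hom refl, folded a_def b_def]
  have n: "((\<lambda>y. y $ j) has_derivative (\<lambda>v. v $ j)) (at x)" for j :: 3
    by (rule bounded_linear_imp_has_derivative[OF bounded_linear_vec_nth])
  have D3: "((\<lambda>y. u y $ 3) has_derivative (\<lambda>v. (2 * x$1 * v$1 + 2 * x$2 * v$2) * hR + v$3 * hz))
      (at x)"
    unfolding hR hz \<zeta> by (rule partial_profile[OF R deriv_b]) (rule pr(3))
  have DP: "(P has_derivative (\<lambda>v. (2 * x$1 * v$1 + 2 * x$2 * v$2) * gR + v$3 * gz)) (at x)"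
    unfolding gR gz \<zeta> by (rule partial_profile[OF R deriv_a]) (simp add: P_def)
  have Px: "P x = g" by (simp add: P_def g \<zeta> R)
  have Dj: "((\<lambda>y. u y $ j) has_derivative
      (\<lambda>v. g * v $ j + ((2 * x$1 * v$1 + 2 * x$2 * v$2) * gR + v$3 * gz) * x $ j)) (at x)"
    if "j = 1 \<or> j = 2" for j
    by (rule has_derivative_transform_within_open[OF
          has_derivative_mult[OF DP n[of j], unfolded Px] open_off_axis])
      (use R pr(1,2) that in \<open>auto simp: P_def\<close>)
  have nth: "partial i u x $ j = partial i (\<lambda>y. u y $ j) x" for i j
    using partial_nth[OF differentiable(1)[OF x]] by simp
  show "partial 1 u x = vector [g + 2 * x$1 * gR * x$1, 2 * x$1 * gR * x$2, 2 * x$1 * hR]"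
    and "partial 2 u x = vector [2 * x$2 * gR * x$1, g + 2 * x$2 * gR * x$2, 2 * x$2 * hR]"
    and "partial 3 u x = vector [gz * x$1, gz * x$2, hz]"
    by (simp_all add: vec3_eq_iff nth partial_eqI[OF Dj] partial_eqI[OF D3])
qed

lemma partial_p:
  assumes R: "R = (x$1)\<^sup>2 + (x$2)\<^sup>2" "R > 0" and \<zeta>: "\<zeta> = x$3 / sqrt R"
    and pR: "pR = (-\<alpha>) * R powr (-\<alpha> - 1) * q \<zeta> - R powr (-\<alpha>) * q' \<zeta> * x$3 / (2 * R * sqrt R)"
  shows "partial 1 p x = 2 * x$1 * pR"
    and "partial 3 p x = R powr (-\<alpha>) * q' \<zeta> / sqrt R"
proof -
  note pr = axisymmetric_profile[OF axi hom refl, folded q_def]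
  have D: "(p has_derivative (\<lambda>v. (2 * x$1 * v$1 + 2 * x$2 * v$2) * pR
      + v$3 * (R powr (-\<alpha>) * q' \<zeta> / sqrt R))) (at x)"
    unfolding pR \<zeta> by (rule partial_profile[OF R deriv_q]) (rule pr(4))
  show "partial 1 p x = 2 * x$1 * pR" "partial 3 p x = R powr (-\<alpha>) * q' \<zeta> / sqrt R"
    by (simp_all add: partial_eqI[OF D])
qed

definition G where "G z = a' z + \<alpha> * b z + z * b' z"

text \<open>The vector on the right is \<open>sqrt R\<close> times \<open>e_phi\<close>. All
  velocity derivatives collapse into the single function \<open>G\<close>, so \<open>G = 0\<close>
  removes the vorticity off the axis.\<close>

lemma curl_u:
  assumes R: "R = (x$1)\<^sup>2 + (x$2)\<^sup>2" "R > 0"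
  shows "curl u x = (R powr (-(\<alpha>+2)/2) * G (x$3 / sqrt R)) *\<^sub>R vector [- x$2, x$1, 0]"
proof -
  define \<zeta> where "\<zeta> = x$3 / sqrt R"
  note pu = partial_u[OF R \<zeta>_def refl refl refl refl refl]
  have p1: "R powr (-(\<alpha>+1)/2) = R powr (-(\<alpha>+2)/2) * sqrt R"
  proof -
    have "-(\<alpha>+1)/2 = -(\<alpha>+2)/2 + 1/2" by (simp add: field_simps)
    then show ?thesis using R by (simp only: powr_add powr_half_sqrt less_imp_le)
  qed
  have p2: "R powr (-\<alpha>/2 - 1) = R powr (-(\<alpha>+2)/2)"
    by (rule arg_cong[where f="\<lambda>y. R powr y"]) (simp add: field_simps)
  have p3: "R powr (-\<alpha>/2) = R powr (-(\<alpha>+2)/2) * R"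
  proof -
    have "-\<alpha>/2 = -(\<alpha>+2)/2 + 1" by (simp add: field_simps)
    then show ?thesis using R by (simp only: powr_add powr_one less_imp_le)
  qed
  have z: "x$3 = \<zeta> * sqrt R" using R(2) by (simp add: \<zeta>_def)
  show ?thesis
    unfolding curl_def pu p1 p2 p3 G_def \<zeta>_def[symmetric] vec3_eq_iff z
    using R(2) by (simp add: field_simps)
qed

text \<open>At (1, 0, z) one has \<open>R = 1\<close> and all powers of \<open>R\<close> disappear.
  The three lines are the divergence equation and the first and third components of the momentum
  equation.\<close>

lemma radial_equations:
  shows "b' z = z * a' z + (\<alpha> - 1) * a z"
    and "a z * (- \<alpha> * a z - z * a' z) + b z * a' z - 2 * \<alpha> * q z - z * q' z = 0"
    and "a z * (- \<alpha> * b z - z * b' z) + b z * b' z + q' z = 0"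
proof -
  define x where "x = (vector [1, 0, z] :: real^3)"
  have x: "x$1 = 1" "x$2 = 0" "x$3 = z" "x \<noteq> 0" by (simp_all add: x_def vec3_eq_iff)
  have R: "1 = (x$1)\<^sup>2 + (x$2)\<^sup>2" by (simp add: x)
  have \<zeta>: "z = x$3 / sqrt 1" by (simp add: x)
  have ux: "u x $ 1 = a z" "u x $ 2 = 0" "u x $ 3 = b z"
    using axisymmetric_profile[OF axi hom R] by (simp_all add: a_def b_def x)
  note pu = partial_u[OF R zero_less_one \<zeta> refl refl refl refl refl]
  note pp = partial_p[OF R zero_less_one \<zeta> refl]
  have "x \<in> - {0}" using x(4) by simp
  note e = euler[unfolded euler_classical_def, rule_format, OF this, THEN conjunct1]
    euler[unfolded euler_classical_def, rule_format, OF this, THEN conjunct2]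
  show "b' z = z * a' z + (\<alpha> - 1) * a z"
    using e(2) by (simp add: divergence_def sum_3 pu x field_simps)
  show "a z * (- \<alpha> * a z - z * a' z) + b z * a' z - 2 * \<alpha> * q z - z * q' z = 0"
    using arg_cong[OF e(1), of "\<lambda>v. v $ 1"]
    by (simp add: convection_def grad_def sum_3 pu pp x ux field_simps)
  show "a z * (- \<alpha> * b z - z * b' z) + b z * b' z + q' z = 0"
    using arg_cong[OF e(1), of "\<lambda>v. v $ 3"]
    by (simp add: convection_def grad_def sum_3 pu pp x ux field_simps)
qed

end

text \<open>A level set of a nonzero value is closed, and also open since the derivative vanishes
  near each of its points; so it is the whole line, and the limit at infinity makes the value 0.
  Differentiability is demanded only where \<open>f\<close> is nonzero because a power of |w| may
  fail to be differentiable at a zero of \<open>w\<close>.\<close>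

lemma deriv_zero_off_zeros_imp_zero:
  fixes f :: "real \<Rightarrow> real"
  assumes cont: "continuous_on UNIV f"
    and d: "\<And>z. f z \<noteq> 0 \<Longrightarrow> (f has_real_derivative 0) (at z)"
    and lim: "((\<lambda>s. f (1 / s)) \<longlongrightarrow> 0) (at_right 0)"
  shows "f z = 0"
proof (rule ccontr)
  assume z: "f z \<noteq> 0"
  define S where "S = {y. f y = f z}"
  have "closed S" unfolding S_def by (intro closed_Collect_eq cont continuous_intros)
  moreover have "open S"
  proof (rule openI)
    fix y assume y: "y \<in> S"
    have o: "open {t. f t \<noteq> 0}" by (intro open_Collect_neq cont continuous_intros)
    have "y \<in> {t. f t \<noteq> 0}" using y z by (simp add: S_def)
    from openE[OF o this] obtain e where e: "e > 0" "ball y e \<subseteq> {t. f t \<noteq> 0}"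
      by blast
    have "(f has_real_derivative 0) (at t within ball y e)" if "t \<in> ball y e" for t
      by (rule has_field_derivative_at_within[OF d]) (use subsetD[OF e(2) that] in simp)
    then have "\<exists>c. \<forall>t\<in>ball y e. f t = c"
      by (intro has_field_derivative_zero_constant convex_ball)
    then have "ball y e \<subseteq> S" using e(1) y centre_in_ball[of y e] by (auto simp: S_def)
    then show "\<exists>e>0. ball y e \<subseteq> S" using e(1) by blast
  qed
  ultimately have "S = UNIV"
    using z connected_UNIV by (auto simp: S_def connected_clopen)
  then have *: "f y = f z" for y by (auto simp: S_def)
  have "((\<lambda>s. f (1 / s)) \<longlongrightarrow> f z) (at_right 0)"
    by (rule tendsto_eventually, rule always_eventually) (use * in blast)
  from tendsto_unique[OF _ this lim] show False using z by simp
qed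

text \<open>Oddness and continuity force \<open>f 0 = 0\<close>, so \<open>f s / s\<close> is the
  difference quotient at 0. This controls quantities that axisymmetry makes odd across the axis and
  that are divided by the distance to it.\<close>

lemma odd_quotient_tendsto:
  fixes f :: "real \<Rightarrow> real"
  assumes f: "(f has_real_derivative L) (at 0)" and odd: "\<And>s. s > 0 \<Longrightarrow> f (- s) = - f s"
  shows "((\<lambda>s. f s / s) \<longlongrightarrow> L) (at_right 0)"
proof -
  have c: "isCont f 0" using f by (rule DERIV_isCont)
  have "((\<lambda>s. f s + f (- s)) \<longlongrightarrow> f 0 + f (- 0)) (at_right 0)"
  proof -
    have "isCont (\<lambda>s. f s + f (- s)) 0"
      using c isCont_o2[of 0 uminus f] by (intro isCont_add) auto
    then show ?thesis unfolding isCont_def by (rule tendsto_within_subset) simp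
  qed
  moreover have "((\<lambda>s. f s + f (- s)) \<longlongrightarrow> 0) (at_right 0)"
    by (rule tendsto_eventually) (use odd in \<open>auto simp: eventually_at_filter\<close>)
  ultimately have "f 0 = 0" using tendsto_unique[of "at_right (0::real)"] by fastforce
  then have "((\<lambda>s. f s / s) \<longlongrightarrow> L) (at 0)" using f by (simp add: DERIV_def)
  then show ?thesis by (rule tendsto_within_subset) simp
qed

section \<open>Stream function and Bernoulli function, and their size near the axis\<close>

context axisymmetric_flow
begin

definition w where "w z = b z - z * a z"
definition H where "H z = q z + ((a z)\<^sup>2 + (b z)\<^sup>2) / 2"

lemma deriv_w: "(w has_real_derivative (\<alpha> - 2) * a z) (at z)"
proof -
  have "((\<lambda>z. b z - z * a z) has_real_derivative b' z - (1 * a z + a' z * z)) (at z)"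
    by (intro derivative_intros deriv_a deriv_b)
  then show ?thesis unfolding w_def[abs_def] radial_equations(1) by (simp add: algebra_simps)
qed

text \<open>Adding \<open>z\<close> times the axial momentum equation to the radial one eliminates
  the derivative of the pressure.\<close>

lemma H_eq: "2 * \<alpha> * H z = w z * G z"
  using radial_equations[of z] unfolding H_def w_def G_def by algebra

lemma deriv_H: "(H has_real_derivative a z * G z) (at z)"
proof -
  have "((\<lambda>z. q z + ((a z)\<^sup>2 + (b z)\<^sup>2) / 2) has_real_derivative q' z + (a z * a' z + b z * b' z))
      (at z)"
    by (rule derivative_eq_intros deriv_a deriv_b deriv_q refl | simp)+
  moreover have "q' z + (a z * a' z + b z * b' z) = a z * G z"
    using radial_equations[of z] unfolding G_def by algebra
  ultimately show ?thesis unfolding H_def[abs_def] by simp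
qed

lemma continuous_partial: "continuous_on (- {0}) (partial i u)"
  using C1(1) by simp

lemma continuous_vector: "continuous_on S (\<lambda>z. vector [c, 0, z] :: real^3)"
  "continuous_on S (\<lambda>z. vector [z, 0, c] :: real^3)"
proof -
  have "vector [c, 0, z] = c *\<^sub>R axis 1 1 + z *\<^sub>R (axis 3 1 :: real^3)" for c z
    by (simp add: vec3_eq_iff)
  then show "continuous_on S (\<lambda>z. vector [c, 0, z] :: real^3)"
    "continuous_on S (\<lambda>z. vector [z, 0, c] :: real^3)"
    by (simp_all only:) (intro continuous_intros)+
qed

lemma continuous_G: "continuous_on UNIV G"
proof -
  have "continuous_on UNIV (\<lambda>z. partial 3 u (vector [1, 0, z]))"
    by (rule continuous_on_compose2[OF continuous_partial continuous_vector(1)]) (use vec_nz in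
        auto)
  then have "continuous_on UNIV a'" "continuous_on UNIV b'"
    unfolding a'_def[abs_def] b'_def[abs_def] by (auto intro!: continuous_intros)
  moreover have "continuous_on UNIV b"
    using deriv_b by (auto intro!: continuous_at_imp_continuous_on DERIV_isCont)
  ultimately show ?thesis unfolding G_def[abs_def] by (intro continuous_intros)
qed

lemma G_eq_zeroI:
  assumes U: "open U" "z \<in> U" and *: "\<And>y. y \<in> U \<Longrightarrow> a y = 0 \<and> b y = 0"
  shows "G z = 0"
proof -
  have "(a has_real_derivative 0) (at z)" "(b has_real_derivative 0) (at z)"
    using has_field_derivative_transform_within_open[OF DERIV_const[of 0] U] * by metis+
  then have "a' z = 0" "b' z = 0" using deriv_a deriv_b DERIV_unique by blast+
  then show ?thesis using * U by (simp add: G_def)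
qed

lemma ab_eq_zero_if_w:
  assumes "\<alpha> \<noteq> 2" and U: "open U" and *: "\<And>y. y \<in> U \<Longrightarrow> w y = 0" and y: "y \<in> U"
  shows "a y = 0 \<and> b y = 0"
proof -
  have "(w has_real_derivative 0) (at y)"
    using has_field_derivative_transform_within_open[OF DERIV_const[of 0] U y] * by metis
  then have "(\<alpha> - 2) * a y = 0" using deriv_w DERIV_unique by blast
  with assms show ?thesis using *[OF y] by (auto simp: w_def)
qed

text \<open>The conservation laws say nothing where \<open>w = 0\<close>. If \<open>G\<close> were
  nonzero somewhere, then \<open>w\<close> would vanish on the open set where \<open>G\<close> does
  not; there w' = (\<alpha> - 2) a gives \<open>a = 0\<close>, then \<open>b = 0\<close>, and hence
  \<open>G = 0\<close>.\<close>

lemma G_eq_zero_if_w: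
  assumes "\<alpha> \<noteq> 2" "\<And>z. w z \<noteq> 0 \<Longrightarrow> G z = 0"
  shows "G z = 0"
proof (rule ccontr)
  assume z: "G z \<noteq> 0"
  have U: "open {y. G y \<noteq> 0}" by (intro open_Collect_neq continuous_G continuous_intros)
  have "G z = 0"
    by (rule G_eq_zeroI[OF U]) (use z assms ab_eq_zero_if_w[OF assms(1) U] in auto)
  with z show False by simp
qed

lemma vec_sq: "s > 0 \<Longrightarrow> s\<^sup>2 = ((vector [s, 0, 1] :: real^3)$1)\<^sup>2 + ((vector [s, 0, 1] ::
    real^3)$2)\<^sup>2"
  "s > 0 \<Longrightarrow> s\<^sup>2 = ((vector [- s, 0, 1] :: real^3)$1)\<^sup>2 + ((vector [- s, 0, 1] :: real^3)$2)\<^sup>2"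
  by simp_all

lemma sq_powr: "s > 0 \<Longrightarrow> (s\<^sup>2) powr (t / 2) = s powr t" for s :: real
  by (simp add: powr_powr flip: powr_numeral)

text \<open>Scaling (1, 0, 1/s) by \<open>s\<close> gives (s, 0, 1), so the end of the line at
  infinity corresponds to the axis point (0, 0, 1), where the flow is regular. The powers of
  \<open>s\<close> come from homogeneity. The reflected point (-s, 0, 1) supplies the oddness needed
  for \<open>odd_quotient_tendsto\<close>.\<close>

lemma profile_near_axis:
  assumes s: "s > 0"
  shows "a (1 / s) = s powr \<alpha> * u (vector [s, 0, 1]) $ 1"
    and "b (1 / s) = s powr \<alpha> * u (vector [s, 0, 1]) $ 3"
    and "q (1 / s) = s powr (2 * \<alpha>) * p (vector [s, 0, 1])"
    and "u (vector [s, 0, 1]) $ 2 = 0"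
    and "u (vector [- s, 0, 1]) $ 1 = - u (vector [s, 0, 1]) $ 1"
    and "G (1 / s) = s powr (\<alpha> + 2) * (curl u (vector [s, 0, 1]) $ 2 / s)"
    and "curl u (vector [- s, 0, 1]) $ 2 = - curl u (vector [s, 0, 1]) $ 2"
proof -
  have s2: "s\<^sup>2 > 0" "sqrt (s\<^sup>2) = s" using s by auto
  note pr = axisymmetric_profile[OF axi hom vec_sq(1)[OF s] s2(1), folded a_def b_def q_def]
  note pr' = axisymmetric_profile[OF axi hom vec_sq(2)[OF s] s2(1), folded a_def b_def q_def]
  note cu = curl_u[OF vec_sq(1)[OF s] s2(1)] curl_u[OF vec_sq(2)[OF s] s2(1)]
  have p1: "(s\<^sup>2) powr (-(\<alpha>+1)/2) * s = s powr (- \<alpha>)"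
  proof -
    have "s powr (-(\<alpha>+1)) * s = s powr (-(\<alpha>+1) + 1)" using s
        by (simp only: powr_add powr_one less_imp_le)
    then show ?thesis unfolding sq_powr[OF s] by simp
  qed
  have p2: "(s\<^sup>2) powr (-\<alpha>/2) = s powr (- \<alpha>)" "(s\<^sup>2) powr (-\<alpha>) = s powr (- (2 * \<alpha>))"
    using sq_powr[OF s, of "-\<alpha>"] sq_powr[OF s, of "-(2*\<alpha>)"] by simp_all
  have p3: "(s\<^sup>2) powr (-(\<alpha>+2)/2) = s powr (-(\<alpha>+2))" using sq_powr[OF s] by simp
  have i: "s powr t * s powr (- t) = 1" for t using s by (simp add: powr_minus)
  have u1: "u (vector [s, 0, 1]) $ 1 = s powr (-\<alpha>) * a (1/s)"
    using pr(1) by (simp add: abs_of_pos[OF s] p1[symmetric] mult_ac)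
  have u3: "u (vector [s, 0, 1]) $ 3 = s powr (-\<alpha>) * b (1/s)"
    using pr(3) p2 by (simp add: abs_of_pos[OF s])
  have p: "p (vector [s, 0, 1]) = s powr (- (2 * \<alpha>)) * q (1/s)"
    using pr(4) p2 by (simp add: abs_of_pos[OF s])
  show "a (1 / s) = s powr \<alpha> * u (vector [s, 0, 1]) $ 1"
    unfolding u1 mult.assoc[symmetric] i by simp
  show "b (1 / s) = s powr \<alpha> * u (vector [s, 0, 1]) $ 3"
    unfolding u3 mult.assoc[symmetric] i by simp
  show "q (1 / s) = s powr (2 * \<alpha>) * p (vector [s, 0, 1])"
    unfolding p mult.assoc[symmetric] i by simp
  show "u (vector [s, 0, 1]) $ 2 = 0" using pr(2) by simp
  show "u (vector [- s, 0, 1]) $ 1 = - u (vector [s, 0, 1]) $ 1"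
    using pr(1) pr'(1) by simp
  have c: "curl u (vector [s, 0, 1]) $ 2 = s powr (-(\<alpha>+2)) * G (1 / s) * s"
    unfolding cu p3 by (simp add: abs_of_pos[OF s])
  then show "G (1 / s) = s powr (\<alpha> + 2) * (curl u (vector [s, 0, 1]) $ 2 / s)"
    unfolding c using i[of "\<alpha> + 2"] s by (simp add: mult.assoc[symmetric])
  show "curl u (vector [- s, 0, 1]) $ 2 = - curl u (vector [s, 0, 1]) $ 2"
    unfolding cu by simp
qed

lemma vec_line1: "vector [0, 0, 1] + t *\<^sub>R axis 1 1 = (vector [t, 0, 1] :: real^3)"
  by (simp add: vec3_eq_iff)

lemma vec_nz1: "vector [s, 0, 1] \<noteq> (0 :: real^3)"
  by (simp add: vec3_eq_iff)

lemma tendsto_near_axis: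
  fixes f :: "real^3 \<Rightarrow> 'a::real_normed_vector"
  assumes "continuous_on (- {0}) f"
  shows "((\<lambda>s. f (vector [s, 0, 1])) \<longlongrightarrow> f (vector [0, 0, 1])) (at_right 0)"
proof -
  have "continuous_on UNIV (\<lambda>s. f (vector [s, 0, 1]))"
    by (rule continuous_on_compose2[OF assms continuous_vector(2)]) (use vec_nz1 in auto)
  then have "isCont (\<lambda>s. f (vector [s, 0, 1])) 0" by (simp add: continuous_on_eq_continuous_at)
  then show ?thesis unfolding isCont_def by (rule tendsto_within_subset) simp
qed

lemma continuous_up: "continuous_on (- {0}) u" "continuous_on (- {0}) p"
  using differentiable by (auto intro!: continuous_at_imp_continuous_on
      differentiable_imp_continuous_within)

text \<open>In \<open>w = b - z * a\<close> the factor \<open>z = 1 / s\<close> is singular, but the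
  radial velocity is odd in \<open>s\<close>, so its quotient by \<open>s\<close> converges to its
  derivative on the axis.\<close>

lemma w_near_axis: obtains W L where "(W \<longlongrightarrow> L) (at_right 0)" "\<And>s. s > 0 \<Longrightarrow> w (1 / s) = s powr \<alpha> * W s"
proof -
  have "((\<lambda>s. u (vector [s, 0, 1])) has_vector_derivative partial 1 u (vector [0, 0, 1])) (at 0)"
    using partial_has_vector_derivative[OF differentiable(1)[OF vec_nz1], of 0 1]
        by (simp only: vec_line1)
  from bounded_linear.has_vector_derivative[OF bounded_linear_vec_nth this, of 1]
  have "((\<lambda>s. u (vector [s, 0, 1]) $ 1) has_real_derivative partial 1 u (vector [0, 0, 1]) $ 1)
      (at 0)"
    by (simp add: has_real_derivative_iff_has_vector_derivative)
  from odd_quotient_tendsto[OF this profile_near_axis(5)]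
  have "((\<lambda>s. u (vector [s, 0, 1]) $ 3 - u (vector [s, 0, 1]) $ 1 / s) \<longlongrightarrow>
      u (vector [0, 0, 1]) $ 3 - partial 1 u (vector [0, 0, 1]) $ 1) (at_right 0)"
    by (intro tendsto_intros tendsto_near_axis continuous_up)
  moreover have "w (1 / s) = s powr \<alpha> * (u (vector [s, 0, 1]) $ 3 - u (vector [s, 0, 1]) $ 1 / s)"
      if "s > 0" for s
    unfolding w_def profile_near_axis(1,2)[OF that] by (simp add: algebra_simps)
  ultimately show ?thesis using that by blast
qed

lemma H_near_axis: obtains W L where "(W \<longlongrightarrow> L) (at_right 0)" "\<And>s. s > 0 \<Longrightarrow> H (1 / s) =
    s powr (2 * \<alpha>) * W s"
proof -
  have "((\<lambda>s. p (vector [s, 0, 1]) + ((u (vector [s, 0, 1]) $ 1)\<^sup>2 + (u (vector [s, 0, 1]) $ 3)\<^sup>2)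
      / 2) \<longlongrightarrow>
      p (vector [0, 0, 1]) + ((u (vector [0, 0, 1]) $ 1)\<^sup>2 + (u (vector [0, 0, 1]) $ 3)\<^sup>2) / 2)
          (at_right 0)"
    by (intro tendsto_intros tendsto_near_axis continuous_up) simp
  moreover have "H (1 / s) = s powr (2 * \<alpha>) *
      (p (vector [s, 0, 1]) + ((u (vector [s, 0, 1]) $ 1)\<^sup>2 + (u (vector [s, 0, 1]) $ 3)\<^sup>2) /
          2)" if "s > 0" for s
  proof -
    have "s powr (2 * \<alpha>) = s powr \<alpha> * s powr \<alpha>" by (simp flip: powr_add)
    then show ?thesis
      unfolding H_def profile_near_axis(1,2,3)[OF that]
          by (simp add: algebra_simps power2_eq_square)
  qed
  ultimately show ?thesis using that by blast
qed

text \<open>The quantity \<open>\<bar>w\<bar>\<^bsup>\<kappa>/(2-\<alpha>)\<^esup> K\<close> is conserved along the flow; the exponent is positive, so it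
  vanishes on the axis.\<close>

lemma conserved_imp_zero:
  assumes \<alpha>: "\<alpha> < 2" "\<kappa> > 0"
    and K: "\<And>z. (K has_real_derivative K' z) (at z)" "\<And>z. w z * K' z = \<kappa> * a z * K z"
    and P: "(P \<longlongrightarrow> L) (at_right 0)" "\<And>s. s > 0 \<Longrightarrow> K (1 / s) = s powr \<kappa> * P s"
    and z: "w z \<noteq> 0"
  shows "K z = 0"
proof -
  \<comment> \<open>Chosen so that differentiating the power of |w| produces
    \<open>- \<kappa> * a * K\<close>, which cancels \<open>w * K'\<close>.\<close>
  define m where "m = \<kappa> / (2 - \<alpha>)"
  have m: "m > 0" "m * (\<alpha> - 2) = - \<kappa>" using \<alpha> by (auto simp: m_def field_simps)
  define f where "f = (\<lambda>z. \<bar>w z\<bar> powr m * K z)"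
  have cw: "continuous_on UNIV w" and cK: "continuous_on UNIV K"
    using deriv_w K(1) by (auto intro!: continuous_at_imp_continuous_on DERIV_isCont)
  have "f z = 0"
  proof (rule deriv_zero_off_zeros_imp_zero[of f])
    show "continuous_on UNIV f" unfolding f_def
      by (intro continuous_on_mult continuous_on_powr' continuous_on_const continuous_on_rabs cw
          cK) (use m in auto)
    show "(f has_real_derivative 0) (at y)" if "f y \<noteq> 0" for y
    proof -
      have y: "w y \<noteq> 0" using that by (auto simp: f_def)
      have "((\<lambda>y. \<bar>w y\<bar>) has_real_derivative sgn (w y) * ((\<alpha> - 2) * a y)) (at y)"
        using DERIV_chain2[OF has_real_derivative_abs[OF y] deriv_w] by simp
      from DERIV_fun_powr[OF this, of m] y
      have "((\<lambda>y. \<bar>w y\<bar> powr m) has_real_derivative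
          m * \<bar>w y\<bar> powr (m - 1) * (sgn (w y) * ((\<alpha> - 2) * a y))) (at y)"
        by (simp add: mult_ac)
      from DERIV_mult[OF this K(1)]
      have D: "(f has_real_derivative m * \<bar>w y\<bar> powr (m - 1) * (sgn (w y) * ((\<alpha> - 2) * a y)) * K y
          + K' y * \<bar>w y\<bar> powr m) (at y)" unfolding f_def .
      have "\<bar>w y\<bar> powr ((m - 1) + 1) = \<bar>w y\<bar> powr (m - 1) * \<bar>w y\<bar>"
        by (simp only: powr_add powr_one abs_ge_zero)
      moreover have "\<bar>w y\<bar> = sgn (w y) * w y" by (simp add: sgn_if)
      ultimately have pm: "\<bar>w y\<bar> powr m = \<bar>w y\<bar> powr (m - 1) * (sgn (w y) * w y)" by simp
      have "m * \<bar>w y\<bar> powr (m - 1) * (sgn (w y) * ((\<alpha> - 2) * a y)) * K y + K' y * \<bar>w y\<bar> powr m =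
          \<bar>w y\<bar> powr (m - 1) * sgn (w y) * (m * (\<alpha> - 2) * a y * K y + w y * K' y)"
        unfolding pm by algebra
      also have "\<dots> = 0" unfolding m K(2) by simp
      finally show ?thesis using D by simp
    qed
    obtain W l where W: "(W \<longlongrightarrow> l) (at_right 0)" "\<And>s. s > 0 \<Longrightarrow> w (1 / s) = s powr \<alpha> * W s"
      using w_near_axis by blast
    \<comment> \<open>Since \<open>\<kappa> = m * (2 - \<alpha>)\<close>, the total power of
      \<open>s\<close> is \<open>2 * m\<close>, positive for negative \<open>\<alpha>\<close> as
      well.\<close>
    have e: "\<alpha> * m + \<kappa> > 0"
    proof -
      have "\<alpha> * m + \<kappa> = 2 * m" using m by (simp add: algebra_simps)
      then show ?thesis using m by simp
    qed
    have "((\<lambda>s. s powr (\<alpha> * m + \<kappa>) * (\<bar>W s\<bar> powr m * P s)) \<longlongrightarrow> 0 * (\<bar>l\<bar> powr m * L)) (at_right 0)"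
      by (intro tendsto_mult tendsto_zero_powrI[OF tendsto_ident_at tendsto_const _ e]
          tendsto_powr2 tendsto_rabs W(1) P(1) m tendsto_const)
        (auto simp: eventually_at_filter)
    then have *: "((\<lambda>s. s powr (\<alpha> * m + \<kappa>) * (\<bar>W s\<bar> powr m * P s)) \<longlongrightarrow> 0) (at_right 0)" by simp
    show "((\<lambda>s. f (1 / s)) \<longlongrightarrow> 0) (at_right 0)"
    proof (rule Lim_transform_eventually[OF *], unfold eventually_at_filter, intro
        always_eventually allI impI)
      fix s :: real assume "s \<in> {0<..}"
      then have s: "s > 0" by simp
      show "s powr (\<alpha> * m + \<kappa>) * (\<bar>W s\<bar> powr m * P s) = f (1 / s)"
        unfolding f_def W(2)[OF s] P(2)[OF s]
        by (simp add: abs_mult powr_mult powr_powr powr_add mult_ac)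
    qed
  qed
  then show ?thesis using z by (simp add: f_def)
qed

text \<open>The conserved quantity is built from \<open>H\<close>, which needs only first
  derivatives of the flow, with \<open>\<kappa> = 2 * \<alpha>\<close>. At
  \<open>\<alpha> = 2\<close> the exponent degenerates: \<open>w\<close> is constant and vanishes at
  the axis, so \<open>H = 0\<close> and \<open>a * G = 0\<close>; where \<open>G\<close> is nonzero
  this gives \<open>a = 0\<close> and, as \<open>w = 0\<close>, also \<open>b = 0\<close>.\<close>

lemma G_eq_zero_C1:
  assumes "0 < \<alpha>" "\<alpha> \<le> 2"
  shows "G z = 0"
proof (cases "\<alpha> = 2")
  case False
  show ?thesis
  proof (rule G_eq_zero_if_w[OF False])
    fix z assume z: "w z \<noteq> 0"
    obtain P L where P: "(P \<longlongrightarrow> L) (at_right 0)" "\<And>s. s > 0 \<Longrightarrow> H (1 / s) = s powr (2 * \<alpha>) * P s"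
      using H_near_axis by blast
    have "H z = 0"
    proof (rule conserved_imp_zero[OF _ _ deriv_H _ P z])
      show "w z * (a z * G z) = 2 * \<alpha> * a z * H z" for z
        using H_eq[of z] by (simp add: algebra_simps)
    qed (use assms False in auto)
    then show "G z = 0" using H_eq[of z] z by simp
  qed
next
  case True
  have "w z = 0" for z
  proof (rule deriv_zero_off_zeros_imp_zero[of w])
    show d: "(w has_real_derivative 0) (at y)" for y using deriv_w[of y] True by simp
    then show "continuous_on UNIV w" by (auto intro!: continuous_at_imp_continuous_on DERIV_isCont)
    obtain W l where W: "(W \<longlongrightarrow> l) (at_right 0)" "\<And>s. s > 0 \<Longrightarrow> w (1 / s) = s powr \<alpha> * W s"
      using w_near_axis by blast
    have "((\<lambda>s. s powr \<alpha> * W s) \<longlongrightarrow> 0 * l) (at_right 0)"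
      by (intro tendsto_mult W(1) tendsto_zero_powrI[OF tendsto_ident_at tendsto_const])
        (use assms in \<open>auto simp: eventually_at_filter\<close>)
    then have *: "((\<lambda>s. s powr \<alpha> * W s) \<longlongrightarrow> 0) (at_right 0)" by simp
    show "((\<lambda>s. w (1 / s)) \<longlongrightarrow> 0) (at_right 0)"
      by (rule Lim_transform_eventually[OF *]) (use W(2) in \<open>auto simp: eventually_at_filter\<close>)
  qed
  then have w: "w = (\<lambda>_. 0)" by auto
  then have "H = (\<lambda>_. 0)" using H_eq True by auto
  then have aG: "a z * G z = 0" for z using deriv_H[of z] DERIV_unique[OF DERIV_const] by fastforce
  show ?thesis
  proof (rule ccontr)
    assume z: "G z \<noteq> 0"
    have U: "open {y. G y \<noteq> 0}" by (intro open_Collect_neq continuous_G continuous_intros)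
    have "b y = y * a y" for y using fun_cong[OF w, of y] by (simp add: w_def)
    with z aG have "G z = 0" by (intro G_eq_zeroI[OF U]) auto
    with z show False by simp
  qed
qed

lemma continuous_curl: "continuous_on (- {0}) (\<lambda>x. curl u x $ j)"
proof -
  have "continuous_on (- {0}) (\<lambda>x. partial 2 u x $ 3 - partial 3 u x $ 2)"
    "continuous_on (- {0}) (\<lambda>x. partial 3 u x $ 1 - partial 1 u x $ 3)"
    "continuous_on (- {0}) (\<lambda>x. partial 1 u x $ 2 - partial 2 u x $ 1)"
    by (intro continuous_intros continuous_partial)+
  then show ?thesis using exhaust_3[of j] by (auto simp: curl_def)
qed

lemma curl_eq_zero:
  assumes G: "\<And>z. G z = 0" and x: "x \<noteq> 0"
  shows "curl u x = 0"
proof (cases "(x$1)\<^sup>2 + (x$2)\<^sup>2 > 0")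
  case True
  show ?thesis unfolding curl_u[OF refl True] G by simp
next
  case False
  then have x12: "x$1 = 0" "x$2 = 0" by (auto simp: not_less sum_power2_le_zero_iff)
  then have x3: "x$3 \<noteq> 0" using x by (auto simp: vec3_eq_iff)
  have "curl u x $ j = 0" for j
  proof -
    \<comment> \<open>An axis point is approached horizontally; \<open>curl_u\<close> applies at
      every nearby point, and continuity of the vorticity does the rest.\<close>
    define f where "f = (\<lambda>t. curl u (x + t *\<^sub>R axis 1 1) $ j)"
    have "continuous_on UNIV f" unfolding f_def
      by (rule continuous_on_compose2[OF continuous_curl]) (use x3 in \<open>auto simp: vec3_eq_iff
          intro!: continuous_intros\<close>)
    then have "isCont f 0" by (simp add: continuous_on_eq_continuous_at)
    then have "(f \<longlongrightarrow> f 0) (at 0)" by (simp add: isCont_def)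
    moreover have "f t = 0" if "t \<noteq> 0" for t
    proof -
      have "((x + t *\<^sub>R axis 1 1)$1)\<^sup>2 + ((x + t *\<^sub>R axis 1 1)$2)\<^sup>2 > 0" using that x12 by simp
      from curl_u[OF refl this] show ?thesis unfolding f_def G by simp
    qed
    then have "(f \<longlongrightarrow> 0) (at 0)"
      by (intro tendsto_eventually) (simp add: eventually_at_filter)
    ultimately have "f 0 = 0" using tendsto_unique[of "at (0::real)"] by fastforce
    then show ?thesis by (simp add: f_def)
  qed
  then show ?thesis by (simp add: vec_eq_iff)
qed

lemma not_rotational: "(\<And>z. G z = 0) \<Longrightarrow> \<not> rotational u"
  using curl_eq_zero by (simp add: rotational_def)

end

section \<open>Vorticity transport for flows with two derivatives\<close>

locale axisymmetric_flow_C2 = axisymmetric_flow +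
  assumes C2: "Ck_on 2 u (- {0})"
begin

lemma C1_partial: "Ck_on (Suc 0) (partial i u) (- {0})"
  using C2 by (simp add: numeral_2_eq_2)

definition G' where "G' z = partial 3 (partial 3 u) (vector [1, 0, z]) $ 1
  + \<alpha> * b' z + (b' z + z * partial 3 (partial 3 u) (vector [1, 0, z]) $ 3)"

lemma deriv_G: "(G has_real_derivative G' z) (at z)"
proof -
  have d: "partial 3 u differentiable (at (vector [1, 0, z]))"
    using C1_partial[of 3] vec_nz by simp
  have "((\<lambda>t. partial 3 u (vector [1, 0, z + t])) has_vector_derivative partial 3 (partial 3 u)
      (vector [1, 0, z])) (at 0)"
    using partial_has_vector_derivative[OF d, of 3] by (simp only: vec_line)
  from bounded_linear.has_vector_derivative[OF bounded_linear_vec_nth this]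
  have "((\<lambda>t. partial 3 u (vector [1, 0, t + z]) $ j) has_real_derivative partial 3 (partial 3 u)
      (vector [1, 0, z]) $ j) (at 0)" for j
    by (simp only: has_real_derivative_iff_has_vector_derivative add.commute[of _ z])
  then have "((\<lambda>t. partial 3 u (vector [1, 0, t]) $ j) has_real_derivative partial 3 (partial 3 u)
      (vector [1, 0, z]) $ j) (at z)" for j
    using DERIV_shift[of "\<lambda>t. partial 3 u (vector [1, 0, t]) $ j" _ 0 z] by simp
  then have da: "(a' has_real_derivative partial 3 (partial 3 u) (vector [1, 0, z]) $ 1) (at z)"
    and db: "(b' has_real_derivative partial 3 (partial 3 u) (vector [1, 0, z]) $ 3) (at z)"
    unfolding a'_def[abs_def] b'_def[abs_def] by auto
  have "((\<lambda>z. a' z + \<alpha> * b z + z * b' z) has_real_derivative G' z) (at z)"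
    unfolding G'_def by (rule derivative_eq_intros da db deriv_b refl | simp)+
  then show ?thesis unfolding G_def[abs_def] .
qed

lemma continuous_G': "continuous_on UNIV G'"
proof -
  have "continuous_on (- {0}) (partial 3 (partial 3 u))" using C1_partial[of 3] by simp
  then have "continuous_on UNIV (\<lambda>z. partial 3 (partial 3 u) (vector [1, 0, z]))"
    by (rule continuous_on_compose2[OF _ continuous_vector(1)]) (use vec_nz in auto)
  moreover have "continuous_on UNIV (\<lambda>z. partial 3 u (vector [1, 0, z]))"
    by (rule continuous_on_compose2[OF continuous_partial continuous_vector(1)]) (use vec_nz in
        auto)
  ultimately show ?thesis
    unfolding G'_def[abs_def] b'_def by (intro continuous_intros)
qed

text \<open>Obtained by differentiating \<open>H_eq\<close>: the left side through
  \<open>deriv_H\<close>, the right side by the product rule. No second-order form of the Euler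
  equations is involved.\<close>

lemma G_transport: "w z * G' z = (\<alpha> + 2) * a z * G z"
proof -
  have "((\<lambda>z. 2 * \<alpha> * H z) has_real_derivative 2 * \<alpha> * (a z * G z)) (at z)"
    by (rule DERIV_cmult[OF deriv_H])
  moreover have "((\<lambda>z. 2 * \<alpha> * H z) has_real_derivative (\<alpha> - 2) * a z * G z + G' z * w z) (at z)"
    unfolding H_eq by (rule DERIV_mult[OF deriv_w deriv_G])
  ultimately have "2 * \<alpha> * (a z * G z) = (\<alpha> - 2) * a z * G z + G' z * w z"
    by (rule DERIV_unique)
  then show ?thesis by algebra
qed

text \<open>The azimuthal vorticity is odd across the axis and differentiable there, so its quotient
  by \<open>s\<close> has a limit; this is the continuous extension of the vorticity over
  \<open>r\<close>.\<close>

lemma G_near_axis: obtains W L where "(W \<longlongrightarrow> L) (at_right 0)" "\<And>s. s > 0 \<Longrightarrow> G (1 / s) =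
    s powr (\<alpha> + 2) * W s"
proof -
  define c where "c = (\<lambda>s. curl u (vector [s, 0, 1]) $ 2)"
  have "((\<lambda>s. partial i u (vector [s, 0, 1])) has_vector_derivative partial 1 (partial i u)
      (vector [0, 0, 1])) (at 0)" for i
    using partial_has_vector_derivative[of "partial i u" "vector [0, 0, 1]" 1] C1_partial[of i]
        vec_nz1[of 0]
    by (simp add: vec_line1)
  from bounded_linear.has_vector_derivative[OF bounded_linear_vec_nth this]
  have "((\<lambda>s. partial i u (vector [s, 0, 1]) $ j) has_real_derivative partial 1 (partial i u)
      (vector [0, 0, 1]) $ j) (at 0)" for i j
    by (simp only: has_real_derivative_iff_has_vector_derivative)
  from DERIV_diff[OF this[of 3 1] this[of 1 3]]
  have "(c has_real_derivative partial 1 (partial 3 u) (vector [0, 0, 1]) $ 1 - partial 1 (partial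
      1 u) (vector [0, 0, 1]) $ 3) (at 0)"
    unfolding c_def curl_def by simp
  from odd_quotient_tendsto[OF this] profile_near_axis(7)
  have "((\<lambda>s. c s / s) \<longlongrightarrow> partial 1 (partial 3 u) (vector [0, 0, 1]) $ 1 - partial 1 (partial 1 u)
      (vector [0, 0, 1]) $ 3) (at_right 0)"
    unfolding c_def by simp
  then show ?thesis using profile_near_axis(6) that unfolding c_def by blast
qed

lemma G_eq_zero_C2:
  assumes "-2 < \<alpha>" "\<alpha> < 2"
  shows "G z = 0"
proof (rule G_eq_zero_if_w)
  fix z assume z: "w z \<noteq> 0"
  obtain P L where P: "(P \<longlongrightarrow> L) (at_right 0)" "\<And>s. s > 0 \<Longrightarrow> G (1 / s) = s powr (\<alpha> + 2) * P s"
    using G_near_axis by blast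
  show "G z = 0"
    by (rule conserved_imp_zero[OF _ _ deriv_G G_transport P z]) (use assms in auto)
qed (use assms in auto)

text \<open>The transport law reads \<open>w * G' = 0\<close>. Where \<open>G'\<close> is nonzero,
  \<open>w\<close> vanishes on an open set and therefore \<open>G = 0\<close>; so
  \<open>G' = 0\<close> wherever \<open>G\<close> is nonzero. No power of \<open>s\<close> provides
  decay here, and the limit at the axis has to be assumed.\<close>

lemma G_eq_zero_minus2:
  assumes \<alpha>: "\<alpha> = -2" and lim: "((\<lambda>s. G (1 / s)) \<longlongrightarrow> 0) (at_right 0)"
  shows "G z = 0"
proof (rule deriv_zero_off_zeros_imp_zero[of G])
  show "(G has_real_derivative 0) (at y)" if y: "G y \<noteq> 0" for y
  proof (rule ccontr)
    assume "\<not> (G has_real_derivative 0) (at y)"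
    then have "G' y \<noteq> 0" using deriv_G[of y] by auto
    define U where "U = {t. G' t \<noteq> 0}"
    have U: "open U" unfolding U_def by (intro open_Collect_neq continuous_G' continuous_intros)
    have "w t = 0" if "t \<in> U" for t using G_transport[of t] that \<alpha> by (simp add: U_def)
    from ab_eq_zero_if_w[OF _ U this] have "G y = 0"
      by (intro G_eq_zeroI[OF U]) (use \<alpha> \<open>G' y \<noteq> 0\<close> in \<open>auto simp: U_def\<close>)
    with y show False by simp
  qed
qed (use continuous_G lim in auto)

end

lemma punctured_solution_flow:
  assumes "punctured_solution 1 \<alpha> u p"
  shows "axisymmetric_flow \<alpha> u p"
  using assms unfolding punctured_solution_def axisymmetric_flow_def by blast

lemma punctured_solution_flow_C2:
  assumes "punctured_solution 2 \<alpha> u p"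
  shows "axisymmetric_flow_C2 \<alpha> u p"
proof -
  have "Ck_on 2 u (- {0})" "Ck_on 2 p (- {0})" using assms by (auto simp: punctured_solution_def)
  then have "Ck_on 1 u (- {0})" "Ck_on 1 p (- {0})"
    using Ck_on_SucD[of 1 u] Ck_on_SucD[of 1 p] by (simp_all only: Suc_1)
  then show ?thesis
    using assms unfolding punctured_solution_def axisymmetric_flow_C2_def axisymmetric_flow_def
      axisymmetric_flow_C2_axioms_def by blast
qed

lemma no_punctured_solution_C1:
  assumes "0 < \<alpha>" "\<alpha> \<le> 2"
  shows "\<not> punctured_solution 1 \<alpha> u p"
proof
  assume *: "punctured_solution 1 \<alpha> u p"
  interpret axisymmetric_flow \<alpha> u p by (rule punctured_solution_flow[OF *])
  show False using not_rotational[OF G_eq_zero_C1[OF assms]] * by (simp add: punctured_solution_def)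
qed

lemma no_punctured_solution_C2:
  assumes "-2 < \<alpha>" "\<alpha> < 2"
  shows "\<not> punctured_solution 2 \<alpha> u p"
proof
  assume *: "punctured_solution 2 \<alpha> u p"
  interpret axisymmetric_flow_C2 \<alpha> u p by (rule punctured_solution_flow_C2[OF *])
  show False using not_rotational[OF G_eq_zero_C2[OF assms]] * by (simp add: punctured_solution_def)
qed

lemma no_punctured_solution_minus2:
  assumes *: "punctured_solution 2 (-2) u p" and v: "vorticity_over_r_vanishes_on_axis u"
  shows False
proof -
  interpret axisymmetric_flow_C2 "-2" u p by (rule punctured_solution_flow_C2[OF *])
  obtain W where W: "continuous_on (- {0}) W"
    "\<And>r \<phi> z. r > 0 \<Longrightarrow> W (cyl r \<phi> z) = (curl u (cyl r \<phi> z) \<bullet> e_phi \<phi>) / r"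
    "\<And>z. z \<noteq> 0 \<Longrightarrow> W (vector [0, 0, z]) = 0"
    using v unfolding vorticity_over_r_vanishes_on_axis_def by blast
  \<comment> \<open>At \<open>\<alpha> = -2\<close> the factor \<open>s powr (\<alpha> + 2)\<close>
    equals 1.\<close>
  have "W (vector [s, 0, 1]) = G (1 / s)" if s: "s > 0" for s
  proof -
    have "cyl s 0 1 = vector [s, 0, 1]" by (simp add: vec3_eq_iff)
    then show ?thesis using W(2)[OF s, of 0 1] profile_near_axis(6)[OF s] s by (simp add: inner_3)
  qed
  moreover have "((\<lambda>s. W (vector [s, 0, 1])) \<longlongrightarrow> 0) (at_right 0)"
    using tendsto_near_axis[OF W(1)] W(3)[of 1] by simp
  ultimately have "((\<lambda>s. G (1 / s)) \<longlongrightarrow> 0) (at_right 0)"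
    by (elim Lim_transform_eventually) (auto simp: eventually_at_filter)
  then show False
    using not_rotational[OF G_eq_zero_minus2] * by (simp add: punctured_solution_def)
qed

section \<open>Existence of minimisers\<close>

text \<open>Level \<open>n\<close> cuts [-1, 1] into \<open>2 * 2 ^ n\<close> cells: index 0 is -1
  and index \<open>2 * 2 ^ n\<close> is 1. The levels are nested.\<close>

definition grid :: "nat \<Rightarrow> nat \<Rightarrow> real" where "grid n i = i / 2 ^ n - 1"

text \<open>The integral of \<open>v' w'\<close> over \<open>[-1, 1]\<close>, with derivatives replaced by difference
  quotients on the grid of mesh \<open>2\<^sup>-\<^sup>n\<close>.\<close>

definition grid_form :: "nat \<Rightarrow> (real \<Rightarrow> real) \<Rightarrow> (real \<Rightarrow> real) \<Rightarrow> real" where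
  "grid_form n v w = 2 ^ n * (\<Sum>i<2 * 2 ^ n. (v (grid n (Suc i)) - v (grid n i)) * (w (grid n (Suc
      i)) - w (grid n i)))"

abbreviation grid_energy :: "nat \<Rightarrow> (real \<Rightarrow> real) \<Rightarrow> real" where "grid_energy n w \<equiv> grid_form n w w"

lemma grid_double: "grid (Suc n) (2 * i) = grid n i"
  by (simp add: grid_def)

lemma grid_bounds: "i \<le> 2 * 2 ^ n \<Longrightarrow> grid n i \<in> {-1..1}"
proof -
  assume "i \<le> 2 * 2 ^ n"
  then have "real i \<le> 2 * 2 ^ n" using of_nat_le_iff[of i "2 * 2 ^ n", where 'a=real] by simp
  then show ?thesis by (simp add: grid_def field_simps)
qed

lemma sum_double: "(\<Sum>j<2 * M. f j) = (\<Sum>i<M. f (2 * i) + f (Suc (2 * i)) :: real)" for M :: nat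
  by (induction M) (simp_all add: algebra_simps)

lemma grid_energy_nonneg: "grid_energy n w \<ge> 0"
  unfolding grid_form_def by (simp add: sum_nonneg)

lemma grid_form_Suc: "grid_form (Suc n) v w = 2 * 2 ^ n * (\<Sum>i<2 * 2 ^ n.
    (v (grid (Suc n) (Suc (2 * i))) - v (grid n i)) * (w (grid (Suc n) (Suc (2 * i))) - w (grid n
        i)) +
    (v (grid n (Suc i)) - v (grid (Suc n) (Suc (2 * i)))) * (w (grid n (Suc i)) - w (grid (Suc n)
        (Suc (2 * i)))))"
proof -
  have "grid (Suc n) (Suc (Suc (2 * i))) = grid n (Suc i)" for i
    using grid_double[of n "Suc i"] by simp
  then show ?thesis
    unfolding grid_form_def power_Suc sum_double[of "\<lambda>i. (v (grid (Suc n) (Suc i)) - v (grid (Suc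
        n) i)) * (w (grid (Suc n) (Suc i)) - w (grid (Suc n) i))" "2 * 2 ^ n"]
    by (simp add: grid_double mult.assoc)
qed

text \<open>Splitting an increment at a midpoint cannot lower the energy: the gain in each cell is
  proportional to the square of the second difference \<open>2 * y - x - z\<close>.\<close>

lemma grid_energy_mono_Suc: "grid_energy n w \<le> grid_energy (Suc n) w"
proof -
  have *: "(z - x) * (z - x) \<le> 2 * ((y - x) * (y - x) + (z - y) * (z - y))" for x y z :: real
  proof -
    have "2 * ((y - x) * (y - x) + (z - y) * (z - y)) - (z - x) * (z - x) =
        (2 * y - x - z) * (2 * y - x - z)"
      by algebra
    then show ?thesis using zero_le_square[of "2 * y - x - z"] by linarith
  qed
  have 2: "2 * 2 ^ n * sum f S = 2 ^ n * (\<Sum>i\<in>S. 2 * f i)" for f :: "nat \<Rightarrow> real" and S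
    by (simp add: sum_distrib_left[symmetric])
  show ?thesis unfolding grid_form_Suc 2 unfolding grid_form_def
      by (intro mult_left_mono sum_mono *) simp
qed

lemma grid_energy_mono: "n \<le> m \<Longrightarrow> grid_energy n w \<le> grid_energy m w"
  using lift_Suc_mono_le[of "\<lambda>n. grid_energy n w"] grid_energy_mono_Suc by blast

text \<open>Cauchy-Schwarz for the telescoping sum of the increments between the two grid
  points.\<close>

lemma grid_energy_increment:
  assumes "i \<le> j" "j \<le> 2 * 2 ^ n"
  shows "(w (grid n j) - w (grid n i))\<^sup>2 \<le> (grid n j - grid n i) * grid_energy n w"
proof -
  let ?d = "\<lambda>k. w (grid n (Suc k)) - w (grid n k)"
  have "w (grid n j) - w (grid n i) = (\<Sum>k=i..<j. ?d k)"
    using sum_Suc_diff'[of i j "\<lambda>k. w (grid n k)"] assms by simp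
  then have "(w (grid n j) - w (grid n i))\<^sup>2 \<le> (\<Sum>k=i..<j. (?d k)\<^sup>2) * real (j - i)"
    using sum_squared_le_sum_of_squares[of ?d "{i..<j}"] by simp
  also have "\<dots> \<le> (\<Sum>k<2 * 2 ^ n. (?d k)\<^sup>2) * real (j - i)"
    by (intro mult_right_mono sum_mono2) (use assms in auto)
  also have "\<dots> = (grid n j - grid n i) * grid_energy n w"
    using assms by (simp add: grid_def grid_form_def power2_eq_square of_nat_diff field_simps)
  finally show ?thesis .
qed

lemma grid_tendsto:
  assumes t: "t \<in> {-1..1}"
  shows "(\<lambda>n. grid n (nat \<lfloor>(t + 1) * 2 ^ n\<rfloor>)) \<longlonglongrightarrow> t" and "nat \<lfloor>(t + 1) * 2 ^ n\<rfloor> \<le> 2 * 2 ^ n"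
proof -
  have nn: "real (nat \<lfloor>(t + 1) * 2 ^ n\<rfloor>) = of_int \<lfloor>(t + 1) * 2 ^ n\<rfloor>" for n using t by simp
  have b: "real (nat \<lfloor>(t + 1) * 2 ^ n\<rfloor>) \<le> (t + 1) * 2 ^ n"
      "real (nat \<lfloor>(t + 1) * 2 ^ n\<rfloor>) \<ge> (t + 1) * 2 ^ n - 1" for n
    unfolding nn by linarith+
  have "t - (1/2) ^ n \<le> grid n (nat \<lfloor>(t + 1) * 2 ^ n\<rfloor>) \<and> grid n (nat \<lfloor>(t + 1) * 2 ^ n\<rfloor>) \<le> t" for n
    using divide_right_mono[OF b(1)[of n], of "2 ^ n"] divide_right_mono[OF b(2)[of n], of "2 ^ n"]
    by (simp add: grid_def diff_divide_distrib power_divide)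
  note sandwich = this
  have "(\<lambda>n. t - (1/2) ^ n) \<longlonglongrightarrow> t - 0"
    by (intro tendsto_diff tendsto_const LIMSEQ_power_zero) simp
  then have "(\<lambda>n. t - (1/2) ^ n) \<longlonglongrightarrow> t" by simp
  then show "(\<lambda>n. grid n (nat \<lfloor>(t + 1) * 2 ^ n\<rfloor>)) \<longlonglongrightarrow> t"
    by (rule tendsto_sandwich[OF _ _ _ tendsto_const, rotated 2]) (use sandwich in \<open>simp_all add:
        always_eventually\<close>)
  have "real (nat \<lfloor>(t + 1) * 2 ^ n\<rfloor>) \<le> 2 * 2 ^ n"
    by (rule order_trans[OF b(1)], rule mult_right_mono) (use t in auto)
  also have "\<dots> = real (2 * 2 ^ n)" by simp
  finally show "nat \<lfloor>(t + 1) * 2 ^ n\<rfloor> \<le> 2 * 2 ^ n" by (simp only: of_nat_le_iff)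
qed

text \<open>The embedding of finite energy into Hoelder continuity of exponent 1/2, passed from grid
  points to all points by continuity. It supplies both the equicontinuity and the boundary decay
  used below.\<close>

lemma energy_increment:
  assumes w: "continuous_on {-1..1} w" and M: "\<And>n. grid_energy n w \<le> M"
      and st: "-1 \<le> s" "s \<le> t" "t \<le> 1"
  shows "(w t - w s)\<^sup>2 \<le> (t - s) * M"
proof -
  let ?i = "\<lambda>t n. nat \<lfloor>(t + 1) * 2 ^ n\<rfloor>"
  have lim: "(\<lambda>n. w (grid n (?i r n))) \<longlonglongrightarrow> w r" if "r \<in> {-1..1}" for r
    by (rule continuous_on_tendsto_compose[OF w grid_tendsto(1)[OF that] that])
      (use grid_bounds grid_tendsto(2)[OF that] in auto)
  have st': "s \<in> {-1..1}" "t \<in> {-1..1}" using st by auto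
  have le: "?i s n \<le> ?i t n" for n using st by (intro nat_mono floor_mono mult_right_mono) auto
  have bd: "(w (grid n (?i t n)) - w (grid n (?i s n)))\<^sup>2 \<le>
      (grid n (?i t n) - grid n (?i s n)) * M" for n
  proof -
    have "grid n (?i t n) - grid n (?i s n) \<ge> 0" using le[of n]
        by (simp add: grid_def divide_right_mono)
    then show ?thesis
      using grid_energy_increment[OF le grid_tendsto(2)[OF st'(2)], of w n] M[of n]
        mult_left_mono[OF M[of n], of "grid n (?i t n) - grid n (?i s n)"] by linarith
  qed
  show ?thesis
    by (rule LIMSEQ_le[where X="\<lambda>n. (w (grid n (?i t n)) - w (grid n (?i s n)))\<^sup>2" and
        Y="\<lambda>n. (grid n (?i t n) - grid n (?i s n)) * M"])
      (auto intro!: tendsto_intros lim grid_tendsto(1) st' bd)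
qed

text \<open>\<open>\<sigma> = 1\<close> encodes even and \<open>\<sigma> = -1\<close> odd functions,
  so one minimisation serves both classes; the symmetry also yields the boundary value at
  -1.\<close>

definition admissible :: "real \<Rightarrow> (real \<Rightarrow> real) \<Rightarrow> bool" where
  "admissible \<sigma> w \<longleftrightarrow> continuous_on {-1..1} w \<and> w 1 = 0 \<and> (\<forall>t\<in>{-1..1}. w (- t) = \<sigma> * w t)"

lemma admissible_minus1: "admissible \<sigma> w \<Longrightarrow> w (-1) = 0"
  unfolding admissible_def by force

text \<open>Apply the increment estimate from the nearer endpoint, where \<open>w\<close> vanishes.
  The bound has exactly the weight 1 - t^2, so the singular weight in \<open>weighted_form\<close>
  costs nothing.\<close>

lemma admissible_sq_le:
  assumes "admissible \<sigma> w" "\<And>n. grid_energy n w \<le> M" "t \<in> {-1..1}"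
  shows "(w t)\<^sup>2 \<le> M * (1 - t\<^sup>2)"
proof -
  have w: "continuous_on {-1..1} w" "w 1 = 0" "w (-1) = 0" using assms(1) admissible_minus1
      by (auto simp: admissible_def)
  have M: "M \<ge> 0" using assms(2)[of 0] grid_energy_nonneg[of 0 w] by simp
  have 1: "(w t)\<^sup>2 \<le> (1 - t) * M" "(w t)\<^sup>2 \<le> (1 + t) * M"
    using energy_increment[OF w(1) assms(2), of t 1] energy_increment[OF w(1) assms(2), of "-1" t]
        assms(3) w
    by (auto simp: add.commute)
  have e: "M * (1 - t\<^sup>2) = (1 - t) * M * (1 + t)" by (simp add: power2_eq_square algebra_simps)
  show ?thesis
  proof (cases "t \<ge> 0")
    case True
    then have "(1 - t) * M * 1 \<le> (1 - t) * M * (1 + t)" using M assms(3)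
        by (intro mult_left_mono) auto
    then show ?thesis using 1(1) e by linarith
  next
    case False
    then have "(1 + t) * M * 1 \<le> (1 + t) * M * (1 - t)" using M assms(3)
        by (intro mult_left_mono) auto
    moreover have "M * (1 - t\<^sup>2) = (1 + t) * M * (1 - t)"
        by (simp add: power2_eq_square algebra_simps)
    ultimately show ?thesis using 1(2) by linarith
  qed
qed

text \<open>Arzela-Ascoli with the Hoelder bound. At a fixed level the grid energy is a finite sum
  of values of the function and hence converges; only the supremum over levels can drop in the
  limit.\<close>

lemma admissible_compact:
  fixes w :: "nat \<Rightarrow> real \<Rightarrow> real"
  assumes admissible: "\<And>k. admissible \<sigma> (w k)" and M: "\<And>k n. grid_energy n (w k) \<le> M"
  obtains v r where "admissible \<sigma> v" "strict_mono r" "\<And>t. t \<in> {-1..1} \<Longrightarrow> (\<lambda>k. w (r k) t) \<longlonglongrightarrow> v t"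
    "\<And>n. (\<lambda>k. grid_energy n (w (r k))) \<longlonglongrightarrow> grid_energy n v"
proof -
  have M0: "M \<ge> 0" using M[of 0 0] grid_energy_nonneg[of 0 "w 0"] by linarith
  have cont: "continuous_on {-1..1} (w k)" for k using admissible by (simp add: admissible_def)
  have inc: "\<bar>w k t - w k s\<bar>\<^sup>2 \<le> \<bar>t - s\<bar> * M" if "s \<in> {-1..1}" "t \<in> {-1..1}" for s t k
    using energy_increment[OF cont M, of s t] energy_increment[OF cont M, of t s] that
    by (cases "s \<le> t") (auto simp: power2_commute abs_if)
  have bdd: "norm (w k t) \<le> sqrt (2 * M)" if "t \<in> {-1..1}" for k t
  proof -
    have "\<bar>w k t\<bar>\<^sup>2 \<le> M * (1 - t\<^sup>2)" using admissible_sq_le[OF admissible M that] by simp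
    also have "\<dots> \<le> 2 * M"
    proof -
      have "1 - t\<^sup>2 \<le> 2" using zero_le_power2[of t] by linarith
      from mult_left_mono[OF this M0] show ?thesis by (simp add: mult.commute)
    qed
    finally show ?thesis using real_le_rsqrt by simp
  qed
  have equi: "\<exists>d>0. \<forall>k s. s \<in> {-1..1} \<and> norm (t - s) < d \<longrightarrow> norm (w k t - w k s) < e"
    if "t \<in> {-1..1}" "e > 0" for t e
  proof (intro exI conjI allI impI)
    show "e\<^sup>2 / (M + 1) > 0" using that M0 by simp
    fix k s assume s: "s \<in> {-1..1} \<and> norm (t - s) < e\<^sup>2 / (M + 1)"
    have "\<bar>w k t - w k s\<bar>\<^sup>2 \<le> \<bar>t - s\<bar> * M" using inc s that by blast
    also have "\<dots> \<le> \<bar>t - s\<bar> * (M + 1)" by (intro mult_left_mono) auto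
    also have "\<dots> < e\<^sup>2" using s M0 by (simp add: field_simps)
    finally show "norm (w k t - w k s) < e" using that power2_less_imp_less[of "\<bar>w k t - w k s\<bar>"
        e] by simp
  qed
  obtain g r where g: "continuous_on {-1..1} g" and r: "strict_mono (r :: nat \<Rightarrow> nat)"
    and lim: "\<And>e. 0 < e \<Longrightarrow> \<exists>N. \<forall>n x. n \<ge> N \<and> x \<in> {-1..1} \<longrightarrow> norm (w (r n) x - g x) < e"
    by (rule Arzela_Ascoli[of "{-1..1::real}" w, OF _ bdd equi]) auto
  have lim': "(\<lambda>k. w (r k) t) \<longlonglongrightarrow> g t" if "t \<in> {-1..1}" for t
    unfolding LIMSEQ_iff using lim that by blast
  have "g 1 = 0"
    using LIMSEQ_unique[OF lim'[of 1], of 0] admissible by (simp add: admissible_def)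
  moreover have "g (- t) = \<sigma> * g t" if "t \<in> {-1..1}" for t
  proof (rule LIMSEQ_unique[OF lim'])
    show "(\<lambda>k. w (r k) (- t)) \<longlonglongrightarrow> \<sigma> * g t"
      using tendsto_mult[OF tendsto_const lim'[OF that], of \<sigma>] admissible that
          by (simp add: admissible_def)
  qed (use that in auto)
  ultimately have "admissible \<sigma> g" using g by (simp add: admissible_def)
  moreover have "(\<lambda>k. grid_energy n (w (r k))) \<longlonglongrightarrow> grid_energy n g" for n
    unfolding grid_form_def by (intro tendsto_intros lim') (use grid_bounds in auto)
  ultimately show ?thesis using that r lim' by blast
qed

definition finite_energy :: "(real \<Rightarrow> real) \<Rightarrow> bool" where
  "finite_energy w \<longleftrightarrow> bdd_above (range (\<lambda>n. grid_energy n w))"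

definition energy :: "(real \<Rightarrow> real) \<Rightarrow> real" where "energy w = (SUP n. grid_energy n w)"

lemma grid_energy_le_energy: "finite_energy w \<Longrightarrow> grid_energy n w \<le> energy w"
  unfolding finite_energy_def energy_def by (intro cSUP_upper) auto

lemma energy_leI: "(\<And>n. grid_energy n w \<le> M) \<Longrightarrow> energy w \<le> M"
  unfolding energy_def by (intro cSUP_least) auto

lemma finite_energyI: "(\<And>n. grid_energy n w \<le> M) \<Longrightarrow> finite_energy w"
  unfolding finite_energy_def by (auto simp: bdd_above_def)

lemma energy_nonneg: "finite_energy w \<Longrightarrow> energy w \<ge> 0"
  using grid_energy_le_energy[of w 0] grid_energy_nonneg[of 0 w] by linarith

lemma grid_energy_tendsto: "finite_energy w \<Longrightarrow> (\<lambda>n. grid_energy n w) \<longlonglongrightarrow> energy w"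
  unfolding finite_energy_def energy_def
  by (rule LIMSEQ_incseq_SUP) (auto simp: incseq_def grid_energy_mono)

lemma grid_energy_scale: "grid_energy n (\<lambda>t. c * w t) = c\<^sup>2 * grid_energy n w"
proof -
  have *: "(c * x - c * y) * (c * x - c * y) = c\<^sup>2 * ((x - y) * (x - y))" for x y by algebra
  show ?thesis unfolding grid_form_def * sum_distrib_left[symmetric] by (rule mult.left_commute)
qed

lemma energy_scale: "finite_energy w \<Longrightarrow> finite_energy (\<lambda>t. c * w t) \<and> energy (\<lambda>t. c * w t) =
    c\<^sup>2 * energy w"
proof
  assume w: "finite_energy w"
  show f: "finite_energy (\<lambda>t. c * w t)"
    by (rule finite_energyI[of _ "c\<^sup>2 * energy w"]) (simp add: grid_energy_scale mult_left_mono
        grid_energy_le_energy w)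
  show "energy (\<lambda>t. c * w t) = c\<^sup>2 * energy w"
    by (rule LIMSEQ_unique[OF grid_energy_tendsto[OF f]])
      (simp add: grid_energy_scale tendsto_mult grid_energy_tendsto w)
qed

lemma admissible_scale: "admissible \<sigma> w \<Longrightarrow> admissible \<sigma> (\<lambda>t. c * w t)"
  unfolding admissible_def by (auto intro!: continuous_intros)

text \<open>Affine on each grid interval of level \<open>m\<close>, as far as the finer grid points can tell.\<close>

definition grid_affine :: "nat \<Rightarrow> (real \<Rightarrow> real) \<Rightarrow> bool" where
  "grid_affine m \<phi> \<longleftrightarrow> (\<forall>n\<ge>m. \<forall>i<2 * 2 ^ n. \<phi> (grid (Suc n) (Suc (2 * i))) =
      (\<phi> (grid n i) + \<phi> (grid n (Suc i))) / 2)"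

text \<open>If the midpoint value of \<open>\<phi>\<close> is the average, both half-cells see the
  same increment of \<open>\<phi>\<close>, namely half of it, and the increments of \<open>w\<close>
  add up. The resulting factor 1/2 cancels the doubled number of cells.\<close>

lemma grid_form_affine:
  assumes "grid_affine m \<phi>" "m \<le> n"
  shows "grid_form n w \<phi> = grid_form m w \<phi>"
  using assms(2)
proof (induction n rule: dec_induct)
  case (step n)
  have "(w c - w a) * (f c - f a) + (w b - w c) * (f b - f c) = (w b - w a) * (f b - f a) / 2"
    if "f c = (f a + f b) / 2" for f and a b c :: real
    unfolding that by (simp add: field_simps)
  note * = this[of \<phi>]
  have "grid_form (Suc n) w \<phi> = 2 * 2 ^ n * (\<Sum>i<2 * 2 ^ n.
      (w (grid n (Suc i)) - w (grid n i)) * (\<phi> (grid n (Suc i)) - \<phi> (grid n i)) / 2)"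
    unfolding grid_form_Suc
    by (intro arg_cong2[where f="(*)"] sum.cong refl *) (use assms(1) step(1) in \<open>auto simp:
        grid_affine_def\<close>)
  also have "\<dots> = grid_form n w \<phi>" by (simp add: grid_form_def sum_divide_distrib[symmetric])
  finally show ?case using step by simp
qed simp

lemma grid_energy_add: "grid_energy n (\<lambda>t. w t + s * \<phi> t) =
    grid_energy n w + 2 * s * grid_form n w \<phi> + s\<^sup>2 * grid_energy n \<phi>"
proof -
  have *: "(w x + s * \<phi> x - (w y + s * \<phi> y)) * (w x + s * \<phi> x - (w y + s * \<phi> y)) =
     (w x - w y) * (w x - w y) + 2 * s * ((w x - w y) * (\<phi> x - \<phi> y)) + s\<^sup>2 * ((\<phi> x - \<phi> y) * (\<phi> x -
         \<phi> y))" for x y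
    by algebra
  have "P * (A + 2 * s * B + s\<^sup>2 * C) = P * A + 2 * s * (P * B) + s\<^sup>2 * (P * C)" for P A B C :: real
    by algebra
  then show ?thesis unfolding grid_form_def * sum.distrib sum_distrib_left[symmetric] by blast
qed

text \<open>From level \<open>m\<close> on, the cross term and the energy of \<open>\<phi>\<close>
  no longer change, so the limit in the level is an exact quadratic in \<open>s\<close> and the
  first variation can be read off.\<close>

lemma energy_add:
  assumes w: "finite_energy w" and \<phi>: "grid_affine m \<phi>"
  shows "finite_energy (\<lambda>t. w t + s * \<phi> t)"
    and "energy (\<lambda>t. w t + s * \<phi> t) = energy w + 2 * s * grid_form m w \<phi> + s\<^sup>2 * grid_energy m \<phi>"
proof -
  have e: "grid_energy n (\<lambda>t. w t + s * \<phi> t) =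
      grid_energy n w + 2 * s * grid_form m w \<phi> + s\<^sup>2 * grid_energy m \<phi>" if "m \<le> n" for n
    unfolding grid_energy_add grid_form_affine[OF \<phi> that] ..
  show f: "finite_energy (\<lambda>t. w t + s * \<phi> t)"
  proof (rule finite_energyI)
    fix n
    have "grid_energy n (\<lambda>t. w t + s * \<phi> t) \<le> grid_energy (max n m) (\<lambda>t. w t + s * \<phi> t)"
        by (intro grid_energy_mono) simp
    then show "grid_energy n (\<lambda>t. w t + s * \<phi> t) \<le>
        energy w + 2 * s * grid_form m w \<phi> + s\<^sup>2 * grid_energy m \<phi>"
      using e[of "max n m"] grid_energy_le_energy[OF w, of "max n m"] by simp
  qed
  have "(\<lambda>n. grid_energy n w + 2 * s * grid_form m w \<phi> + s\<^sup>2 * grid_energy m \<phi>) \<longlonglongrightarrow> energy w + 2 * s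
      * grid_form m w \<phi> + s\<^sup>2 * grid_energy m \<phi>"
    by (intro tendsto_add grid_energy_tendsto w tendsto_const)
  then have "(\<lambda>n. grid_energy n (\<lambda>t. w t + s * \<phi> t)) \<longlonglongrightarrow> energy w + 2 * s * grid_form m w \<phi> + s\<^sup>2 *
      grid_energy m \<phi>"
    by (rule Lim_transform_eventually) (use e in \<open>auto simp: eventually_sequentially intro!:
        exI[of _ m]\<close>)
  then show "energy (\<lambda>t. w t + s * \<phi> t) = energy w + 2 * s * grid_form m w \<phi> + s\<^sup>2 * grid_energy m
      \<phi>"
    using LIMSEQ_unique[OF grid_energy_tendsto[OF f]] by blast
qed

lemma grid_affine_finite_energy: "grid_affine m \<phi> \<Longrightarrow> finite_energy \<phi>"
proof (rule finite_energyI)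
  fix n assume "grid_affine m \<phi>"
  then show "grid_energy n \<phi> \<le> grid_energy m \<phi>"
      using grid_energy_mono[of n "max n m" \<phi>] grid_form_affine[of m \<phi> "max n m" \<phi>] by simp
qed

section \<open>The weighted quadratic form and the constraint\<close>

lemma integrable_bounded_continuous_Ioo:
  fixes f :: "real \<Rightarrow> real"
  assumes "continuous_on {a<..<b} f" "\<And>x. x \<in> {a<..<b} \<Longrightarrow> \<bar>f x\<bar> \<le> C"
  shows "f integrable_on {a..b}"
proof -
  have "f integrable_on {a<..<b}"
  proof (rule measurable_bounded_by_integrable_imp_integrable)
    show "f \<in> borel_measurable (lebesgue_on {a<..<b})"
      by (rule continuous_imp_measurable_on_sets_lebesgue[OF assms(1)]) simp
    show "(\<lambda>x. C) integrable_on {a<..<b}"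
      unfolding integrable_on_open_interval_real by (rule integrable_const_ivl)
  qed (use assms in auto)
  then show ?thesis by (simp only: integrable_on_open_interval_real)
qed

text \<open>At the endpoints the integrand is 0 by division by zero and need not be continuous;
  inside it is bounded through \<open>admissible_sq_le\<close>, which gives integrability.\<close>

definition weighted_form :: "(real \<Rightarrow> real) \<Rightarrow> (real \<Rightarrow> real) \<Rightarrow> real" where
  "weighted_form v w = integral {-1..1} (\<lambda>t. v t * w t / (1 - t\<^sup>2))"

definition power_integral :: "real \<Rightarrow> (real \<Rightarrow> real) \<Rightarrow> real" where
  "power_integral q w = integral {-1..1} (\<lambda>t. \<bar>w t\<bar> powr (q + 1))"

lemma one_minus_sq: "t \<in> {-1<..<1} \<Longrightarrow> 1 - t\<^sup>2 > (0::real)"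
  by (simp add: abs_square_less_1[of t] abs_less_iff)

lemma one_minus_sq_le: "t \<in> {-1..1} \<Longrightarrow> 1 - t\<^sup>2 \<ge> (0::real)"
  by (simp add: abs_square_le_1 abs_le_iff)

lemma weighted_form_integrand_bound:
  assumes "admissible \<sigma> w" "\<And>n. grid_energy n w \<le> M" "admissible \<sigma>' v" "\<And>n. grid_energy n v \<le>
      M" "t \<in> {-1..1}"
  shows "\<bar>v t * w t / (1 - t\<^sup>2)\<bar> \<le> M"
proof -
  have M: "M \<ge> 0" using assms(2)[of 0] grid_energy_nonneg[of 0 w] by linarith
  consider "1 - t\<^sup>2 = 0" | "1 - t\<^sup>2 > 0" using one_minus_sq_le[OF assms(5)] by linarith
  then show ?thesis
  proof cases
    case 2
    have "2 * \<bar>v t * w t\<bar> \<le> (v t)\<^sup>2 + (w t)\<^sup>2"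
      using sum_squares_bound[of "\<bar>v t\<bar>" "\<bar>w t\<bar>"] by (simp add: abs_mult)
    also have "\<dots> \<le> 2 * (M * (1 - t\<^sup>2))"
      using admissible_sq_le[OF assms(1,2,5)] admissible_sq_le[OF assms(3,4,5)] by linarith
    finally show ?thesis using 2 by (simp add: abs_div pos_divide_le_eq abs_mult)
  qed (use M in simp)
qed

lemma weighted_form_integrable:
  assumes "admissible \<sigma> w" "finite_energy w" "admissible \<sigma>' v" "finite_energy v"
  shows "(\<lambda>t. v t * w t / (1 - t\<^sup>2)) integrable_on {-1..1}"
proof (rule integrable_bounded_continuous_Ioo)
  have "continuous_on {-1<..<1} w" "continuous_on {-1<..<1} v"
    using assms by (auto simp: admissible_def intro: continuous_on_subset)
  then show "continuous_on {-1<..<1} (\<lambda>t. v t * w t / (1 - t\<^sup>2))"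
    by (intro continuous_intros) (use one_minus_sq in force)+
  fix t :: real assume t: "t \<in> {-1<..<1}"
  show "\<bar>v t * w t / (1 - t\<^sup>2)\<bar> \<le> max (energy w) (energy v)"
    by (rule weighted_form_integrand_bound[OF assms(1) _ assms(3)])
      (use t grid_energy_le_energy[OF assms(2)] grid_energy_le_energy[OF assms(4)] in \<open>auto simp:
          le_max_iff_disj\<close>)
qed

lemma weighted_form_scale: "weighted_form (\<lambda>t. c * w t) (\<lambda>t. c * w t) = c\<^sup>2 * weighted_form w w"
proof -
  have "c * w t * (c * w t) / (1 - t\<^sup>2) = c\<^sup>2 * (w t * w t / (1 - t\<^sup>2))" for t
    by (simp add: power2_eq_square)
  then show ?thesis unfolding weighted_form_def by (simp only: integral_mult_right)
qed

lemma weighted_form_bound: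
  assumes "admissible \<sigma> w" "\<And>n. grid_energy n w \<le> M"
  shows "0 \<le> weighted_form w w" "weighted_form w w \<le> 2 * M"
proof -
  have I: "(\<lambda>t. w t * w t / (1 - t\<^sup>2)) integrable_on {-1..1}"
    using weighted_form_integrable[OF assms(1) _ assms(1)] finite_energyI[OF assms(2)] by blast
  show "0 \<le> weighted_form w w" unfolding weighted_form_def
    by (rule integral_nonneg[OF I]) (use one_minus_sq_le in auto)
  have "integral {-1..1} (\<lambda>t. w t * w t / (1 - t\<^sup>2)) \<le> integral {-1..1} (\<lambda>t::real. M)"
    by (rule integral_le[OF I integrable_const_ivl])
      (rule order_trans[OF abs_ge_self weighted_form_integrand_bound[OF assms assms]])
  then show "weighted_form w w \<le> 2 * M" by (simp add: weighted_form_def)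
qed

lemma weighted_form_add:
  assumes "admissible \<sigma> w" "finite_energy w" "admissible \<sigma> \<phi>" "finite_energy \<phi>"
  shows "weighted_form (\<lambda>t. w t + s * \<phi> t) (\<lambda>t. w t + s * \<phi> t) =
      weighted_form w w + 2 * s * weighted_form w \<phi> + s\<^sup>2 * weighted_form \<phi> \<phi>"
proof -
  have "(w t + s * \<phi> t) * (w t + s * \<phi> t) / (1 - t\<^sup>2) =
     w t * w t / (1 - t\<^sup>2) + 2 * s * (w t * \<phi> t / (1 - t\<^sup>2)) + s\<^sup>2 * (\<phi> t * \<phi> t / (1 - t\<^sup>2))" for t
    by (simp add: add_divide_distrib[symmetric]) (simp add: algebra_simps power2_eq_square)
  then have *: "weighted_form (\<lambda>t. w t + s * \<phi> t) (\<lambda>t. w t + s * \<phi> t) = integral {-1..1} (\<lambda>t.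
     w t * w t / (1 - t\<^sup>2) + 2 * s * (w t * \<phi> t / (1 - t\<^sup>2)) + s\<^sup>2 * (\<phi> t * \<phi> t / (1 - t\<^sup>2)))"
    unfolding weighted_form_def by (simp only:)
  have h: "((\<lambda>t. w t * w t / (1 - t\<^sup>2)) has_integral weighted_form w w) {-1..1}"
    "((\<lambda>t. w t * \<phi> t / (1 - t\<^sup>2)) has_integral weighted_form w \<phi>) {-1..1}"
    "((\<lambda>t. \<phi> t * \<phi> t / (1 - t\<^sup>2)) has_integral weighted_form \<phi> \<phi>) {-1..1}"
    unfolding weighted_form_def
    using weighted_form_integrable[OF assms(1,2,1,2)] weighted_form_integrable[OF assms(3,4,1,2)]
        weighted_form_integrable[OF assms(3,4,3,4)]
    by (simp_all only: integrable_integral)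
  show ?thesis unfolding *
    by (intro integral_unique has_integral_add has_integral_mult_right h)
qed

lemma power_integral_integrable: "q > 0 \<Longrightarrow> admissible \<sigma> w \<Longrightarrow>
    (\<lambda>t. \<bar>w t\<bar> powr (q + 1)) integrable_on {-1..1}"
  by (intro integrable_continuous_real continuous_on_powr' continuous_on_rabs continuous_on_const)
    (auto simp: admissible_def)

lemma power_integral_nonneg: "q > 0 \<Longrightarrow> admissible \<sigma> w \<Longrightarrow> power_integral q w \<ge> 0"
  unfolding power_integral_def by (intro integral_nonneg power_integral_integrable) auto

lemma power_integral_scale: "power_integral q (\<lambda>t. c * w t) = \<bar>c\<bar> powr (q + 1) * power_integral q w"
  unfolding power_integral_def by (simp only: abs_mult powr_mult abs_ge_zero integral_mult_right)

lemma power_integral_eq_zeroD: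
  assumes "q > 0" "admissible \<sigma> w" "power_integral q w = 0" "t \<in> {-1..1}"
  shows "w t = 0"
proof -
  have "continuous_on {-1..1} (\<lambda>t. \<bar>w t\<bar> powr (q + 1))"
    using assms by (intro continuous_on_powr' continuous_on_rabs continuous_on_const) (auto simp:
        admissible_def)
  then have "(\<lambda>t. \<bar>w t\<bar> powr (q + 1)) t = 0" if "t \<in> {-1..1}" for t
    using integral_eq_0_iff[of "-1" 1 "\<lambda>t. \<bar>w t\<bar> powr (q + 1)"] assms(3) that
    by (auto simp: power_integral_def)
  from this[OF assms(4)] show ?thesis by simp
qed

text \<open>Dominated convergence with constant majorants, both provided by
  \<open>admissible_sq_le\<close>. Thus the constraint and the subtracted term survive pointwise
  limits exactly, whatever the sign of \<open>\<kappa>\<close>.\<close>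

lemma forms_tendsto:
  assumes "q > 0" "\<And>k. admissible \<sigma> (w k)" "\<And>k n. grid_energy n (w k) \<le> M"
    and lim: "\<And>t. t \<in> {-1..1} \<Longrightarrow> (\<lambda>k. w k t) \<longlonglongrightarrow> v t"
  shows "(\<lambda>k. weighted_form (w k) (w k)) \<longlonglongrightarrow> weighted_form v v"
      "(\<lambda>k. power_integral q (w k)) \<longlonglongrightarrow> power_integral q v"
proof -
  have M0: "M \<ge> 0" using assms(3)[of 0 0] grid_energy_nonneg[of 0 "w 0"] by linarith
  show "(\<lambda>k. weighted_form (w k) (w k)) \<longlonglongrightarrow> weighted_form v v" unfolding weighted_form_def
  proof (rule dominated_convergence(2))
    show "(\<lambda>t. w k t * w k t / (1 - t\<^sup>2)) integrable_on {-1..1}" for k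
      by (intro weighted_form_integrable[OF assms(2) _ assms(2)] finite_energyI[OF assms(3)])
    show "(\<lambda>t. M) integrable_on {-1..1::real}" by (rule integrable_const_ivl)
    show "norm (w k t * w k t / (1 - t\<^sup>2)) \<le> M" if "t \<in> {-1..1}" for k t
      unfolding real_norm_def by (rule weighted_form_integrand_bound[OF assms(2,3) assms(2,3) that])
    show "(\<lambda>k. w k t * w k t / (1 - t\<^sup>2)) \<longlonglongrightarrow> v t * v t / (1 - t\<^sup>2)" if "t \<in> {-1..1}" for t
      unfolding divide_inverse by (intro tendsto_mult lim that tendsto_const)
  qed
  show "(\<lambda>k. power_integral q (w k)) \<longlonglongrightarrow> power_integral q v" unfolding power_integral_def
  proof (rule dominated_convergence(2))
    show "(\<lambda>t. \<bar>w k t\<bar> powr (q + 1)) integrable_on {-1..1}" for k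
      by (intro power_integral_integrable[OF _ assms(2)] assms)
    show "(\<lambda>t. sqrt M powr (q + 1)) integrable_on {-1..1::real}" by (rule integrable_const_ivl)
    show "norm (\<bar>w k t\<bar> powr (q + 1)) \<le> sqrt M powr (q + 1)" if "t \<in> {-1..1}" for k t
    proof -
      have "(w k t)\<^sup>2 \<le> M * (1 - t\<^sup>2)" by (rule admissible_sq_le[OF assms(2,3) that])
      also have "\<dots> \<le> M * 1" using M0 by (intro mult_left_mono) auto
      finally have "\<bar>w k t\<bar> \<le> sqrt M" by (simp add: real_le_rsqrt)
      then show ?thesis using assms(1) by (simp add: powr_mono2)
    qed
    show "(\<lambda>k. \<bar>w k t\<bar> powr (q + 1)) \<longlonglongrightarrow> \<bar>v t\<bar> powr (q + 1)" if "t \<in> {-1..1}" for t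
      by (intro tendsto_powr2 tendsto_rabs lim that tendsto_const) (use assms in auto)
  qed
qed

text \<open>The direct method: coercivity bounds the energies of a minimising sequence, a
  subsequence converges pointwise, the constraint and \<open>weighted_form\<close> pass to the
  limit, and the energy is lower semicontinuous.\<close>

lemma minimizer_exists:
  fixes \<kappa> q \<sigma> :: real
  assumes q: "q > 0"
    and ne: "admissible \<sigma> w0" "finite_energy w0" "power_integral q w0 = 1"
  obtains w where "admissible \<sigma> w" "finite_energy w" "power_integral q w = 1"
    "\<And>v. admissible \<sigma> v \<Longrightarrow> finite_energy v \<Longrightarrow> power_integral q v = 1 \<Longrightarrow>
        energy w - \<kappa> * weighted_form w w \<le> energy v - \<kappa> * weighted_form v v"
proof -
  define A where "A = {w. admissible \<sigma> w \<and> finite_energy w \<and> power_integral q w = 1}"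
  define Q where "Q = (\<lambda>w. energy w - \<kappa> * weighted_form w w)"
  text \<open>Coercivity: otherwise normalising the energy gives a sequence with a limit \<open>v\<close> such that
    \<open>power_integral q v = 0\<close>, hence \<open>v = 0\<close>, although \<open>1 - \<kappa> * weighted_form v v \<le> 0\<close>.\<close>
  have coercive: "\<exists>M. \<forall>w\<in>A. Q w \<le> C \<longrightarrow> energy w \<le> M" for C
  proof (rule ccontr)
    assume "\<nexists>M. \<forall>w\<in>A. Q w \<le> C \<longrightarrow> energy w \<le> M"
    then have "\<forall>k::nat. \<exists>w. w \<in> A \<and> Q w \<le> C \<and> energy w > real k + 1" by (meson not_le)
    from choice[OF this] obtain f where
      f: "\<And>k. f k \<in> A" "\<And>k. Q (f k) \<le> C" "\<And>k::nat. energy (f k) > real k + 1" by blast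
    define c where "c = (\<lambda>k. 1 / sqrt (energy (f k)))"
    have pos: "energy (f k) > 0" for k using f(3)[of k] of_nat_0_le_iff[of k, where 'a=real]
        by linarith
    have c: "c k > 0" "(c k)\<^sup>2 = 1 / energy (f k)" for k using pos[of k]
        by (auto simp: c_def power_divide)
    define v where "v = (\<lambda>k t. c k * f k t)"
    have admissible: "admissible \<sigma> (v k)" for k using f(1)[of k] unfolding v_def A_def
        by (auto intro: admissible_scale)
    have v: "finite_energy (v k)" "energy (v k) = 1" for k
      using energy_scale[of "f k" "c k"] f(1)[of k] pos[of k] unfolding v_def A_def
          by (auto simp: c)
    have grid_energy: "grid_energy n (v k) \<le> 1" for n k
        using grid_energy_le_energy[OF v(1), of n k] v(2) by simp
    obtain u r where u: "admissible \<sigma> u" "strict_mono (r :: nat \<Rightarrow> nat)"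
      "\<And>t. t \<in> {-1..1} \<Longrightarrow> (\<lambda>k. v (r k) t) \<longlonglongrightarrow> u t"
      "\<And>n. (\<lambda>k. grid_energy n (v (r k))) \<longlonglongrightarrow> grid_energy n u"
      by (rule admissible_compact[of \<sigma> v 1, OF admissible grid_energy]) (rule that)
    note KN = forms_tendsto[of q \<sigma> "\<lambda>k. v (r k)" 1 u, OF q admissible grid_energy u(3)]
    have inf: "filterlim (\<lambda>k. energy (f (r k))) at_top sequentially"
    proof (rule filterlim_at_top_mono[OF filterlim_real_sequentially], rule always_eventually,
        rule allI)
      fix k have "real k \<le> real (r k)" using seq_suble[OF u(2), of k] by simp
      then show "real k \<le> energy (f (r k))" using f(3)[of "r k"] by simp
    qed
    have "(\<lambda>k. power_integral q (v (r k))) \<longlonglongrightarrow> 0"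
    proof -
      \<comment> \<open>By scaling, the constraint value 1 of \<open>f k\<close> turns into a
        negative power of its energy, which tends to 0.\<close>
      have "power_integral q (v k) = inverse (energy (f k)) powr ((q + 1) / 2)" for k
      proof -
        have "power_integral q (v k) = c k powr (q + 1)"
          unfolding v_def power_integral_scale using f(1)[of k] c(1)[of k] by (simp add: A_def)
        also have "c k = inverse (energy (f k)) powr (1 / 2)"
          using pos[of k] by (simp add: c_def powr_half_sqrt real_sqrt_divide inverse_eq_divide)
        finally show ?thesis by (simp add: powr_powr)
      qed
      moreover have "(\<lambda>k. inverse (energy (f (r k))) powr ((q + 1) / 2)) \<longlonglongrightarrow> 0"
        by (intro tendsto_zero_powrI[OF tendsto_inverse_0_at_top[OF inf] tendsto_const])
          (use q pos in \<open>auto simp: less_imp_le\<close>)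
      ultimately show ?thesis by simp
    qed
    then have "power_integral q u = 0" using KN(2) LIMSEQ_unique by blast
    then have u0: "u t = 0" if "t \<in> {-1..1}" for t using power_integral_eq_zeroD[OF q u(1) _ that]
        by simp
    have "weighted_form u u = integral {-1..1} (\<lambda>t::real. 0)"
      unfolding weighted_form_def by (rule Henstock_Kurzweil_Integration.integral_cong) (use u0 in
          simp)
    then have K0: "(\<lambda>k. 1 - \<kappa> * weighted_form (v (r k)) (v (r k))) \<longlonglongrightarrow> 1 - \<kappa> * 0"
      by (intro tendsto_intros) (use KN(1) in simp)
    have "1 - \<kappa> * weighted_form (v k) (v k) \<le> \<bar>C\<bar> * inverse (energy (f k))" for k
    proof -
      have "1 - \<kappa> * weighted_form (v k) (v k) = Q (f k) * inverse (energy (f k))"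
        unfolding v_def weighted_form_scale c using pos[of k] by (simp add: Q_def field_simps)
      also have "\<dots> \<le> \<bar>C\<bar> * inverse (energy (f k))"
        using f(2)[of k] pos[of k] by (intro mult_right_mono) auto
      finally show ?thesis .
    qed
    moreover have "(\<lambda>k. \<bar>C\<bar> * inverse (energy (f (r k)))) \<longlonglongrightarrow> \<bar>C\<bar> * 0"
      by (intro tendsto_mult tendsto_const tendsto_inverse_0_at_top[OF inf])
    ultimately have "1 - \<kappa> * 0 \<le> \<bar>C\<bar> * 0"
      by (intro LIMSEQ_le[OF K0]) auto
    then show False by simp
  qed
  have Kb: "weighted_form w w \<ge> 0" "weighted_form w w \<le> 2 * energy w" if "w \<in> A" for w
    using weighted_form_bound[of \<sigma> w "energy w"] that grid_energy_le_energy[of w]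
        by (auto simp: A_def)
  have bdd: "bdd_below (Q ` A)"
  proof -
    obtain M where M: "\<And>w. w \<in> A \<Longrightarrow> Q w \<le> 0 \<Longrightarrow> energy w \<le> M" using coercive[of 0] by blast
    have "Q w \<ge> - (\<bar>\<kappa>\<bar> * (2 * \<bar>M\<bar>))" if w: "w \<in> A" for w
    proof (cases "Q w \<le> 0")
      case True
      have "\<kappa> * weighted_form w w \<le> \<bar>\<kappa>\<bar> * weighted_form w w" using Kb(1)[OF w]
          by (intro mult_right_mono) auto
      also have "\<dots> \<le> \<bar>\<kappa>\<bar> * (2 * \<bar>M\<bar>)"
        using Kb(2)[OF w] M[OF w True] by (intro mult_left_mono) auto
      finally show ?thesis using energy_nonneg[of w] w by (simp add: Q_def A_def)
    next
      case False
      have "0 \<le> \<bar>\<kappa>\<bar> * (2 * \<bar>M\<bar>)" by simp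
      then show ?thesis using False by linarith
    qed
    then show ?thesis by (intro bdd_belowI2)
  qed
  define m where "m = Inf (Q ` A)"
  have A0: "A \<noteq> {}" using ne by (auto simp: A_def)
  have "\<exists>w\<in>A. Q w < m + 1 / (real k + 1)" for k :: nat
  proof -
    have "Inf (Q ` A) < m + 1 / (real k + 1)" by (simp add: m_def)
    then show ?thesis using cInf_less_iff[of "Q ` A"] A0 bdd by auto
  qed
  then have "\<forall>k::nat. \<exists>w. w \<in> A \<and> Q w < m + 1 / (real k + 1)" by blast
  from choice[OF this] obtain f where f: "\<And>k. f k \<in> A" "\<And>k. Q (f k) < m + 1 / (real k + 1)" by blast
  have "Q (f k) \<le> m + 1" for k
  proof -
    have "1 / (real k + 1) \<le> 1" by simp
    then show ?thesis using f(2)[of k] by linarith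
  qed
  then obtain M where M: "energy (f k) \<le> M" for k using coercive[of "m + 1"] f(1) by blast
  have admissible: "admissible \<sigma> (f k)" for k using f(1) by (simp add: A_def)
  have grid_energy: "grid_energy n (f k) \<le> M" for n k
    using grid_energy_le_energy[of "f k" n] f(1)[of k] M[of k] by (simp add: A_def)
  obtain w r where w: "admissible \<sigma> w" "strict_mono (r :: nat \<Rightarrow> nat)"
    "\<And>t. t \<in> {-1..1} \<Longrightarrow> (\<lambda>k. f (r k) t) \<longlonglongrightarrow> w t"
    "\<And>n. (\<lambda>k. grid_energy n (f (r k))) \<longlonglongrightarrow> grid_energy n w"
    by (rule admissible_compact[of \<sigma> f M, OF admissible grid_energy]) (rule that)
  note KN = forms_tendsto[of q \<sigma> "\<lambda>k. f (r k)" M w, OF q admissible grid_energy w(3)]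
  have N1: "power_integral q w = 1"
    using LIMSEQ_unique[OF KN(2)] f(1) by (simp add: A_def tendsto_const)
  \<comment> \<open>Lower semicontinuity: the limit in \<open>k\<close> is taken at a fixed level
    \<open>n\<close>, and the supremum over \<open>n\<close> only afterwards.\<close>
  have "grid_energy n w \<le> m + \<kappa> * weighted_form w w" for n
  proof -
    have "(\<lambda>k. 1 / (real (r k) + 1)) \<longlonglongrightarrow> 0"
      using LIMSEQ_subseq_LIMSEQ[OF LIMSEQ_inverse_real_of_nat w(2)]
      by (simp add: o_def inverse_eq_divide add.commute)
    then have "(\<lambda>k. m + 1 / (real (r k) + 1) + \<kappa> * weighted_form (f (r k)) (f (r k))) \<longlonglongrightarrow> m + 0 + \<kappa>
        * weighted_form w w"
      by (intro tendsto_add tendsto_const tendsto_mult KN(1))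
    then have "grid_energy n w \<le> m + 0 + \<kappa> * weighted_form w w"
    proof (rule LIMSEQ_le[OF w(4)])
      have "grid_energy n (f (r k)) \<le> m + 1 / (real (r k) + 1) + \<kappa> * weighted_form (f (r k)) (f (r
          k))" for k
        using grid_energy_le_energy[of "f (r k)" n] f(1)[of "r k"] f(2)[of "r k"]
            by (simp add: A_def Q_def)
      then show "\<exists>N. \<forall>k\<ge>N. grid_energy n (f (r k)) \<le>
          m + 1 / (real (r k) + 1) + \<kappa> * weighted_form (f (r k)) (f (r k))" by blast
    qed
    then show ?thesis by simp
  qed
  then have fin: "finite_energy w" and "energy w \<le> m + \<kappa> * weighted_form w w"
      by (rule finite_energyI, rule energy_leI)
  then have "Q w \<le> m" by (simp add: Q_def)
  moreover have "m \<le> Q v" if "v \<in> A" for v unfolding m_def using that bdd by (intro cINF_lower)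
  ultimately have "Q w \<le> Q v" if "v \<in> A" for v using that by (meson order_trans)
  then show ?thesis
    using that[OF w(1) fin N1] unfolding Q_def A_def by blast
qed

section \<open>The Euler--Lagrange equation\<close>

text \<open>The nonlinearity |x|^(q-1) x, written so that the exponent stays positive: for 0 < q < 1
  it is continuous through 0.\<close>

definition spow :: "real \<Rightarrow> real \<Rightarrow> real" where "spow q x = sgn x * \<bar>x\<bar> powr q"

lemma spow_eq: "spow q x = max x 0 powr q - max (- x) 0 powr q"
  by (cases x "0::real" rule: linorder_cases) (auto simp: spow_def max_def)

lemma continuous_on_spow:
  assumes "q > 0" "continuous_on A f"
  shows "continuous_on A (\<lambda>x. spow q (f x))"
  unfolding spow_eq
  by (intro continuous_on_diff continuous_on_powr' continuous_on_max assms continuous_on_minus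
      continuous_on_const)
    (use assms in auto)

lemma spow_sign: "\<sigma> = 1 \<or> \<sigma> = -1 \<Longrightarrow> spow q (\<sigma> * x) = \<sigma> * spow q x"
  by (auto simp: spow_def)

lemma abs_powr_has_derivative:
  assumes q: "q > 0"
  shows "((\<lambda>x. \<bar>x\<bar> powr (q + 1)) has_real_derivative (q + 1) * spow q x) (at x)"
proof (cases "x = 0")
  case False
  from DERIV_fun_powr[OF has_real_derivative_abs[OF False], of "q + 1"] False
  show ?thesis by (simp add: spow_def mult_ac)
next
  case True
  have "((\<lambda>h. \<bar>h\<bar> powr q) \<longlongrightarrow> \<bar>0\<bar> powr q) (at (0::real))"
    by (intro tendsto_powr2 tendsto_rabs tendsto_ident_at tendsto_const) (use q in auto)
  then have 0: "((\<lambda>h. \<bar>h\<bar> powr q) \<longlongrightarrow> 0) (at (0::real))" using q by simp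
  have "((\<lambda>h. (\<bar>0 + h\<bar> powr (q + 1) - \<bar>0\<bar> powr (q + 1)) / h) \<longlongrightarrow> 0) (at (0::real))"
  proof (rule Lim_null_comparison[OF _ 0], rule always_eventually, rule allI)
    fix h :: real
    have "\<bar>h\<bar> powr (q + 1) = \<bar>h\<bar> powr q * \<bar>h\<bar>"
      by (simp only: powr_add powr_one abs_ge_zero)
    then show "norm ((\<bar>0 + h\<bar> powr (q + 1) - \<bar>0\<bar> powr (q + 1)) / h) \<le> \<bar>h\<bar> powr q"
      by (cases "h = 0") (use q in auto)
  qed
  then show ?thesis using True by (simp add: DERIV_def spow_def)
qed

lemma power_integral_has_derivative:
  assumes q: "q > 0" and w: "admissible \<sigma> w" and \<phi>: "admissible \<sigma> \<phi>"
  shows "((\<lambda>s. power_integral q (\<lambda>t. w t + s * \<phi> t)) has_real_derivative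
    (q + 1) * integral {-1..1} (\<lambda>t. spow q (w t) * \<phi> t)) (at 0)"
proof -
  have c: "continuous_on {-1..1} w" "continuous_on {-1..1} \<phi>" using w \<phi>
      by (auto simp: admissible_def)
  have "((\<lambda>s. integral (cbox (-1) 1) (\<lambda>t. \<bar>w t + s * \<phi> t\<bar> powr (q + 1))) has_field_derivative
    integral (cbox (-1) 1) (\<lambda>t. (q + 1) * spow q (w t + 0 * \<phi> t) * \<phi> t)) (at 0 within UNIV)"
  proof (rule leibniz_rule_field_derivative[where fx="\<lambda>s t. (q + 1) * spow q (w t + s * \<phi> t) * \<phi>
      t"])
    fix s t :: real
    have "((\<lambda>s. w t + s * \<phi> t) has_real_derivative \<phi> t) (at s)"
        by (auto intro!: derivative_eq_intros)
    from DERIV_chain2[OF abs_powr_has_derivative[OF q] this]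
    show "((\<lambda>s. \<bar>w t + s * \<phi> t\<bar> powr (q + 1)) has_field_derivative (q + 1) * spow q (w t + s * \<phi>
        t) * \<phi> t) (at s within UNIV)"
      by simp
  next
    fix s :: real
    have "continuous_on (cbox (-1) 1) (\<lambda>t. \<bar>w t + s * \<phi> t\<bar> powr (q + 1))"
      by (intro continuous_on_powr' continuous_on_rabs continuous_intros c[folded cbox_interval])
          (use q in auto)
    then show "(\<lambda>t. \<bar>w t + s * \<phi> t\<bar> powr (q + 1)) integrable_on cbox (-1) 1"
        by (rule integrable_continuous)
  next
    have "continuous_on (UNIV \<times> cbox (-1) 1) (\<lambda>x::real \<times> real. w (snd x))"
        "continuous_on (UNIV \<times> cbox (-1) 1) (\<lambda>x::real \<times> real. \<phi> (snd x))"
      by (rule continuous_on_compose2[OF c(1)] continuous_on_compose2[OF c(2)]; auto intro!: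
          continuous_intros)+
    then show "continuous_on (UNIV \<times> cbox (-1) 1) (\<lambda>(s, t). (q + 1) * spow q (w t + s * \<phi> t) * \<phi> t)"
      unfolding split_beta by (intro continuous_intros continuous_on_spow q)
  qed auto
  then show ?thesis unfolding power_integral_def by (simp add: mult.assoc)
qed

text \<open>Competitors must be rescaled onto the constraint. As the functional has degree 2 and the
  constraint degree \<open>q + 1\<close>, minimality says that
  \<open>g s = Q s - \<mu> * N s powr (2 / (q + 1))\<close> is nonnegative near 0, with
  \<open>g 0 = 0\<close>. The vanishing derivative of \<open>g\<close> at 0 is the claim, with the
  minimum \<open>\<mu>\<close> itself as multiplier.\<close>

lemma Euler_Lagrange:
  assumes q: "q > 0" and w: "admissible \<sigma> w" "finite_energy w" "power_integral q w = 1"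
    and min: "\<And>v. admissible \<sigma> v \<Longrightarrow> finite_energy v \<Longrightarrow> power_integral q v = 1 \<Longrightarrow> \<mu> \<le>
        energy v - \<kappa> * weighted_form v v"
    and \<mu>: "\<mu> = energy w - \<kappa> * weighted_form w w"
    and \<phi>: "admissible \<sigma> \<phi>" "grid_affine m \<phi>"
  shows "grid_form m w \<phi> = \<kappa> * weighted_form w \<phi> + \<mu> * integral {-1..1} (\<lambda>t. spow q (w t) * \<phi> t)"
proof -
  define v where "v = (\<lambda>s t. w t + s * \<phi> t)"
  define N where "N = (\<lambda>s. power_integral q (v s))"
  define Q where "Q = (\<lambda>s. energy w + 2 * s * grid_form m w \<phi> + s\<^sup>2 * grid_energy m \<phi> - \<kappa> *
      (weighted_form w w + 2 * s * weighted_form w \<phi> + s\<^sup>2 * weighted_form \<phi> \<phi>))"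
  define I where "I = integral {-1..1} (\<lambda>t. spow q (w t) * \<phi> t)"
  have v: "admissible \<sigma> (v s)" "finite_energy (v s)" for s
    using w(1) \<phi>(1) energy_add(1)[OF w(2) \<phi>(2)] unfolding v_def admissible_def
    by (auto intro!: continuous_intros simp: algebra_simps)
  have Q: "energy (v s) - \<kappa> * weighted_form (v s) (v s) = Q s" for s
    unfolding v_def energy_add(2)[OF w(2) \<phi>(2)] weighted_form_add[OF w(1,2) \<phi>(1)
        grid_affine_finite_energy[OF \<phi>(2)]] Q_def ..
  have N0: "N 0 = 1" using w(3) by (simp add: N_def v_def)
  have dN: "(N has_real_derivative (q + 1) * I) (at 0)"
    unfolding N_def v_def I_def by (rule power_integral_has_derivative[OF q w(1) \<phi>(1)])
  define g where "g = (\<lambda>s. Q s - \<mu> * N s powr (2 / (q + 1)))"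
  have "(Q has_real_derivative 2 * grid_form m w \<phi> - \<kappa> * (2 * weighted_form w \<phi>)) (at 0)"
    unfolding Q_def by (auto intro!: derivative_eq_intros)
  moreover have "((\<lambda>s. N s powr (2 / (q + 1))) has_real_derivative 2 * I) (at 0)"
    by (rule DERIV_cong[OF DERIV_fun_powr[OF dN, of "2 / (q + 1)"]]) (use N0 q in simp_all)
  ultimately have dg: "(g has_real_derivative 2 * grid_form m w \<phi> - \<kappa> * (2 * weighted_form w \<phi>) -
      \<mu> * (2 * I)) (at 0)"
    unfolding g_def by (intro DERIV_diff DERIV_cmult)
  have g0: "g 0 = 0" using \<mu> N0 by (simp add: g_def Q_def)
  have pos: "g s \<ge> 0" if "N s > 0" for s
  proof -
    \<comment> \<open>The factor that brings \<open>v s\<close> back to the constraint;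
      \<open>c\<^sup>2\<close> is the inverse of \<open>N s powr (2 / (q + 1))\<close>.\<close>
    define c where "c = N s powr (- 1 / (q + 1))"
    have c: "c > 0" using that by (simp add: c_def)
    have "c powr (q + 1) = N s powr (- 1)" using q by (simp add: c_def powr_powr)
    then have c1: "c powr (q + 1) = 1 / N s" using that by (simp add: powr_minus inverse_eq_divide)
    have "N s powr (2 / (q + 1)) * N s powr (- 1 / (q + 1)) * N s powr (- 1 / (q + 1)) = 1"
      using that by (simp add: powr_add[symmetric] add_divide_distrib[symmetric])
    then have c2: "N s powr (2 / (q + 1)) * c\<^sup>2 = 1"
        by (simp add: c_def power2_eq_square mult.assoc)
    have "\<mu> \<le> energy (\<lambda>t. c * v s t) - \<kappa> * weighted_form (\<lambda>t. c * v s t) (\<lambda>t. c * v s t)"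
    proof (rule min)
      show "admissible \<sigma> (\<lambda>t. c * v s t)" by (rule admissible_scale[OF v(1)])
      show "finite_energy (\<lambda>t. c * v s t)" using energy_scale[OF v(2)] by simp
      show "power_integral q (\<lambda>t. c * v s t) = 1" unfolding power_integral_scale using c c1 that
          by (simp add: N_def)
    qed
    also have "\<dots> = c\<^sup>2 * Q s"
      using energy_scale[OF v(2)[of s], of c] unfolding weighted_form_scale Q[symmetric]
          by (simp add: algebra_simps)
    finally have "\<mu> * N s powr (2 / (q + 1)) \<le> c\<^sup>2 * Q s * N s powr (2 / (q + 1))"
      by (rule mult_right_mono) simp
    also have "\<dots> = Q s * (N s powr (2 / (q + 1)) * c\<^sup>2)" by (simp add: mult_ac)
    also have "\<dots> = Q s" unfolding c2 by simp
    finally show ?thesis by (simp add: g_def)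
  qed
  have "(N \<longlongrightarrow> N 0) (nhds 0)"
    using DERIV_isCont[OF dN] unfolding isCont_def tendsto_at_iff_tendsto_nhds .
  from order_tendstoD(1)[OF this, of 0] have "\<forall>\<^sub>F s in nhds 0. N s > 0" using N0 by simp
  then obtain d where d: "d > 0" "\<And>s. dist s 0 < d \<Longrightarrow> N s > 0" by (auto simp: eventually_nhds_metric)
  have "2 * grid_form m w \<phi> - \<kappa> * (2 * weighted_form w \<phi>) - \<mu> * (2 * I) = 0"
    by (rule DERIV_local_min[OF dg d(1)]) (use d(2) pos g0 in \<open>auto simp: dist_norm\<close>)
  then show ?thesis by (simp add: I_def algebra_simps)
qed

section \<open>Hat functions: from the weak equation to the differential equation\<close>

definition hat :: "nat \<Rightarrow> real \<Rightarrow> real \<Rightarrow> real" where "hat n c t = max 0 (1 - 2 ^ n * \<bar>t - c\<bar>)"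

text \<open>In units of the fine mesh the kinks of a hat sit at the integers -D, 0 and D. Hence it
  is affine between consecutive integers, and the four cases are the four affine pieces.\<close>

lemma hat_midpoint:
  fixes k D :: int
  assumes "D \<ge> 1"
  shows "max 0 (1 - \<bar>of_int k + 1/2\<bar> / of_int D) =
    (max 0 (1 - \<bar>of_int k\<bar> / of_int D) + max 0 (1 - \<bar>of_int k + 1\<bar> / of_int D)) / (2::real)"
proof -
  have D: "(of_int D :: real) \<ge> 1" using assms by simp
  consider "k \<ge> D" | "0 \<le> k" "k + 1 \<le> D" | "k \<le> -1" "- k \<le> D" | "- k - 1 \<ge> D" by linarith
  then show ?thesis
  proof cases
    case 1
    then have "(of_int k :: real) \<ge> of_int D" by simp
    then have "\<bar>of_int k\<bar> / of_int D \<ge> (1::real)" "\<bar>of_int k + 1\<bar> / of_int D \<ge> (1::real)"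
      "\<bar>of_int k + 1/2\<bar> / of_int D \<ge> (1::real)" using D by (auto simp: field_simps)
    then show ?thesis by simp
  next
    case 2
    then have "(of_int k :: real) \<ge> 0" "of_int k + 1 \<le> (of_int D :: real)" by linarith+
    then have "\<bar>of_int k\<bar> / of_int D \<le> (1::real)" "\<bar>of_int k + 1\<bar> / of_int D \<le> (1::real)"
      "\<bar>of_int k + 1/2\<bar> / of_int D \<le> (1::real)" "\<bar>of_int k + 1/2\<bar> =
          (\<bar>of_int k\<bar> + \<bar>of_int k + 1\<bar>) / (2::real)"
      using D by (auto simp: field_simps)
    then show ?thesis by (simp add: add_divide_distrib)
  next
    case 3
    then have "(of_int k :: real) \<le> -1" "- of_int k \<le> (of_int D :: real)" by linarith+
    then have "\<bar>of_int k\<bar> / of_int D \<le> (1::real)" "\<bar>of_int k + 1\<bar> / of_int D \<le> (1::real)"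
      "\<bar>of_int k + 1/2\<bar> / of_int D \<le> (1::real)" "\<bar>of_int k + 1/2\<bar> =
          (\<bar>of_int k\<bar> + \<bar>of_int k + 1\<bar>) / (2::real)"
      using D by (auto simp: field_simps)
    then show ?thesis by (simp add: add_divide_distrib)
  next
    case 4
    then have "- (of_int k :: real) - 1 \<ge> of_int D" by linarith
    then have "\<bar>of_int k\<bar> / of_int D \<ge> (1::real)" "\<bar>of_int k + 1\<bar> / of_int D \<ge> (1::real)"
      "\<bar>of_int k + 1/2\<bar> / of_int D \<ge> (1::real)" using D by (auto simp: field_simps)
    then show ?thesis by simp
  qed
qed

lemma grid_affine_hat: "grid_affine n (hat n (grid n j))"
  unfolding grid_affine_def
proof (intro allI impI)
  fix l i :: nat assume l: "n \<le> l" "i < 2 * 2 ^ l"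
  \<comment> \<open>\<open>D\<close> is the number of fine cells in one coarse cell, and
    \<open>k\<close> is the offset of the fine index from the centre of the hat.\<close>
  define D :: int where "D = 2 ^ (l - n)"
  define k :: int where "k = int i - int j * D"
  have p: "(2::real) ^ l = of_int D * 2 ^ n" using l by (simp add: D_def power_add[symmetric])
  have D: "D \<ge> 1" "(of_int D :: real) > 0" by (auto simp: D_def)
  have e: "2 ^ n * \<bar>y / 2 ^ l - 1 - grid n j\<bar> = \<bar>y - real j * of_int D\<bar> / of_int D" for y :: real
  proof -
    have "2 ^ n * \<bar>y / 2 ^ l - 1 - grid n j\<bar> = \<bar>2 ^ n * (y / 2 ^ l - 1 - grid n j)\<bar>"
        by (simp add: abs_mult)
    also have "2 ^ n * (y / 2 ^ l - 1 - grid n j) = (y - real j * of_int D) / of_int D"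
      unfolding p using D(2) by (simp add: grid_def field_simps)
    finally show ?thesis using D(2) by (simp add: abs_div)
  qed
  have k: "real i - real j * of_int D = of_int k" by (simp add: k_def)
  have 1: "2 ^ n * \<bar>grid l i - grid n j\<bar> = \<bar>of_int k\<bar> / of_int D"
    using e[of "real i"] by (simp add: grid_def[of l] k)
  have 2: "2 ^ n * \<bar>grid l (Suc i) - grid n j\<bar> = \<bar>of_int k + 1\<bar> / of_int D"
    using e[of "real i + 1"] k by (simp add: grid_def[of l] algebra_simps)
  have h: "grid (Suc l) (Suc (2 * i)) = (real i + 1/2) / 2 ^ l - 1"
      by (simp add: grid_def field_simps)
  have k': "real i + 1/2 - real j * of_int D = of_int k + 1/2" using k by linarith
  have 3: "2 ^ n * \<bar>grid (Suc l) (Suc (2 * i)) - grid n j\<bar> = \<bar>of_int k + 1/2\<bar> / of_int D"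
    unfolding h e k' ..
  show "hat n (grid n j) (grid (Suc l) (Suc (2 * i))) =
      (hat n (grid n j) (grid l i) + hat n (grid n j) (grid l (Suc i))) / 2"
    unfolding hat_def 1 2 3 by (rule hat_midpoint[OF D(1)])
qed

lemma grid_affine_add: "grid_affine m \<phi> \<Longrightarrow> grid_affine m \<psi> \<Longrightarrow> grid_affine m (\<lambda>t. \<phi> t + s * \<psi> t)"
  unfolding grid_affine_def by (simp add: field_simps)

lemma grid_form_add: "grid_form n w (\<lambda>t. \<phi> t + s * \<psi> t) = grid_form n w \<phi> + s * grid_form n w \<psi>"
proof -
  have *: "(w x - w y) * (\<phi> x + s * \<psi> x - (\<phi> y + s * \<psi> y)) =
     (w x - w y) * (\<phi> x - \<phi> y) + s * ((w x - w y) * (\<psi> x - \<psi> y))" for x y by algebra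
  show ?thesis unfolding grid_form_def * sum.distrib sum_distrib_left[symmetric] by algebra
qed

lemma hat_grid: "hat n (grid n j) (grid n i) = (if i = j then 1 else 0)"
proof -
  have "2 ^ n * \<bar>grid n i - grid n j\<bar> = \<bar>2 ^ n * (grid n i - grid n j)\<bar>" by (simp add: abs_mult)
  also have "2 ^ n * (grid n i - grid n j) = real i - real j" by (simp add: grid_def field_simps)
  finally have *: "2 ^ n * \<bar>grid n i - grid n j\<bar> = \<bar>real i - real j\<bar>" .
  have "\<bar>real i - real j\<bar> \<ge> 1" if "i \<noteq> j" using that by (cases i j rule: linorder_cases) auto
  then show ?thesis unfolding hat_def * by auto
qed

text \<open>A hat has slope nonzero only on the two cells around its centre, so pairing with it
  yields minus a second difference.\<close>

lemma grid_form_hat: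
  assumes "Suc j < 2 * 2 ^ n"
  shows "grid_form n w (hat n (grid n (Suc j))) =
      2 ^ n * (2 * w (grid n (Suc j)) - w (grid n (Suc (Suc j))) - w (grid n j))"
proof -
  let ?d = "\<lambda>i. w (grid n (Suc i)) - w (grid n i)"
  have "(\<Sum>i<2 * 2 ^ n. ?d i * (hat n (grid n (Suc j)) (grid n (Suc i)) - hat n (grid n (Suc j))
      (grid n i))) =
     (\<Sum>i<2 * 2 ^ n. (if i = j then ?d i else 0) - (if i = Suc j then ?d i else 0))"
    by (intro sum.cong refl) (auto simp: hat_grid)
  also have "\<dots> = ?d j - ?d (Suc j)"
    unfolding sum_subtractf using assms by simp
  finally have *: "(\<Sum>i<2 * 2 ^ n. ?d i * (hat n (grid n (Suc j)) (grid n (Suc i)) - hat n (grid n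
      (Suc j)) (grid n i))) =
     ?d j - ?d (Suc j)" .
  show ?thesis unfolding grid_form_def * by (simp add: algebra_simps)
qed

lemma antiderivative_Ioo:
  fixes f :: "real \<Rightarrow> real"
  assumes "continuous_on {a<..<b} f" "a < b"
  obtains F where "\<And>t. t \<in> {a<..<b} \<Longrightarrow> (F has_real_derivative f t) (at t)"
proof -
  have "\<exists>F. \<forall>x. ereal a < ereal x \<longrightarrow> ereal x < ereal b \<longrightarrow> (F has_vector_derivative f x) (at x)"
    by (rule einterval_antiderivative) (use assms in \<open>auto simp: continuous_on_eq_continuous_at\<close>)
  then show ?thesis using that by (auto simp: has_real_derivative_iff_has_vector_derivative)
qed

text \<open>Integration by parts on each half of the hat: it is the kernel that turns a function
  into second differences of its second antiderivative \<open>F2\<close>. Matched with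
  \<open>grid_form_hat\<close>, this makes the weak equation a statement about second differences of
  \<open>w + F2\<close>.\<close>

lemma hat_integral:
  assumes F1: "\<And>t. t \<in> {-1<..<1} \<Longrightarrow> (F1 has_real_derivative f t) (at t)"
    and F2: "\<And>t. t \<in> {-1<..<1} \<Longrightarrow> (F2 has_real_derivative F1 t) (at t)"
    and d: "d = 1 / 2 ^ n" and c: "c - d > -1" "c + d < 1"
  shows "((\<lambda>t. f t * hat n c t) has_integral 2 ^ n * (F2 (c + d) - 2 * F2 c + F2 (c - d))) {-1..1}"
proof -
  have d0: "d > 0" using d by simp
  have "((\<lambda>t. f t * (2 ^ n * (t - (c - d)))) has_integral
     2 ^ n * ((c - (c - d)) * F1 c - F2 c) - 2 ^ n * ((c - d - (c - d)) * F1 (c - d) - F2 (c -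
         d))) {c - d..c}"
  proof (rule fundamental_theorem_of_calculus)
    fix t assume t: "t \<in> {c - d..c}"
    then have t': "t \<in> {-1<..<1}" using c d0 by auto
    have "((\<lambda>t. 2 ^ n * ((t - (c - d)) * F1 t - F2 t)) has_real_derivative
        2 ^ n * ((1 * F1 t + f t * (t - (c - d))) - F1 t)) (at t)"
      by (intro DERIV_cmult DERIV_diff DERIV_mult F1 F2 t') (auto intro!: derivative_eq_intros)
    then have "((\<lambda>t. 2 ^ n * ((t - (c - d)) * F1 t - F2 t)) has_real_derivative f t * (2 ^ n * (t
        - (c - d)))) (at t)"
      by (simp add: mult_ac)
    then show "((\<lambda>t. 2 ^ n * ((t - (c - d)) * F1 t - F2 t)) has_vector_derivative
        f t * (2 ^ n * (t - (c - d)))) (at t within {c - d..c})"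
      using has_field_derivative_at_within has_real_derivative_iff_has_vector_derivative by blast
  qed (use d0 in simp)
  then have 1: "((\<lambda>t. f t * hat n c t) has_integral 2 ^ n * (d * F1 c - F2 c + F2 (c - d))) {c -
      d..c}"
    by (rule has_integral_eq_rhs[OF has_integral_eq[rotated]])
      (use d in \<open>auto simp: hat_def max_def field_simps\<close>)
  have "((\<lambda>t. f t * (2 ^ n * (c + d - t))) has_integral
     2 ^ n * ((c + d - (c + d)) * F1 (c + d) + F2 (c + d)) - 2 ^ n * ((c + d - c) * F1 c + F2 c))
         {c..c + d}"
  proof (rule fundamental_theorem_of_calculus)
    fix t assume t: "t \<in> {c..c + d}"
    then have t': "t \<in> {-1<..<1}" using c d0 by auto
    have "((\<lambda>t. 2 ^ n * ((c + d - t) * F1 t + F2 t)) has_real_derivative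
        2 ^ n * (((- 1) * F1 t + f t * (c + d - t)) + F1 t)) (at t)"
      by (intro DERIV_cmult DERIV_add DERIV_mult F1 F2 t') (auto intro!: derivative_eq_intros)
    then have "((\<lambda>t. 2 ^ n * ((c + d - t) * F1 t + F2 t)) has_real_derivative f t * (2 ^ n * (c +
        d - t))) (at t)"
      by (simp add: mult_ac)
    then show "((\<lambda>t. 2 ^ n * ((c + d - t) * F1 t + F2 t)) has_vector_derivative
        f t * (2 ^ n * (c + d - t))) (at t within {c..c + d})"
      using has_field_derivative_at_within has_real_derivative_iff_has_vector_derivative by blast
  qed (use d0 in simp)
  then have 2: "((\<lambda>t. f t * hat n c t) has_integral 2 ^ n * (F2 (c + d) - d * F1 c - F2 c)) {c..c
      + d}"
    by (rule has_integral_eq_rhs[OF has_integral_eq[rotated]])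
      (use d in \<open>auto simp: hat_def max_def field_simps\<close>)
  have "((\<lambda>t. f t * hat n c t) has_integral
      2 ^ n * (d * F1 c - F2 c + F2 (c - d)) + 2 ^ n * (F2 (c + d) - d * F1 c - F2 c)) {c - d..c +
          d}"
    by (rule has_integral_combine[OF _ _ 1 2]) (use d0 in auto)
  then have "((\<lambda>t. f t * hat n c t) has_integral
      2 ^ n * (d * F1 c - F2 c + F2 (c - d)) + 2 ^ n * (F2 (c + d) - d * F1 c - F2 c)) {-1..1}"
  proof (rule has_integral_on_superset)
    fix t assume "t \<notin> {c - d..c + d}"
    then have "\<bar>t - c\<bar> \<ge> d" by auto
    then have "2 ^ n * \<bar>t - c\<bar> \<ge> 1" using d by (simp add: field_simps)
    then show "f t * hat n c t = 0" by (simp add: hat_def)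
  qed (use c in auto)
  then show ?thesis by (simp add: algebra_simps)
qed

text \<open>At each level the values form an arithmetic progression; after subtraction of an affine
  interpolant it vanishes at two of its points, hence everywhere, and dyadic points are dense. The
  index range keeps all three points strictly inside (-1, 1), where \<open>F2\<close> is
  controlled.\<close>

lemma affine_if_dyadic_second_differences_zero:
  assumes cont: "continuous_on {-1<..<1} g"
    and sd: "\<And>n j. 1 \<le> j \<Longrightarrow> j + 3 \<le> 2 * 2 ^ n \<Longrightarrow>
      g (grid n (Suc (Suc j))) - 2 * g (grid n (Suc j)) + g (grid n j) = 0"
  obtains A B where "\<And>t. t \<in> {-1<..<1} \<Longrightarrow> g t = A + B * t"
proof -
  \<comment> \<open>Interpolation at 0 and 1/2, which are grid points of every level
    \<open>n \<ge> 1\<close>.\<close>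
  define A where "A = g 0"
  define B where "B = 2 * (g (1/2) - g 0)"
  define h where "h = (\<lambda>t. g t - (A + B * t))"
  have hsd: "h (grid n (Suc (Suc j))) = 2 * h (grid n (Suc j)) - h (grid n j)"
      if "1 \<le> j" "j + 3 \<le> 2 * 2 ^ n" for n j
  proof -
    have "grid n (Suc (Suc j)) - 2 * grid n (Suc j) + grid n j = 0"
        by (simp add: grid_def field_simps)
    then have "B * (grid n (Suc (Suc j)) - 2 * grid n (Suc j) + grid n j) = 0" by simp
    then show ?thesis using sd[OF that] unfolding h_def by (simp add: algebra_simps)
  qed
  have arith: "j + 2 \<le> 2 * 2 ^ n \<Longrightarrow> h (grid n (Suc j)) =
      h (grid n 1) + real j * (h (grid n 2) - h (grid n 1))
      \<and> (j + 3 \<le> 2 * 2 ^ n \<longrightarrow> h (grid n (Suc (Suc j))) = h (grid n 1) + real (Suc j) * (h (grid n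
          2) - h (grid n 1)))" for n j
  proof (induction j)
    case (Suc j)
    then show ?case using hsd[of "Suc j" n] by (auto simp: algebra_simps)
  qed (simp add: numeral_2_eq_2)
  have hz: "h (grid n j) = 0" if "n \<ge> 1" "1 \<le> j" "j + 1 \<le> 2 * 2 ^ n" for n j
  proof -
    obtain m where m: "n = Suc m" using \<open>n \<ge> 1\<close> by (cases n) auto
    have p0: "grid n (2 ^ n) = 0" "grid n (2 ^ n + 2 ^ m) = 1/2"
        by (simp_all add: grid_def m field_simps)
    have m1: "(2::nat) ^ m \<ge> 1" by simp
    have z: "h 0 = 0" "h (1/2) = 0" by (simp_all add: h_def A_def B_def field_simps)
    have "h (grid n (Suc (2 ^ n - 1))) = h (grid n 1) + real (2 ^ n - 1) * (h (grid n 2) - h (grid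
        n 1))"
      using arith[of "2 ^ n - 1" n] m1 by (simp add: m)
    then have 1: "h (grid n 1) + real (2 ^ n - 1) * (h (grid n 2) - h (grid n 1)) = 0" using z p0
        by simp
    have s2: "Suc (2 ^ n + 2 ^ m - 1) = 2 ^ n + 2 ^ m" by simp
    have "2 ^ n + 2 ^ m - 1 + 2 \<le> 2 * (2::nat) ^ n" using m1 by (simp add: m)
    from arith[OF this, THEN conjunct1, unfolded s2 p0(2) z(2)]
    have 2: "h (grid n 1) + real (2 ^ n + 2 ^ m - 1) * (h (grid n 2) - h (grid n 1)) = 0"
        by (rule sym)
    have "real (Suc (2 ^ n + 2 ^ m - 1)) = real (2 ^ n + 2 ^ m)" unfolding s2 ..
    then have "real (2 ^ n + 2 ^ m - 1) = 2 ^ n + 2 ^ m - 1"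
      by (simp only: of_nat_Suc of_nat_add of_nat_power of_nat_numeral)
    moreover have "real (2 ^ n - 1) = 2 ^ n - 1" by simp
    ultimately have "real (2 ^ n + 2 ^ m - 1) - real (2 ^ n - 1) = 2 ^ m" by linarith
    moreover have "D * e = 0" if "P - R = D" "a + R * e = 0" "a + P * e = 0" for P R D a e :: real
      unfolding that(1)[symmetric] left_diff_distrib using that(2,3) by linarith
    ultimately have "2 ^ m * (h (grid n 2) - h (grid n 1)) = 0" using 1 2 by blast
    then have "h (grid n 2) - h (grid n 1) = 0" by simp
    then have "h (grid n 1) = 0" "h (grid n 2) - h (grid n 1) = 0" using 1 by auto
    then show ?thesis using arith[of "j - 1" n] that by simp
  qed
  have "g t = A + B * t" if t: "t \<in> {-1<..<1}" for t
  proof -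
    let ?p = "\<lambda>n. grid n (nat \<lfloor>(t + 1) * 2 ^ n\<rfloor>)"
    have t': "t \<in> {-1..1}" using t by auto
    have hc: "continuous_on {-1<..<1} h" unfolding h_def by (intro continuous_intros cont)
    have ev: "\<forall>\<^sub>F n in sequentially. ?p n \<in> {-1<..<1}"
      by (rule topological_tendstoD[OF grid_tendsto(1)[OF t'] _ t]) simp
    have "(\<lambda>n. h (?p n)) \<longlonglongrightarrow> h t"
      by (rule continuous_on_tendsto_compose[OF hc grid_tendsto(1)[OF t'] t ev])
    moreover have "(\<lambda>n. h (?p n)) \<longlonglongrightarrow> 0"
    proof (rule tendsto_eventually, use ev eventually_ge_at_top[of 1] in eventually_elim)
      case (elim n)
      define j where "j = nat \<lfloor>(t + 1) * 2 ^ n\<rfloor>"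
      have "grid n j \<in> {-1<..<1}" using elim j_def by simp
      then have "real j > 0" "real j < 2 * 2 ^ n" by (auto simp: grid_def field_simps)
      then have "j \<ge> 1" "real j < real (2 * 2 ^ n)" by auto
      then have "j \<ge> 1" "j < 2 * 2 ^ n" by (auto simp only: of_nat_less_iff)
      then show "h (grid n (nat \<lfloor>(t + 1) * 2 ^ n\<rfloor>)) = 0" using hz[of n j] elim(2)
          by (simp add: j_def)
    qed
    ultimately have "h t = 0" by (rule LIMSEQ_unique)
    then show ?thesis by (simp add: h_def)
  qed
  then show ?thesis using that by blast
qed

lemma hat_minus: "hat n c (- t) = hat n (- c) t"
proof -
  have "\<bar>- t - c\<bar> = \<bar>t - (- c)\<bar>" by linarith
  then show ?thesis by (simp only: hat_def)
qed

lemma grid_minus: "j \<le> 2 * 2 ^ n \<Longrightarrow> - grid n j = grid n (2 * 2 ^ n - j)"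
  by (simp add: grid_def of_nat_diff field_simps)

text \<open>With \<open>F2\<close> a second antiderivative of the right-hand side \<open>f\<close>,
  testing with hats shows that \<open>w + F2\<close> has no second differences, so it is affine and
  w'' = -f. Regularity of the minimiser thus comes out of the weak equation itself.\<close>

lemma minimizer_ode:
  assumes q: "q > 0" and \<sigma>: "\<sigma> = 1 \<or> \<sigma> = -1" and w: "admissible \<sigma> w" "finite_energy w"
      "power_integral q w = 1"
    and min: "\<And>v. admissible \<sigma> v \<Longrightarrow> finite_energy v \<Longrightarrow> power_integral q v = 1 \<Longrightarrow> \<mu> \<le>
        energy v - \<kappa> * weighted_form v v"
    and \<mu>: "\<mu> = energy w - \<kappa> * weighted_form w w"
  obtains w' where "\<And>t. t \<in> {-1<..<1} \<Longrightarrow> (w has_real_derivative w' t) (at t)"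
    "\<And>t. t \<in> {-1<..<1} \<Longrightarrow>
      (w' has_real_derivative - (\<kappa> * w t / (1 - t\<^sup>2) + \<mu> * spow q (w t))) (at t)"
proof -
  define f where "f = (\<lambda>t. \<kappa> * w t / (1 - t\<^sup>2) + \<mu> * spow q (w t))"
  have wc: "continuous_on {-1..1} w" "continuous_on {-1<..<1} w"
    using w(1) by (auto simp: admissible_def intro: continuous_on_subset)
  have ws: "w (- t) = \<sigma> * w t" if "t \<in> {-1..1}" for t using w(1) that by (simp add: admissible_def)
  have fc: "continuous_on {-1<..<1} f" unfolding f_def
    by (intro continuous_intros continuous_on_spow q wc(2)) (use one_minus_sq in force)
  obtain F1 where F1: "\<And>t. t \<in> {-1<..<1} \<Longrightarrow> (F1 has_real_derivative f t) (at t)"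
    using antiderivative_Ioo[OF fc] by auto
  have F1c: "continuous_on {-1<..<1} F1"
    by (intro continuous_at_imp_continuous_on ballI) (rule DERIV_isCont[OF F1])
  obtain F2 where F2: "\<And>t. t \<in> {-1<..<1} \<Longrightarrow> (F2 has_real_derivative F1 t) (at t)"
    using antiderivative_Ioo[OF F1c] by auto
  have F2c: "continuous_on {-1<..<1} F2"
    by (intro continuous_at_imp_continuous_on ballI) (rule DERIV_isCont[OF F2])
  have key: "(w (grid n (Suc (Suc j))) + F2 (grid n (Suc (Suc j)))) - 2 * (w (grid n (Suc j)) + F2
      (grid n (Suc j)))
      + (w (grid n j) + F2 (grid n j)) = 0" if j: "1 \<le> j" "j + 3 \<le> 2 * 2 ^ n" for n j
  proof -
    define c where "c = grid n (Suc j)"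
    define d :: real where "d = 1 / 2 ^ n"
    have cd: "c + d = grid n (Suc (Suc j))" "c - d = grid n j"
        by (simp_all add: c_def d_def grid_def field_simps)
    have bd: "c - d > -1" "c + d < 1"
    proof -
      show "c - d > -1" using j unfolding cd by (simp add: grid_def)
      have "real (j + 3) \<le> real (2 * 2 ^ n)" using j(2) by (simp only: of_nat_le_iff)
      then show "c + d < 1" unfolding cd by (simp add: grid_def field_simps)
    qed
    have d0: "d > 0" by (simp add: d_def)
    \<comment> \<open>A single hat lacks the parity required of a competitor, so its mirror image is
      added with sign \<open>\<sigma>\<close>.\<close>
    define \<phi> where "\<phi> = (\<lambda>t. hat n c t + \<sigma> * hat n (- c) t)"
    define I where "I = 2 ^ n * (F2 (c + d) - 2 * F2 c + F2 (c - d))"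
    \<comment> \<open>The mirrored stencil starts at \<open>j'\<close>: reflection maps the indices
      \<open>j\<close>, \<open>Suc j\<close>, \<open>Suc (Suc j)\<close> to
      \<open>Suc (Suc j')\<close>, \<open>Suc j'\<close>, \<open>j'\<close>.\<close>
    define j' where "j' = 2 * 2 ^ n - Suc (Suc j)"
    have mc: "- c = grid n (Suc j')" "- (c + d) = grid n j'" "- (c - d) = grid n (Suc (Suc j'))"
      unfolding cd unfolding c_def using j grid_minus[of _ n] by (auto simp: j'_def Suc_diff_Suc)
    have z: "hat n c t = 0" if "\<bar>t - c\<bar> \<ge> d" for t
    proof -
      have "2 ^ n * \<bar>t - c\<bar> \<ge> 1" using that by (simp add: d_def field_simps)
      then show ?thesis by (simp add: hat_def)
    qed
    have z1: "hat n c 1 = 0" "hat n (- c) 1 = 0"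
      using z[of 1] z[of "-1"] hat_minus[of n c 1] bd by auto
    have hc: "continuous_on S (hat n e)" for S e unfolding hat_def by (intro continuous_intros)
    have s2: "\<sigma> * \<sigma> = 1" using \<sigma> by auto
    have admissible: "admissible \<sigma> \<phi>" unfolding admissible_def \<phi>_def
    proof (intro conjI ballI)
      show "continuous_on {-1..1} (\<lambda>t. hat n c t + \<sigma> * hat n (- c) t)"
        by (intro continuous_intros hc)
      show "hat n c (- t) + \<sigma> * hat n (- c) (- t) = \<sigma> * (hat n c t + \<sigma> * hat n (- c) t)" for t
        using s2 by (simp add: hat_minus algebra_simps mult.assoc[symmetric])
    qed (simp add: z1)
    have pl: "grid_affine n \<phi>" unfolding \<phi>_def mc(1)
        by (rule grid_affine_add[OF _ grid_affine_hat]) (simp add: c_def grid_affine_hat)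
    have wsym: "w (grid n (Suc j')) = \<sigma> * w c" "w (grid n j') =
        \<sigma> * w (c + d)" "w (grid n (Suc (Suc j'))) = \<sigma> * w (c - d)"
      unfolding mc[symmetric] using bd d0 by (intro ws; auto)+
    have "grid_form n w \<phi> = 2 ^ n * (2 * w c - w (c + d) - w (c - d)) + \<sigma> * (2 ^ n * (2 * w (grid
        n (Suc j')) - w (grid n (Suc (Suc j'))) - w (grid n j')))"
      unfolding \<phi>_def grid_form_add mc(1) cd unfolding c_def using j
          by (simp add: grid_form_hat j'_def)
    also have "\<dots> = 2 ^ n * (2 * w c - w (c + d) - w (c - d)) + (\<sigma> * \<sigma>) * (2 ^ n * (2 * w c - w (c
        - d) - w (c + d)))"
      unfolding wsym by algebra
    finally have L: "grid_form n w \<phi> = 2 * (2 ^ n * (2 * w c - w (c + d) - w (c - d)))"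
        unfolding s2 by simp
    have i1: "((\<lambda>t. f t * hat n c t) has_integral I) {-1..1}"
      unfolding I_def by (rule hat_integral[OF F1 F2 d_def bd])
    then have "((\<lambda>t. f (- t) * hat n c (- t)) has_integral I) {-1..1}"
      using has_integral_reflect_real[of "\<lambda>t. f t * hat n c t" I 1 "-1"] by simp
    \<comment> \<open>As \<open>f\<close> inherits the parity of \<open>w\<close>, the mirrored hat
      contributes the same integral as the original one; both sides of the equation just
      double.\<close>
    then have "((\<lambda>t. \<sigma> * (f t * hat n (- c) t)) has_integral I) {-1..1}"
    proof (rule has_integral_eq[rotated])
      fix t :: real assume "t \<in> {-1..1}"
      then have "f (- t) = \<sigma> * f t" unfolding f_def by (simp add: ws spow_sign[OF \<sigma>] algebra_simps)
      then show "f (- t) * hat n c (- t) = \<sigma> * (f t * hat n (- c) t)" by (simp add: hat_minus)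
    qed
    from has_integral_add[OF i1 this]
    have i2: "((\<lambda>t. f t * \<phi> t) has_integral 2 * I) {-1..1}"
      by (simp add: \<phi>_def algebra_simps)
    have k1: "((\<lambda>t. w t * \<phi> t / (1 - t\<^sup>2)) has_integral weighted_form w \<phi>) {-1..1}"
      unfolding weighted_form_def by (rule integrable_integral[OF weighted_form_integrable[OF
          admissible grid_affine_finite_energy[OF pl] w(1,2)]])
    have k2: "((\<lambda>t. spow q (w t) * \<phi> t) has_integral integral {-1..1} (\<lambda>t. spow q (w t) * \<phi> t))
        {-1..1}"
      by (intro integrable_integral integrable_continuous_real continuous_intros
          continuous_on_spow q wc(1))
        (use admissible in \<open>simp add: admissible_def\<close>)
    have "((\<lambda>t. \<kappa> * (w t * \<phi> t / (1 - t\<^sup>2)) + \<mu> * (spow q (w t) * \<phi> t)) has_integral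
        \<kappa> * weighted_form w \<phi> + \<mu> * integral {-1..1} (\<lambda>t. spow q (w t) * \<phi> t)) {-1..1}"
      by (intro has_integral_add has_integral_mult_right k1 k2)
    moreover have "grid_form n w \<phi> = \<kappa> * weighted_form w \<phi> + \<mu> * integral {-1..1} (\<lambda>t. spow q (w
        t) * \<phi> t)"
      by (rule Euler_Lagrange[OF q w min \<mu> admissible pl])
    moreover have "f t * \<phi> t = \<kappa> * (w t * \<phi> t / (1 - t\<^sup>2)) + \<mu> * (spow q (w t) * \<phi> t)" for t
      by (simp add: f_def algebra_simps)
    ultimately have "((\<lambda>t. f t * \<phi> t) has_integral grid_form n w \<phi>) {-1..1}" by (simp only:)
    from has_integral_unique[OF i2 this] have "I = 2 ^ n * (2 * w c - w (c + d) - w (c - d))"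
      unfolding L by simp
    then have "2 ^ n * (F2 (c + d) - 2 * F2 c + F2 (c - d)) =
        2 ^ n * (2 * w c - w (c + d) - w (c - d))"
      unfolding I_def .
    then have "F2 (c + d) - 2 * F2 c + F2 (c - d) = 2 * w c - w (c + d) - w (c - d)" by simp
    then show ?thesis unfolding cd by (simp add: c_def)
  qed
  obtain A B where AB: "\<And>t. t \<in> {-1<..<1} \<Longrightarrow> w t + F2 t = A + B * t"
    using affine_if_dyadic_second_differences_zero[of "\<lambda>t. w t + F2 t"] key
      continuous_on_add[OF wc(2) F2c] by blast
  show ?thesis
  proof (rule that[of "\<lambda>t. B - F1 t"])
    fix t :: real assume t: "t \<in> {-1<..<1}"
    have "((\<lambda>t. A + B * t - F2 t) has_real_derivative B - F1 t) (at t)"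
      by (auto intro!: derivative_eq_intros F2 t)
    then show "(w has_real_derivative B - F1 t) (at t)"
      by (rule has_field_derivative_transform_within_open[OF _ _ t]) (use AB in \<open>auto simp:
          algebra_simps\<close>)
    have "((\<lambda>t. B - F1 t) has_real_derivative 0 - f t) (at t)"
      by (intro DERIV_diff DERIV_const F1 t)
    then show "((\<lambda>t. B - F1 t) has_real_derivative - (\<kappa> * w t / (1 - t\<^sup>2) + \<mu> * spow q (w t))) (at
        t)"
      by (simp add: f_def)
  qed
qed

section \<open>Regularity at the poles\<close>

lemma continuous_extension_Icc:
  fixes g :: "real \<Rightarrow> real"
  assumes "continuous_on {-1..1} g"
  obtains G where "continuous_on UNIV G" "\<And>t. t \<in> {-1..1} \<Longrightarrow> G t = g t"
proof
  show "continuous_on UNIV (\<lambda>t. g (max (-1) (min 1 t)))"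
    by (rule continuous_on_compose2[OF assms]) (auto intro!: continuous_intros)
qed auto

text \<open>Derivative sequences live on the whole line, while the profiles are known only on
  [-1, 1]. Integrating a continuous extension of the derivative gives a globally differentiable
  function with the same values on the interval.\<close>

lemma derivative_extension_Icc:
  fixes f f' :: "real \<Rightarrow> real"
  assumes f: "continuous_on {-1..1} f" and f': "continuous_on UNIV f'"
    and d: "\<And>t. t \<in> {-1<..<1} \<Longrightarrow> (f has_real_derivative f' t) (at t)"
  obtains F where "\<And>t. (F has_real_derivative f' t) (at t)" "\<And>t. t \<in> {-1..1} \<Longrightarrow> F t = f t"
proof -
  have "\<exists>F. \<forall>x. - \<infinity> < ereal x \<longrightarrow> ereal x < \<infinity> \<longrightarrow> (F has_vector_derivative f' x) (at x)"
    by (rule einterval_antiderivative) (use f' in \<open>auto simp: continuous_on_eq_continuous_at\<close>)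
  then obtain F where F: "(F has_real_derivative f' t) (at t)" for t
    by (auto simp: has_real_derivative_iff_has_vector_derivative)
  have Fc: "continuous_on S F" for S
    by (intro continuous_at_imp_continuous_on ballI) (rule DERIV_isCont[OF F])
  have "f t - F t = f (-1) - F (-1)" if t: "t \<in> {-1..1}" for t
  proof (cases "t = -1")
    case False
    show ?thesis
    proof (rule DERIV_isconst2[of "-1" 1 "\<lambda>t. f t - F t" t])
      show "continuous_on {-1..1} (\<lambda>t. f t - F t)" by (intro continuous_on_diff f Fc)
      show "((\<lambda>t. f t - F t) has_real_derivative 0) (at x)" if "-1 < x" "x < 1" for x
        using DERIV_diff[OF d[of x] F[of x]] that by simp
    qed (use t in auto)
  qed simp
  then have e: "F t + (f (-1) - F (-1)) = f t" if "t \<in> {-1..1}" for t using that by (smt (verit))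
  show ?thesis
    by (rule that[of "\<lambda>t. F t + (f (-1) - F (-1))"])
      (use e F in \<open>auto intro!: derivative_eq_intros\<close>)
qed

lemma quotient_tendsto_left:
  fixes Y Z :: "real \<Rightarrow> real"
  assumes Y: "continuous_on {-1..1} Y" "Y 1 = 0" and Z: "continuous_on UNIV Z"
    and d: "\<And>t. t \<in> {-1<..<1} \<Longrightarrow> (Y has_real_derivative (1 - t\<^sup>2) ^ j * Z t) (at t)"
  shows "((\<lambda>t. Y t / (1 - t\<^sup>2) ^ Suc j) \<longlongrightarrow> - Z 1 / (2 * real (Suc j))) (at_left 1)"
proof -
  define D where "D = (\<lambda>t::real. real (Suc j) * (1 - t\<^sup>2) ^ j * (- 2 * t))"
  have ev: "\<forall>\<^sub>F t in at_left 1. t \<in> {0<..<1::real}" by (rule eventually_at_left_real) simp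
  show ?thesis
  proof (rule lhopital_left[where g'=D and f'="\<lambda>t. (1 - t\<^sup>2) ^ j * Z t"])
    show "(Y \<longlongrightarrow> 0) (at_left 1)"
      using Y by (auto simp: continuous_on_def at_within_Icc_at_left dest: bspec[of _ _ 1])
    have "((\<lambda>t::real. (1 - t\<^sup>2) ^ Suc j) \<longlongrightarrow> (1 - 1\<^sup>2) ^ Suc j) (at_left 1)" by (intro tendsto_intros)
    then show "((\<lambda>t::real. (1 - t\<^sup>2) ^ Suc j) \<longlongrightarrow> 0) (at_left 1)" by simp
    show "\<forall>\<^sub>F t in at_left 1. (1 - t\<^sup>2) ^ Suc j \<noteq> (0::real)"
      by (rule eventually_mono[OF ev]) (use one_minus_sq in force)
    show "\<forall>\<^sub>F t in at_left 1. D t \<noteq> 0"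
    proof (rule eventually_mono[OF ev])
      fix t :: real assume "t \<in> {0<..<1}"
      then show "D t \<noteq> 0" using one_minus_sq[of t] by (simp add: D_def)
    qed
    show "\<forall>\<^sub>F t in at_left 1. (Y has_real_derivative (1 - t\<^sup>2) ^ j * Z t) (at t)"
      by (rule eventually_mono[OF ev]) (simp add: d)
    have "((\<lambda>t. (1 - t\<^sup>2) ^ Suc j) has_real_derivative D t) (at t)" for t
      unfolding D_def by (rule derivative_eq_intros refl | simp)+
    then show "\<forall>\<^sub>F t in at_left 1. ((\<lambda>t. (1 - t\<^sup>2) ^ Suc j) has_real_derivative D t) (at t)" by simp
    have "(Z \<longlongrightarrow> Z 1) (at_left 1)"
      using Z by (meson UNIV_I continuous_on_def tendsto_within_subset subset_UNIV)
    then have "((\<lambda>t. - Z t / (2 * real (Suc j) * t)) \<longlongrightarrow> - Z 1 / (2 * real (Suc j) * 1)) (at_left 1)"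
      by (intro tendsto_intros) simp_all
    then have *: "((\<lambda>t. - Z t / (2 * real (Suc j) * t)) \<longlongrightarrow> - Z 1 / (2 * real (Suc j))) (at_left 1)"
        by simp
    show "((\<lambda>t. (1 - t\<^sup>2) ^ j * Z t / D t) \<longlongrightarrow> - Z 1 / (2 * real (Suc j))) (at_left 1)"
    proof (rule Lim_transform_eventually[OF *], rule eventually_mono[OF ev])
      fix t :: real assume t: "t \<in> {0<..<1}"
      have "P * z / (S * P * (- 2 * t)) = - z / (2 * S * t)" if "P \<noteq> 0" "S \<noteq> 0" for P z S :: real
        using that t by (simp add: field_simps)
      moreover have "(1 - t\<^sup>2) ^ j \<noteq> 0" using one_minus_sq[of t] t by simp
      moreover have "real (Suc j) \<noteq> 0" by simp
      ultimately show "- Z t / (2 * real (Suc j) * t) = (1 - t\<^sup>2) ^ j * Z t / D t" unfolding D_def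
          by metis
    qed
  qed
qed

text \<open>Division by a zero of order \<open>Suc j\<close> at both poles, justified by l'Hopital's
  rule. It is applied with \<open>j\<close> equal to 0, 1 and 2 to reach the quotient w / (1 - t^2)
  and its first and second derivatives.\<close>

lemma quotient_extends:
  fixes Y Z :: "real \<Rightarrow> real"
  assumes Y: "continuous_on {-1..1} Y" "Y 1 = 0" "Y (-1) = 0" and Z: "continuous_on UNIV Z"
    and d: "\<And>t. t \<in> {-1<..<1} \<Longrightarrow> (Y has_real_derivative (1 - t\<^sup>2) ^ j * Z t) (at t)"
  obtains V where "continuous_on UNIV V" "\<And>t. t \<in> {-1..1} \<Longrightarrow> Y t = (1 - t\<^sup>2) ^ Suc j * V t"
proof -
  \<comment> \<open>The second branch is the l'Hopital limit at both endpoints at once; the factor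
    \<open>- t\<close> accounts for the sign of the derivative of 1 - t^2 there.\<close>
  define v where "v = (\<lambda>t. if t \<in> {-1<..<1} then Y t / (1 - t\<^sup>2) ^ Suc j else - t * Z t / (2 *
      real (Suc j)))"
  have l1: "((\<lambda>t. Y t / (1 - t\<^sup>2) ^ Suc j) \<longlongrightarrow> v 1) (at_left 1)"
    using quotient_tendsto_left[OF Y(1,2) Z d] by (simp add: v_def)
  have "((\<lambda>t. Y (- t) / (1 - t\<^sup>2) ^ Suc j) \<longlongrightarrow> - (- Z (- 1)) / (2 * real (Suc j))) (at_left 1)"
  proof (rule quotient_tendsto_left)
    show "continuous_on {-1..1} (\<lambda>t. Y (- t))" "continuous_on UNIV (\<lambda>t. - Z (- t))"
      by (intro continuous_on_minus continuous_on_compose2[OF Y(1)] continuous_on_compose2[OF Z]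
          continuous_on_id; auto)+
    show "((\<lambda>t. Y (- t)) has_real_derivative (1 - t\<^sup>2) ^ j * - Z (- t)) (at t)" if "t \<in> {-1<..<1}"
        for t
      using DERIV_mirror[of Y "(1 - t\<^sup>2) ^ j * Z (- t)" t] d[of "- t"] that by simp
  qed (use Y in simp)
  then have l2: "((\<lambda>t. Y t / (1 - t\<^sup>2) ^ Suc j) \<longlongrightarrow> v (-1)) (at_right (-1))"
    by (simp add: filterlim_at_left_to_right v_def)
  have "continuous_on {-1..1} v"
  proof (rule continuous_on_IccI)
    have "\<forall>\<^sub>F t in at_right (-1). t \<in> {-1<..<1::real}" by (rule eventually_at_right_real) simp
    then show "(v \<longlongrightarrow> v (-1)) (at_right (-1))"
      by (intro Lim_transform_eventually[OF l2]) (auto elim!: eventually_mono simp: v_def)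
    have "\<forall>\<^sub>F t in at_left 1. t \<in> {-1<..<1::real}" by (rule eventually_at_left_real) simp
    then show "(v \<longlongrightarrow> v 1) (at_left 1)"
      by (intro Lim_transform_eventually[OF l1]) (auto elim!: eventually_mono simp: v_def)
    show "v \<midarrow>x\<rightarrow> v x" if "-1 < x" "x < 1" for x
    proof -
      have x: "x \<in> {-1<..<1}" using that by simp
      have "isCont Y x" by (rule DERIV_isCont[OF d[OF x]])
      then have "((\<lambda>t. Y t / (1 - t\<^sup>2) ^ Suc j) \<longlongrightarrow> Y x / (1 - x\<^sup>2) ^ Suc j) (at x)"
        by (intro tendsto_intros) (use one_minus_sq[OF x] in \<open>auto simp: isCont_def\<close>)
      then have "((\<lambda>t. Y t / (1 - t\<^sup>2) ^ Suc j) \<longlongrightarrow> v x) (at x)" using x by (simp add: v_def)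
      then show ?thesis
        by (rule Lim_transform_within_open[OF _ open_greaterThanLessThan x]) (simp add: v_def)
    qed
  qed simp
  then obtain V where V: "continuous_on UNIV V" "\<And>t. t \<in> {-1..1} \<Longrightarrow> V t = v t"
    using continuous_extension_Icc by blast
  have "Y t = (1 - t\<^sup>2) ^ Suc j * V t" if t: "t \<in> {-1..1}" for t
  proof (cases "t \<in> {-1<..<1}")
    case True
    then show ?thesis using V(2)[OF t] one_minus_sq[OF True] by (simp add: v_def)
  next
    case False
    then have "t = 1 \<or> t = -1" using t by auto
    then show ?thesis using Y by auto
  qed
  then show ?thesis using that V(1) by blast
qed

lemma spow_has_derivative:
  assumes q: "q > 1"
  shows "(spow q has_real_derivative q * \<bar>x\<bar> powr (q - 1)) (at x)"
proof (cases "x = 0")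
  case False
  have "((\<lambda>y. sgn x * \<bar>y\<bar> powr q) has_real_derivative sgn x * (q * \<bar>x\<bar> powr (q - 1) * sgn x)) (at
      x)"
    by (intro DERIV_cmult DERIV_cong[OF DERIV_fun_powr[OF has_real_derivative_abs[OF False]]])
        (use False in simp_all)
  moreover have "sgn x * (q * \<bar>x\<bar> powr (q - 1) * sgn x) = q * \<bar>x\<bar> powr (q - 1)"
    using False by (simp add: sgn_if)
  ultimately have "((\<lambda>y. sgn x * \<bar>y\<bar> powr q) has_real_derivative q * \<bar>x\<bar> powr (q - 1)) (at x)"
      by simp
  then show ?thesis
  proof (rule has_field_derivative_transform_within_open)
    show "open {y. sgn x * y > 0}" by (intro open_Collect_less continuous_intros)
  qed (use False in \<open>auto simp: spow_def sgn_if split: if_splits\<close>)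
next
  case True
  have "((\<lambda>h. \<bar>h\<bar> powr (q - 1)) \<longlongrightarrow> \<bar>0\<bar> powr (q - 1)) (at (0::real))"
    by (intro tendsto_powr2 tendsto_rabs tendsto_ident_at tendsto_const) (use q in auto)
  then have 0: "((\<lambda>h. \<bar>h\<bar> powr (q - 1)) \<longlongrightarrow> 0) (at (0::real))" using q by simp
  have "((\<lambda>h. (spow q (0 + h) - spow q 0) / h) \<longlongrightarrow> 0) (at (0::real))"
  proof (rule Lim_null_comparison[OF _ 0], rule always_eventually, rule allI)
    fix h :: real
    have "\<bar>h\<bar> powr ((q - 1) + 1) = \<bar>h\<bar> powr (q - 1) * \<bar>h\<bar>"
      by (simp only: powr_add powr_one abs_ge_zero)
    then show "norm ((spow q (0 + h) - spow q 0) / h) \<le> \<bar>h\<bar> powr (q - 1)"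
      by (cases "h = 0") (use q in \<open>auto simp: spow_def abs_mult sgn_if\<close>)
  qed
  then show ?thesis using True q by (simp add: DERIV_def spow_def)
qed

locale ode_profile =
  fixes q \<sigma> \<kappa> \<mu> :: real and w w' :: "real \<Rightarrow> real"
  assumes q: "q > 0" and w: "admissible \<sigma> w" "finite_energy w"
    and dw: "\<And>t. t \<in> {-1<..<1} \<Longrightarrow> (w has_real_derivative w' t) (at t)"
    and dw': "\<And>t. t \<in> {-1<..<1} \<Longrightarrow>
      (w' has_real_derivative - (\<kappa> * w t / (1 - t\<^sup>2) + \<mu> * spow q (w t))) (at t)"
begin

lemma w_cont: "continuous_on {-1..1} w" and w1: "w 1 = 0" "w (-1) = 0"
  using w(1) admissible_minus1 by (auto simp: admissible_def)

lemma w_bound: "t \<in> {-1..1} \<Longrightarrow> \<bar>w t\<bar> \<le> sqrt (energy w) * sqrt (1 - t\<^sup>2)"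
  using real_le_rsqrt[of "\<bar>w t\<bar>" "energy w * (1 - t\<^sup>2)"] admissible_sq_le[OF w(1)
      grid_energy_le_energy[OF w(2)]]
  by (simp add: real_sqrt_mult)

text \<open>Near the poles the decay of \<open>w\<close> gives only |w''| \<le> C / sqrt(1 - t^2).
  This bound is unbounded but integrable, with antiderivative C arcsin t; hence w' is uniformly
  continuous, since arcsin is.\<close>

lemma w'_extends:
  obtains W where "continuous_on UNIV W" "\<And>t. t \<in> {-1<..<1} \<Longrightarrow> W t = w' t"
proof -
  define f where "f = (\<lambda>t. \<kappa> * w t / (1 - t\<^sup>2) + \<mu> * spow q (w t))"
  define C where "C = \<bar>\<kappa>\<bar> * sqrt (energy w) + \<bar>\<mu>\<bar> * sqrt (energy w) powr q"
  have en0: "sqrt (energy w) \<ge> 0" using energy_nonneg[OF w(2)] by simp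
  have fb: "\<bar>f t\<bar> \<le> C * inverse (sqrt (1 - t\<^sup>2))" if t: "t \<in> {-1<..<1}" for t
  proof -
    define r where "r = sqrt (1 - t\<^sup>2)"
    have r: "r > 0" "r \<le> 1" "r * r = 1 - t\<^sup>2" using one_minus_sq[OF t] by (auto simp: r_def)
    have wb: "\<bar>w t\<bar> \<le> sqrt (energy w) * r" using w_bound[of t] t by (simp add: r_def)
    have "sqrt (energy w) * r \<le> sqrt (energy w) * 1" using r(2) en0 by (rule mult_left_mono)
    with wb have wb': "\<bar>w t\<bar> \<le> sqrt (energy w)" by simp
    have "\<bar>w t\<bar> / (r * r) \<le> sqrt (energy w) * r / (r * r)"
      by (intro divide_right_mono wb mult_nonneg_nonneg less_imp_le[OF r(1)])
    moreover have "sqrt (energy w) * r / (r * r) = sqrt (energy w) * inverse r" using r(1)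
        by (simp add: divide_inverse)
    ultimately have 1: "\<bar>w t\<bar> / (1 - t\<^sup>2) \<le> sqrt (energy w) * inverse r" unfolding r(3) by simp
    have "\<bar>spow q (w t)\<bar> \<le> sqrt (energy w) powr q"
      using wb' q by (auto simp: spow_def abs_mult sgn_if intro!: powr_mono2)
    also have "\<dots> \<le> sqrt (energy w) powr q * inverse r"
      using r by (intro mult_left_mono[of 1 "inverse r", simplified]) (auto simp: field_simps)
    finally have 2: "\<bar>spow q (w t)\<bar> \<le> sqrt (energy w) powr q * inverse r" .
    have "\<bar>f t\<bar> \<le> \<bar>\<kappa>\<bar> * (\<bar>w t\<bar> / (1 - t\<^sup>2)) + \<bar>\<mu>\<bar> * \<bar>spow q (w t)\<bar>"
      unfolding f_def
      by (rule order_trans[OF abs_triangle_ineq]) (use one_minus_sq[OF t] in \<open>simp add: abs_mult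
          abs_div\<close>)
    also have "\<dots> \<le> \<bar>\<kappa>\<bar> * (sqrt (energy w) * inverse r) + \<bar>\<mu>\<bar> * (sqrt (energy w) powr q * inverse r)"
      by (intro add_mono mult_left_mono 1 2) auto
    finally show ?thesis by (simp add: C_def r_def algebra_simps)
  qed
  have inc: "\<bar>w' t - w' s\<bar> \<le> C * (arcsin t - arcsin s)"
      if st: "s \<in> {-1<..<1}" "t \<in> {-1<..<1}" "s \<le> t" for s t
  proof -
    \<comment> \<open>Used with \<open>c = 1\<close> and \<open>c = -1\<close>, giving one
      nondecreasing and one nonincreasing function and so a two-sided bound on increments of
      w'.\<close>
    have da: "((\<lambda>x. c * (C * arcsin x) + w' x) has_real_derivative c * (C * inverse (sqrt (1 -
        x\<^sup>2))) + - f x) (at x)"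
      if "s \<le> x" "x \<le> t" for x c
      unfolding f_def using that st by (intro DERIV_add DERIV_cmult dw' DERIV_arcsin) auto
    have "1 * (C * arcsin s) + w' s \<le> 1 * (C * arcsin t) + w' t"
    proof (rule DERIV_nonneg_imp_nondecreasing[OF st(3), of "\<lambda>x. 1 * (C * arcsin x) + w' x"])
      fix x assume x: "s \<le> x" "x \<le> t"
      then have "x \<in> {-1<..<1}" using st by auto
      from fb[OF this] show "\<exists>y. ((\<lambda>x. 1 * (C * arcsin x) + w' x) has_real_derivative y) (at x) \<and>
          0 \<le> y"
        by (intro exI[of _ "1 * (C * inverse (sqrt (1 - x\<^sup>2))) + - f x"] conjI da x) auto
    qed
    moreover have "- (-1 * (C * arcsin s) + w' s) \<le> - (-1 * (C * arcsin t) + w' t)"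
    proof (rule DERIV_nonneg_imp_nondecreasing[OF st(3), of "\<lambda>x. - (-1 * (C * arcsin x) + w' x)"])
      fix x assume x: "s \<le> x" "x \<le> t"
      then have "x \<in> {-1<..<1}" using st by auto
      from fb[OF this] show "\<exists>y. ((\<lambda>x. - (-1 * (C * arcsin x) + w' x)) has_real_derivative y) (at
          x) \<and> 0 \<le> y"
        by (intro exI[of _ "- (-1 * (C * inverse (sqrt (1 - x\<^sup>2))) + - f x)"] conjI DERIV_minus da
            x) auto
    qed
    ultimately show ?thesis by (simp add: algebra_simps abs_le_iff)
  qed
  have C0: "C \<ge> 0" using en0 by (simp add: C_def)
  have "uniformly_continuous_on {-1..1} arcsin"
    by (intro compact_uniformly_continuous continuous_on_arcsin') auto
  have "uniformly_continuous_on {-1<..<1} w'"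
    unfolding uniformly_continuous_on_def
  proof (intro allI impI)
    fix e :: real assume e: "e > 0"
    obtain d where d: "d > 0" "\<And>x y. x \<in> {-1..1} \<Longrightarrow> y \<in> {-1..1} \<Longrightarrow> dist y x < d \<Longrightarrow>
        dist (arcsin y) (arcsin x) < e / (C + 1)"
      using \<open>uniformly_continuous_on {-1..1} arcsin\<close> e C0 unfolding uniformly_continuous_on_def
      by (metis add_nonneg_pos divide_pos_pos zero_less_one)
    have "dist (w' y) (w' x) < e" if "x \<in> {-1<..<1}" "y \<in> {-1<..<1}" "dist y x < d" for x y
    proof -
      have *: "\<bar>arcsin y - arcsin x\<bar> < e / (C + 1)" using d(2)[of x y] that
          by (auto simp: dist_real_def)
      have "\<bar>w' y - w' x\<bar> \<le> C * \<bar>arcsin y - arcsin x\<bar>"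
      proof (cases "x \<le> y")
        case True
        show ?thesis by (rule order_trans[OF inc[OF that(1,2) True] mult_left_mono[OF abs_ge_self
            C0]])
      next
        case False
        then have "y \<le> x" by simp
        from order_trans[OF inc[OF that(2,1) this] mult_left_mono[OF abs_ge_self C0]]
        show ?thesis by (simp only: abs_minus_commute)
      qed
      also have "\<dots> \<le> (C + 1) * \<bar>arcsin y - arcsin x\<bar>" by (intro mult_right_mono) auto
      also have "\<dots> < e" using * C0 by (simp add: field_simps)
      finally show ?thesis by (simp add: dist_real_def)
    qed
    then show "\<exists>d>0. \<forall>x\<in>{-1<..<1}. \<forall>y\<in>{-1<..<1}. dist y x < d \<longrightarrow> dist (w' y) (w' x) < e" using d(1)
        by blast
  qed
  then obtain g where g: "uniformly_continuous_on (closure {-1<..<1}) g" "\<And>x. x \<in> {-1<..<1} \<Longrightarrow>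
      w' x = g x"
    by (rule uniformly_continuous_on_extension_on_closure) (rule that)
  have "continuous_on {-1..1} g" using uniformly_continuous_imp_continuous[OF g(1)] by simp
  then obtain G where "continuous_on UNIV G" "\<And>t. t \<in> {-1..1} \<Longrightarrow> G t = g t"
    using continuous_extension_Icc by blast
  then show ?thesis using that[of G] g(2) by simp
qed

end

text \<open>\<open>W\<close> extends w', \<open>h\<close> extends w / (1 - t^2) and
  \<open>h1\<close> extends h'. The expression (1 - t^2) W + 2 t w is (1 - t^2)^2 h'; in its
  derivative the W terms cancel and a factor 1 - t^2 comes out, which is what makes
  \<open>h1\<close> continuous up to the poles.\<close>

locale regular_profile = ode_profile +
  fixes W h h1 :: "real \<Rightarrow> real"
  assumes cont: "continuous_on UNIV W" "continuous_on UNIV h" "continuous_on UNIV h1"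
    and W: "\<And>t. t \<in> {-1<..<1} \<Longrightarrow> w' t = W t"
    and h: "\<And>t. t \<in> {-1..1} \<Longrightarrow> w t = (1 - t\<^sup>2) * h t"
    and h1: "\<And>t. t \<in> {-1..1} \<Longrightarrow> (1 - t\<^sup>2) * W t + 2 * t * w t = (1 - t\<^sup>2)\<^sup>2 * h1 t"
    and dh: "\<And>t. t \<in> {-1<..<1} \<Longrightarrow> (h has_real_derivative h1 t) (at t)"
    and dW: "\<And>t. t \<in> {-1<..<1} \<Longrightarrow> (W has_real_derivative - (\<kappa> * h t + \<mu> * spow q (w t))) (at t)"
    and dN: "\<And>t. t \<in> {-1<..<1} \<Longrightarrow> ((\<lambda>t. (1 - t\<^sup>2) * W t + 2 * t * w t) has_real_derivative
        (1 - t\<^sup>2) * ((2 - \<kappa>) * h t - \<mu> * spow q (w t))) (at t)"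

context ode_profile
begin

lemma regular: "\<exists>W h h1. regular_profile q \<sigma> \<kappa> \<mu> w w' W h h1"
proof -
  obtain W where W: "continuous_on UNIV W" "\<And>t. t \<in> {-1<..<1} \<Longrightarrow> W t = w' t"
    using w'_extends by blast
  have dwW: "(w has_real_derivative W t) (at t)" if "t \<in> {-1<..<1}" for t
    using dw[OF that] W(2)[OF that] by simp
  obtain h where h: "continuous_on UNIV h" "\<And>t. t \<in> {-1..1} \<Longrightarrow> w t = (1 - t\<^sup>2) * h t"
    by (rule quotient_extends[OF w_cont w1 W(1), where j=0]) (use dwW in simp_all)
  have dW: "(W has_real_derivative - (\<kappa> * h t + \<mu> * spow q (w t))) (at t)" if t: "t \<in> {-1<..<1}"
      for t
  proof -
    have "\<kappa> * w t / (1 - t\<^sup>2) = \<kappa> * h t" using h(2)[of t] one_minus_sq[OF t] t by simp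
    then have "(w' has_real_derivative - (\<kappa> * h t + \<mu> * spow q (w t))) (at t)" using dw'[OF t]
        by simp
    then show ?thesis
      by (rule has_field_derivative_transform_within_open[OF _ open_greaterThanLessThan t]) (use
          W(2) in simp)
  qed
  obtain wE where wE: "continuous_on UNIV wE" "\<And>t. t \<in> {-1..1} \<Longrightarrow> wE t = w t"
    using continuous_extension_Icc[OF w_cont] by blast
  define N where "N = (\<lambda>t. (1 - t\<^sup>2) * W t + 2 * t * w t)"
  have dN: "(N has_real_derivative (1 - t\<^sup>2) * ((2 - \<kappa>) * h t - \<mu> * spow q (w t))) (at t)"
      if t: "t \<in> {-1<..<1}" for t
  proof -
    have "(N has_real_derivative (- (2 * t)) * W t + - (\<kappa> * h t + \<mu> * spow q (w t)) * (1 - t\<^sup>2) +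
        (2 * w t + W t * (2 * t))) (at t)"
      unfolding N_def by (intro DERIV_add DERIV_mult dW dwW t) (auto intro!: derivative_eq_intros)
    moreover have "(- (2 * t)) * W t + - (\<kappa> * h t + \<mu> * spow q (w t)) * (1 - t\<^sup>2) + (2 * w t + W t
        * (2 * t)) =
       (1 - t\<^sup>2) * ((2 - \<kappa>) * h t - \<mu> * spow q (w t))"
      using h(2)[of t] t by (simp add: algebra_simps)
    ultimately show ?thesis by simp
  qed
  have Nc: "continuous_on {-1..1} N" unfolding N_def
    by (intro continuous_intros w_cont continuous_on_subset[OF W(1)]) auto
  obtain h1 where h1: "continuous_on UNIV h1" "\<And>t. t \<in> {-1..1} \<Longrightarrow> N t = (1 - t\<^sup>2)\<^sup>2 * h1 t"
  proof (rule quotient_extends[OF Nc, where j=1 and Z="\<lambda>t. (2 - \<kappa>) * h t - \<mu> * spow q (wE t)"])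
    show "N 1 = 0" "N (-1) = 0" by (simp_all add: N_def w1)
    show "continuous_on UNIV (\<lambda>t. (2 - \<kappa>) * h t - \<mu> * spow q (wE t))"
      by (intro continuous_intros h(1) continuous_on_spow q wE(1))
    show "(N has_real_derivative (1 - t\<^sup>2) ^ 1 * ((2 - \<kappa>) * h t - \<mu> * spow q (wE t))) (at t)"
      if "t \<in> {-1<..<1}" for t using dN[OF that] wE(2)[of t] that by simp
  qed (use that in \<open>simp add: numeral_2_eq_2\<close>)
  have dh: "(h has_real_derivative h1 t) (at t)" if t: "t \<in> {-1<..<1}" for t
  proof -
    have p: "1 - t\<^sup>2 > 0" by (rule one_minus_sq[OF t])
    have "((\<lambda>t. w t / (1 - t\<^sup>2)) has_real_derivative (W t * (1 - t\<^sup>2) - w t * (- (2 * t))) / ((1 -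
        t\<^sup>2) * (1 - t\<^sup>2))) (at t)"
      by (rule DERIV_divide[OF dwW[OF t]]) (use p in \<open>auto intro!: derivative_eq_intros\<close>)
    moreover have "(W t * (1 - t\<^sup>2) - w t * (- (2 * t))) / ((1 - t\<^sup>2) * (1 - t\<^sup>2)) =
        N t / (1 - t\<^sup>2)\<^sup>2"
      by (simp add: N_def algebra_simps power2_eq_square)
    moreover have "\<dots> = h1 t" using h1(2)[of t] t p by simp
    ultimately have "((\<lambda>t. w t / (1 - t\<^sup>2)) has_real_derivative h1 t) (at t)" by simp
    then show ?thesis
      by (rule has_field_derivative_transform_within_open[OF _ open_greaterThanLessThan t])
        (use h(2) one_minus_sq in force)
  qed
  have "regular_profile q \<sigma> \<kappa> \<mu> w w' W h h1"
    by unfold_locales (rule W(1) h(1) h1(1) W(2)[symmetric] h(2) h1(2)[unfolded N_def] dh dW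
        dN[unfolded N_def], assumption?)+
  then show ?thesis by blast
qed

end

text \<open>\<open>\<Phi> j\<close> is the \<open>j\<close>-th derivative of the \<open>C\<^sup>k\<close> function \<open>\<Phi> 0\<close>.\<close>

definition Ck_seq :: "nat \<Rightarrow> (nat \<Rightarrow> real \<Rightarrow> real) \<Rightarrow> bool" where
  "Ck_seq k \<Phi> \<longleftrightarrow> (\<forall>j<k. \<forall>y. (\<Phi> j has_real_derivative \<Phi> (Suc j) y) (at y)) \<and> continuous_on UNIV (\<Phi> k)"

lemma Ck_seq_1_extension:
  assumes "continuous_on {-1..1} f" "continuous_on UNIV f1"
    and "\<And>t. t \<in> {-1<..<1} \<Longrightarrow> (f has_real_derivative f1 t) (at t)"
  obtains \<Phi> where "Ck_seq 1 \<Phi>" "\<And>t. t \<in> {-1..1} \<Longrightarrow> \<Phi> 0 t = f t" "\<And>t. t \<in> {-1..1} \<Longrightarrow> \<Phi> 1 t = f1 t"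
proof -
  obtain F where F: "\<And>t. (F has_real_derivative f1 t) (at t)" "\<And>t. t \<in> {-1..1} \<Longrightarrow> F t = f t"
    using derivative_extension_Icc[OF assms] by blast
  show ?thesis
    by (rule that[of "\<lambda>j. if j = 0 then F else f1"]) (use F assms in \<open>auto simp: Ck_seq_def\<close>)
qed

lemma Ck_seq_2_extension:
  assumes f: "continuous_on {-1..1} f" and f1: "continuous_on UNIV f1"
      and f2: "continuous_on UNIV f2"
    and d: "\<And>t. t \<in> {-1<..<1} \<Longrightarrow> (f has_real_derivative f1 t) (at t)"
    and d1: "\<And>t. t \<in> {-1<..<1} \<Longrightarrow> (f1 has_real_derivative f2 t) (at t)"
  obtains \<Phi> where "Ck_seq 2 \<Phi>" "\<And>t. t \<in> {-1..1} \<Longrightarrow> \<Phi> 0 t = f t" "\<And>t. t \<in> {-1..1} \<Longrightarrow> \<Phi> 1 t = f1 t"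
proof -
  obtain F1 where F1: "\<And>t. (F1 has_real_derivative f2 t) (at t)" "\<And>t. t \<in> {-1..1} \<Longrightarrow> F1 t = f1 t"
    using derivative_extension_Icc[OF continuous_on_subset[OF f1 subset_UNIV] f2 d1] by blast
  have F1c: "continuous_on UNIV F1"
    by (intro continuous_at_imp_continuous_on ballI) (rule DERIV_isCont[OF F1(1)])
  have "(f has_real_derivative F1 t) (at t)" if "t \<in> {-1<..<1}" for t
    using d[OF that] F1(2)[of t] that by simp
  from derivative_extension_Icc[OF f F1c this]
  obtain F where F: "\<And>t. (F has_real_derivative F1 t) (at t)" "\<And>t. t \<in> {-1..1} \<Longrightarrow> F t = f t"
    by blast
  show ?thesis
    by (rule that[of "\<lambda>j. if j = 0 then F else if j = 1 then F1 else f2"])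
      (use F F1 f2 in \<open>auto simp: Ck_seq_def less_2_cases_iff\<close>)
qed

lemma zero_on_Icc:
  fixes f :: "real \<Rightarrow> real"
  assumes "continuous_on UNIV f" "\<And>t. t \<in> {-1<..<1} \<Longrightarrow> f t = 0" "t \<in> {-1..1}"
  shows "f t = 0"
proof -
  have "closed {t. f t = 0}" by (intro closed_Collect_eq assms continuous_intros)
  moreover have "{-1<..<1} \<subseteq> {t. f t = 0}" using assms(2) by auto
  ultimately have "closure {-1<..<1} \<subseteq> {t. f t = 0}" by (intro closure_minimal)
  then show ?thesis using assms(3) by auto
qed

text \<open>With \<open>\<rho> = \<bar>x\<bar>\<close> and \<open>t = x\<^sub>3 / \<rho>\<close>, the three identities are the divergence, the \<open>e\<^sub>z\<close> and the
  \<open>x\<close> component of the Euler equations for \<open>u = \<rho>\<^bsup>-\<alpha>\<^esup> (A(t) x / \<rho> + B(t) e\<^sub>z)\<close>,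
  \<open>p = \<rho>\<^bsup>-2\<alpha>\<^esup> P(t)\<close>; the last expression is proportional to the vorticity.\<close>

definition profile :: "nat \<Rightarrow> real \<Rightarrow> (nat \<Rightarrow> real \<Rightarrow> real) \<Rightarrow> (nat \<Rightarrow> real \<Rightarrow> real) \<Rightarrow> (nat \<Rightarrow> real \<Rightarrow>
    real) \<Rightarrow> bool" where
  "profile k \<alpha> A B P \<longleftrightarrow> Ck_seq k A \<and> Ck_seq k B \<and> Ck_seq k P \<and>
     (\<forall>t\<in>{-1..1}. (1 - t\<^sup>2) * B 1 t = \<alpha> * t * B 0 t - (2 - \<alpha>) * A 0 t \<and>
        P 1 t = A 0 t * B 0 t \<and>
        2 * \<alpha> * P 0 t = (1 - t\<^sup>2) * B 0 t * A 1 t - \<alpha> * (A 0 t)\<^sup>2 - (\<alpha> + 2) * t * A 0 t * B 0 t) \<and>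
     (\<exists>t\<in>{-1<..<1}. A 1 t + \<alpha> * B 0 t + t * B 1 t \<noteq> 0)"

context regular_profile
begin

text \<open>The velocity is read off from the stream function and the pressure from the Bernoulli
  function; the vorticity expression of the profile becomes \<open>\<mu> * spow q w\<close>, which
  is nonzero somewhere. For \<open>k = 2\<close> this expression has to be differentiated once,
  hence \<open>q > 1\<close>.\<close>

lemma profile_if_multiplier_nonzero:
  assumes \<alpha>: "\<alpha> \<noteq> 0" "\<alpha> \<noteq> 2" and \<kappa>: "\<kappa> = (\<alpha> - 2) * (\<alpha> - 1)" and q': "q = (\<alpha> + 2) / (\<alpha> - 2)"
    and k: "k = 1 \<or> k = 2 \<and> q > 1" and nz: "\<mu> \<noteq> 0" "power_integral q w \<noteq> 0"
  shows "\<exists>A B P. profile k \<alpha> A B P"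
proof -
  obtain v where v: "continuous_on UNIV v" "\<And>t. t \<in> {-1..1} \<Longrightarrow> v t = w t"
    using continuous_extension_Icc[OF w_cont] by blast
  have dv: "(v has_real_derivative W t) (at t)" if t: "t \<in> {-1<..<1}" for t
  proof (rule has_field_derivative_transform_within_open[OF _ open_greaterThanLessThan t])
    show "(w has_real_derivative W t) (at t)" using dw[OF t] W[OF t] by simp
  qed (use v in auto)
  define S where "S = (\<lambda>t. spow q (v t))"
  have Sc: "continuous_on UNIV S" unfolding S_def by (intro continuous_on_spow q v)
  have Sw: "S t = spow q (w t)" if "t \<in> {-1..1}" for t using v(2)[OF that] by (simp add: S_def)
  have id1: "(1 - t\<^sup>2) * h1 t - (W t + 2 * t * h t) = 0" if "t \<in> {-1..1}" for t
  proof (rule zero_on_Icc[OF _ _ that])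
    show "continuous_on UNIV (\<lambda>t. (1 - t\<^sup>2) * h1 t - (W t + 2 * t * h t))"
      by (intro continuous_intros cont)
    show "(1 - t\<^sup>2) * h1 t - (W t + 2 * t * h t) = 0" if t: "t \<in> {-1<..<1}" for t
    proof -
      have "(1 - t\<^sup>2) * ((1 - t\<^sup>2) * h1 t - (W t + 2 * t * h t)) = 0"
        using h1[of t] h[of t] t by (simp add: power2_eq_square algebra_simps)
      then show ?thesis using one_minus_sq[OF t] by simp
    qed
  qed
  \<comment> \<open>\<open>B0\<close> is (2 - \<alpha>) w / (1 - t^2); \<open>A0\<close> is then
    dictated by the divergence identity.\<close>
  define B0 where "B0 = (\<lambda>t. (2 - \<alpha>) * h t)"
  define B1 where "B1 = (\<lambda>t. (2 - \<alpha>) * h1 t)"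
  define A0 where "A0 = (\<lambda>t. - W t - t * B0 t)"
  define A1 where "A1 = (\<lambda>t. \<alpha> * (\<alpha> - 2) * h t + \<mu> * S t + (\<alpha> - 2) * (t * h1 t))"
  \<comment> \<open>Bernoulli function minus |u|^2 / 2 on the unit sphere. The coefficient comes
    from 2 \<alpha> H = (stream function) * (vorticity), here (2 - \<alpha>) w times
    \<open>\<mu> * spow q w\<close>.\<close>
  define P0 where "P0 = (\<lambda>t. (2 - \<alpha>) * \<mu> / (2 * \<alpha>) * \<bar>v t\<bar> powr (q + 1) - ((A0 t)\<^sup>2 + 2 * t * A0 t
      * B0 t + (B0 t)\<^sup>2) / 2)"
  define P1 where "P1 = (\<lambda>t. A0 t * B0 t)"
  have cB: "continuous_on UNIV B0" "continuous_on UNIV B1" unfolding B0_def B1_def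
      by (intro continuous_intros cont)+
  have cA: "continuous_on UNIV A0" "continuous_on UNIV A1" unfolding A0_def A1_def
      by (intro continuous_intros cont cB Sc)+
  have cP1: "continuous_on UNIV P1" unfolding P1_def by (intro continuous_intros cA cB)
  have cP0: "continuous_on UNIV P0" unfolding P0_def
    by (intro continuous_on_diff continuous_on_mult continuous_on_powr' continuous_intros cA cB v)
        (use q in auto)
  have grid_form: "(B0 has_real_derivative B1 t) (at t)" if "t \<in> {-1<..<1}" for t
    unfolding B0_def B1_def by (intro DERIV_cmult dh that)
  have dA: "(A0 has_real_derivative A1 t) (at t)" if t: "t \<in> {-1<..<1}" for t
  proof -
    have "(A0 has_real_derivative - (- (\<kappa> * h t + \<mu> * spow q (w t))) - (1 * B0 t + B1 t * t)) (at
        t)"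
      unfolding A0_def by (intro DERIV_diff DERIV_minus DERIV_mult DERIV_ident dW grid_form t)
    moreover have "- (- (\<kappa> * h t + \<mu> * spow q (w t))) - (1 * B0 t + B1 t * t) = A1 t"
      unfolding A1_def B0_def B1_def \<kappa> using Sw[of t] t by (simp add: algebra_simps)
    ultimately show ?thesis by simp
  qed
  have id2: "(1 - t\<^sup>2) * B1 t = \<alpha> * t * B0 t - (2 - \<alpha>) * A0 t" if "t \<in> {-1..1}" for t
    using id1[OF that] unfolding A0_def B1_def B0_def by algebra
  have G: "A1 t + \<alpha> * B0 t + t * B1 t = \<mu> * S t" for t
    unfolding A1_def B1_def B0_def by (simp add: algebra_simps)
  \<comment> \<open>This value of \<open>q + 1\<close> makes the derivative of the Bernoulli term
    exactly \<open>- \<mu> * S t * W t\<close>; here the choice of \<open>q\<close> enters.\<close>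
  have q1: "q + 1 = 2 * \<alpha> / (\<alpha> - 2)" unfolding q' using \<alpha> by (simp add: field_simps)
  have dP: "(P0 has_real_derivative P1 t) (at t)" if t: "t \<in> {-1<..<1}" for t
  proof -
    have "((\<lambda>t. \<bar>v t\<bar> powr (q + 1)) has_real_derivative (q + 1) * S t * W t) (at t)"
      using DERIV_chain2[OF abs_powr_has_derivative[OF q] dv[OF t]] by (simp add: S_def)
    then have 1: "((\<lambda>t. (2 - \<alpha>) * \<mu> / (2 * \<alpha>) * \<bar>v t\<bar> powr (q + 1)) has_real_derivative
        (2 - \<alpha>) * \<mu> / (2 * \<alpha>) * ((q + 1) * S t * W t)) (at t)"
      by (rule DERIV_cmult)
    have 2: "((\<lambda>t. ((A0 t)\<^sup>2 + 2 * t * A0 t * B0 t + (B0 t)\<^sup>2) / 2) has_real_derivative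
       A0 t * A1 t + (A0 t * B0 t + t * A1 t * B0 t + t * A0 t * B1 t) + B0 t * B1 t) (at t)"
      by (rule derivative_eq_intros dA grid_form t refl | simp add: algebra_simps)+
    have "(2 - \<alpha>) * \<mu> / (2 * \<alpha>) * ((q + 1) * S t * W t) = - (\<mu> * S t) * W t"
      unfolding q1 using \<alpha> by (simp add: field_simps)
    also have "\<dots> = (A1 t + \<alpha> * B0 t + t * B1 t) * (A0 t + t * B0 t)"
      unfolding G A0_def by (simp add: algebra_simps)
    finally have 3: "(2 - \<alpha>) * \<mu> / (2 * \<alpha>) * ((q + 1) * S t * W t) =
        (A1 t + \<alpha> * B0 t + t * B1 t) * (A0 t + t * B0 t)" .
    have t': "t \<in> {-1..1}" using t by auto
    have "(A1 t + \<alpha> * B0 t + t * B1 t) * (A0 t + t * B0 t) -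
       (A0 t * A1 t + (A0 t * B0 t + t * A1 t * B0 t + t * A0 t * B1 t) + B0 t * B1 t) = P1 t"
      using id2[OF t'] unfolding P1_def by algebra
    then show ?thesis using DERIV_diff[OF 1 2] unfolding 3 P0_def by simp
  qed
  have id3: "2 * \<alpha> * P0 t = (1 - t\<^sup>2) * B0 t * A1 t - \<alpha> * (A0 t)\<^sup>2 - (\<alpha> + 2) * t * A0 t * B0 t"
    if t: "t \<in> {-1..1}" for t
  proof -
    have "\<bar>v t\<bar> powr (q + 1) = \<bar>v t\<bar> powr q * \<bar>v t\<bar>" by (simp only: powr_add powr_one abs_ge_zero)
    then have 1: "\<bar>v t\<bar> powr (q + 1) = v t * S t" by (simp add: S_def spow_def sgn_if)
    have "2 * \<alpha> * P0 t = (2 - \<alpha>) * \<mu> * (v t * S t) - \<alpha> * ((A0 t)\<^sup>2 + 2 * t * A0 t * B0 t + (B0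
        t)\<^sup>2)"
      unfolding P0_def 1 using \<alpha>(1) by (simp add: field_simps)
    also have "(2 - \<alpha>) * \<mu> * (v t * S t) = (1 - t\<^sup>2) * B0 t * (\<mu> * S t)"
      using v(2)[OF t] h[OF t] by (simp add: B0_def)
    also have "\<mu> * S t = A1 t + \<alpha> * B0 t + t * B1 t" using G by simp
    finally show ?thesis using id2[OF t] by algebra
  qed
  have ex: "\<exists>t\<in>{-1<..<1}. A1 t + \<alpha> * B0 t + t * B1 t \<noteq> 0"
  proof (rule ccontr)
    assume "\<not> (\<exists>t\<in>{-1<..<1}. A1 t + \<alpha> * B0 t + t * B1 t \<noteq> 0)"
    then have S0: "\<mu> * S t = 0" if "t \<in> {-1<..<1}" for t unfolding G[symmetric] using that by blast
    have "w t = 0" if "t \<in> {-1<..<1}" for t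
    proof -
      have "spow q (w t) = 0" using S0[OF that] Sw[of t] nz(1) that by simp
      then show ?thesis by (auto simp: spow_def sgn_zero_iff)
    qed
    then have "w t = 0" if "t \<in> {-1..1}" for t using w1 that by (cases "t = 1 \<or> t = -1") auto
    then have "power_integral q w = integral {-1..1} (\<lambda>t::real. 0)"
      unfolding power_integral_def by (intro Henstock_Kurzweil_Integration.integral_cong) simp
    then show False using nz(2) by simp
  qed
  have fin: "\<exists>A B P. profile k \<alpha> A B P"
    if "Ck_seq k A" "\<And>t. t \<in> {-1..1} \<Longrightarrow> A 0 t = A0 t" "\<And>t. t \<in> {-1..1} \<Longrightarrow> A 1 t = A1 t"
     "Ck_seq k B" "\<And>t. t \<in> {-1..1} \<Longrightarrow> B 0 t = B0 t" "\<And>t. t \<in> {-1..1} \<Longrightarrow> B 1 t = B1 t"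
     "Ck_seq k P" "\<And>t. t \<in> {-1..1} \<Longrightarrow> P 0 t = P0 t" "\<And>t. t \<in> {-1..1} \<Longrightarrow> P 1 t = P1 t" for A B P
  proof -
    have "\<exists>t\<in>{-1<..<1}. A 1 t + \<alpha> * B 0 t + t * B 1 t \<noteq> 0"
    proof -
      obtain t where t: "t \<in> {-1<..<1}" "A1 t + \<alpha> * B0 t + t * B1 t \<noteq> 0" using ex by blast
      then have "t \<in> {-1..1}" by auto
      with t that show ?thesis by (intro bexI[of _ t]) simp_all
    qed
    then have "profile k \<alpha> A B P" unfolding profile_def using that id2 id3 by (simp add: P1_def)
    then show ?thesis by blast
  qed
  have sub: "continuous_on {-1..1} f" if "continuous_on UNIV f" for f :: "real \<Rightarrow> real"
    using that continuous_on_subset by blast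
  show ?thesis
  proof (cases "k = 1")
    case True
    obtain A where A: "Ck_seq 1 A" "\<And>t. t \<in> {-1..1} \<Longrightarrow> A 0 t = A0 t" "\<And>t. t \<in> {-1..1} \<Longrightarrow> A 1 t = A1 t"
      using Ck_seq_1_extension[OF sub[OF cA(1)] cA(2) dA] by blast
    obtain B where B: "Ck_seq 1 B" "\<And>t. t \<in> {-1..1} \<Longrightarrow> B 0 t = B0 t" "\<And>t. t \<in> {-1..1} \<Longrightarrow> B 1 t = B1 t"
      using Ck_seq_1_extension[OF sub[OF cB(1)] cB(2) grid_form] by blast
    obtain P where P: "Ck_seq 1 P" "\<And>t. t \<in> {-1..1} \<Longrightarrow> P 0 t = P0 t" "\<And>t. t \<in> {-1..1} \<Longrightarrow> P 1 t = P1 t"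
      using Ck_seq_1_extension[OF sub[OF cP0] cP1 dP] by blast
    show ?thesis by (rule fin[of A B P]) (use A B P True in simp_all)
  next
    case False
    then have k2: "k = 2" "q > 1" using k by auto
    define R where "R = (\<lambda>t. (2 - \<kappa>) * h t - \<mu> * S t)"
    define S1 where "S1 = (\<lambda>t. q * \<bar>v t\<bar> powr (q - 1) * W t)"
    define R1 where "R1 = (\<lambda>t. (2 - \<kappa>) * h1 t - \<mu> * S1 t)"
    have S1c: "continuous_on UNIV S1" unfolding S1_def
      by (intro continuous_on_mult continuous_on_powr' continuous_intros cont v) (use k2 in auto)
    have R1c: "continuous_on UNIV R1" unfolding R1_def by (intro continuous_intros cont S1c)
    have dS: "(S has_real_derivative S1 t) (at t)" if "t \<in> {-1<..<1}" for t
      unfolding S_def S1_def using DERIV_chain2[OF spow_has_derivative[OF k2(2)] dv[OF that]] .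
    have dR: "(R has_real_derivative R1 t) (at t)" if "t \<in> {-1<..<1}" for t
      unfolding R_def R1_def by (intro DERIV_diff DERIV_cmult dh dS that)
    define N where "N = (\<lambda>t. (1 - t\<^sup>2) * W t + 2 * t * w t)"
    have dN': "(N has_real_derivative (1 - t\<^sup>2) * R t) (at t)" if "t \<in> {-1<..<1}" for t
      using dN[OF that] Sw[of t] that unfolding N_def R_def by simp
    \<comment> \<open>Differentiating N / (1 - t^2)^2 gives M / (1 - t^2)^3. In M' the terms with
      \<open>R\<close> cancel, leaving the factor (1 - t^2)^2 that \<open>quotient_extends\<close>
      asks for.\<close>
    define M where "M = (\<lambda>t. 4 * t * N t + (1 - t\<^sup>2)\<^sup>2 * R t)"
    have sq: "((\<lambda>t. (1 - t\<^sup>2)\<^sup>2) has_real_derivative - (4 * t * (1 - t\<^sup>2))) (at t)" for t :: real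
      by (auto intro!: derivative_eq_intros)
    have dM: "(M has_real_derivative (1 - t\<^sup>2) ^ 2 * (4 * h1 t + R1 t)) (at t)"
        if t: "t \<in> {-1<..<1}" for t
    proof -
      have "(M has_real_derivative (4 * N t + (1 - t\<^sup>2) * R t * (4 * t)) + (- (4 * t * (1 - t\<^sup>2))
          * R t + R1 t * (1 - t\<^sup>2)\<^sup>2)) (at t)"
        unfolding M_def by (intro DERIV_add DERIV_mult dN' dR t sq) (auto intro!:
            derivative_eq_intros)
      moreover have "(4 * N t + (1 - t\<^sup>2) * R t * (4 * t)) + (- (4 * t * (1 - t\<^sup>2)) * R t + R1 t *
          (1 - t\<^sup>2)\<^sup>2) =
          (1 - t\<^sup>2) ^ 2 * (4 * h1 t + R1 t)"
        using h1[of t] t unfolding N_def by (simp add: algebra_simps)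
      ultimately show ?thesis by simp
    qed
    have cM: "continuous_on {-1..1} M" unfolding M_def N_def R_def
      by (intro continuous_intros w_cont sub cont Sc)
    obtain h2 where h2: "continuous_on UNIV h2" "\<And>t. t \<in> {-1..1} \<Longrightarrow> M t = (1 - t\<^sup>2) ^ Suc 2 * h2 t"
      by (rule quotient_extends[OF cM _ _ _ dM]) (use R1c cont in \<open>auto intro!: continuous_intros
          simp: M_def N_def w1\<close>)
    have dh1: "(h1 has_real_derivative h2 t) (at t)" if t: "t \<in> {-1<..<1}" for t
    proof -
      have p: "1 - t\<^sup>2 > 0" by (rule one_minus_sq[OF t])
      define s where "s = 1 - t\<^sup>2"
      have "((\<lambda>t. N t / (1 - t\<^sup>2)\<^sup>2) has_real_derivative
          (s * R t * s\<^sup>2 - N t * (- (4 * t * s))) / (s\<^sup>2 * s\<^sup>2)) (at t)"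
        unfolding s_def by (rule DERIV_divide[OF dN'[OF t] sq]) (use p in simp)
      moreover have "(s * R t * s\<^sup>2 - N t * (- (4 * t * s))) / (s\<^sup>2 * s\<^sup>2) = h2 t"
      proof -
        have s: "s \<noteq> 0" using p by (simp add: s_def)
        have *: "4 * t * N t + s\<^sup>2 * R t = s ^ Suc 2 * h2 t" using h2(2)[of t] t
            by (simp add: M_def s_def)
        have "s * R t * s\<^sup>2 - N t * (- (4 * t * s)) = s * (4 * t * N t + s\<^sup>2 * R t)"
          by (simp add: algebra_simps)
        also have "\<dots> = (s\<^sup>2 * s\<^sup>2) * h2 t" unfolding *
            by (simp add: power2_eq_square power3_eq_cube)
        finally show ?thesis using s by simp
      qed
      ultimately have "((\<lambda>t. N t / (1 - t\<^sup>2)\<^sup>2) has_real_derivative h2 t) (at t)" by simp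
      then show ?thesis
      proof (rule has_field_derivative_transform_within_open[OF _ open_greaterThanLessThan t])
        fix x :: real assume x: "x \<in> {-1<..<1}"
        then have "x \<in> {-1..1}" by auto
        from h1[OF this] show "N x / (1 - x\<^sup>2)\<^sup>2 = h1 x" using one_minus_sq[OF x]
            by (simp add: N_def)
      qed
    qed
    define B2 where "B2 = (\<lambda>t. (2 - \<alpha>) * h2 t)"
    define A2 where "A2 = (\<lambda>t. \<alpha> * (\<alpha> - 2) * h1 t + \<mu> * S1 t + (\<alpha> - 2) * (1 * h1 t + h2 t * t))"
    define P2 where "P2 = (\<lambda>t. A1 t * B0 t + B1 t * A0 t)"
    have c2: "continuous_on UNIV A2" "continuous_on UNIV B2" "continuous_on UNIV P2"
      unfolding A2_def B2_def P2_def by (intro continuous_intros cont S1c h2 cA cB)+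
    have dA2: "(A1 has_real_derivative A2 t) (at t)" if "t \<in> {-1<..<1}" for t
      unfolding A1_def A2_def by (intro DERIV_add DERIV_cmult DERIV_mult DERIV_ident dh dh1 dS that)
    have dB2: "(B1 has_real_derivative B2 t) (at t)" if "t \<in> {-1<..<1}" for t
      unfolding B1_def B2_def by (intro DERIV_cmult dh1 that)
    have dP2: "(P1 has_real_derivative P2 t) (at t)" if "t \<in> {-1<..<1}" for t
      unfolding P1_def P2_def by (intro DERIV_mult dA grid_form that)
    obtain A where A: "Ck_seq 2 A" "\<And>t. t \<in> {-1..1} \<Longrightarrow> A 0 t = A0 t" "\<And>t. t \<in> {-1..1} \<Longrightarrow> A 1 t = A1 t"
      using Ck_seq_2_extension[OF sub[OF cA(1)] cA(2) c2(1) dA dA2] by blast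
    obtain B where B: "Ck_seq 2 B" "\<And>t. t \<in> {-1..1} \<Longrightarrow> B 0 t = B0 t" "\<And>t. t \<in> {-1..1} \<Longrightarrow> B 1 t = B1 t"
      using Ck_seq_2_extension[OF sub[OF cB(1)] cB(2) c2(2) grid_form dB2] by blast
    obtain P where P: "Ck_seq 2 P" "\<And>t. t \<in> {-1..1} \<Longrightarrow> P 0 t = P0 t" "\<And>t. t \<in> {-1..1} \<Longrightarrow> P 1 t = P1 t"
      using Ck_seq_2_extension[OF sub[OF cP0] cP1 c2(3) dP dP2] by blast
    show ?thesis by (rule fin[of A B P]) (use A B P k2 in simp_all)
  qed
qed

text \<open>If \<open>\<mu> = 0\<close>, then \<open>h N\<close> with \<open>N = (1 - t\<^sup>2)\<^sup>2 h'\<close> is nondecreasing and vanishes at both ends.\<close>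

lemma multiplier_nonzero_odd:
  assumes \<kappa>: "\<kappa> \<le> 2" and odd: "\<sigma> = -1" and nz: "power_integral q w \<noteq> 0"
  shows "\<mu> \<noteq> 0"
proof
  assume \<mu>: "\<mu> = 0"
  define N where "N = (\<lambda>t. (1 - t\<^sup>2) * W t + 2 * t * w t)"
  define E where "E = (\<lambda>t. h t * N t)"
  have Ec: "continuous_on {-1..1} E" unfolding E_def N_def
    by (intro continuous_intros w_cont continuous_on_subset[OF cont(1)] continuous_on_subset[OF
        cont(2)]) auto
  have E1: "E 1 = 0" "E (-1) = 0" by (simp_all add: E_def N_def w1)
  have grid_energy: "(E has_real_derivative (1 - t\<^sup>2)\<^sup>2 * (h1 t)\<^sup>2 + (2 - \<kappa>) * (1 - t\<^sup>2) * (h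
      t)\<^sup>2) (at t)"
    if t: "t \<in> {-1<..<1}" for t
  proof -
    have "(E has_real_derivative h1 t * N t + (1 - t\<^sup>2) * ((2 - \<kappa>) * h t - \<mu> * spow q (w t)) * h
        t) (at t)"
      unfolding E_def N_def by (intro DERIV_mult dh dN t)
    moreover have "N t = (1 - t\<^sup>2)\<^sup>2 * h1 t" using h1[of t] t by (simp add: N_def)
    ultimately show ?thesis using \<mu> by (simp add: algebra_simps power2_eq_square)
  qed
  have dE0: "0 \<le> (1 - t\<^sup>2)\<^sup>2 * (h1 t)\<^sup>2 + (2 - \<kappa>) * (1 - t\<^sup>2) * (h t)\<^sup>2" if "t \<in> {-1<..<1}" for t
    using one_minus_sq[OF that] \<kappa> by (intro add_nonneg_nonneg mult_nonneg_nonneg) auto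
  have mono: "E s \<le> E t" if st: "-1 \<le> s" "s \<le> t" "t \<le> 1" for s t
  proof (rule DERIV_nonneg_imp_increasing_open[OF st(2)])
    show "continuous_on {s..t} E" by (rule continuous_on_subset[OF Ec]) (use st in auto)
    fix x assume "s < x" "x < t"
    then have "x \<in> {-1<..<1}" using st by auto
    then show "\<exists>y. (E has_real_derivative y) (at x) \<and> 0 \<le> y" using grid_energy dE0 by blast
  qed
  have E0: "E t = 0" if "t \<in> {-1..1}" for t using mono[of "-1" t] mono[of t 1] E1 that by auto
  have h10: "h1 t = 0" if t: "t \<in> {-1<..<1}" for t
  proof -
    have "(E has_real_derivative 0) (at t)"
      by (rule has_field_derivative_transform_within_open[OF DERIV_const[of 0]
          open_greaterThanLessThan t]) (use E0 in auto)
    then have "(1 - t\<^sup>2)\<^sup>2 * (h1 t)\<^sup>2 + (2 - \<kappa>) * (1 - t\<^sup>2) * (h t)\<^sup>2 = 0"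
        using grid_energy[OF t] DERIV_unique by blast
    moreover have "0 \<le> (2 - \<kappa>) * (1 - t\<^sup>2) * (h t)\<^sup>2" using one_minus_sq[OF t] \<kappa> by simp
    moreover have "0 \<le> (1 - t\<^sup>2)\<^sup>2 * (h1 t)\<^sup>2" by simp
    ultimately have "(1 - t\<^sup>2)\<^sup>2 * (h1 t)\<^sup>2 = 0" by linarith
    then show ?thesis using one_minus_sq[OF t] by simp
  qed
  \<comment> \<open>A constant \<open>h\<close> is still possible so far, and at
    \<open>\<kappa> = 2\<close> it does solve the linear equation; oddness excludes it through
    \<open>h 0 = 0\<close>.\<close>
  have "w (- 0) = \<sigma> * w 0" using w(1) unfolding admissible_def by (elim conjE) (erule bspec, simp)
  then have h0: "h 0 = 0" using h[of 0] odd by simp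
  have "h t = 0" if t: "t \<in> {-1<..<1}" for t
  proof -
    have "h t = h 0"
      by (rule DERIV_isconst3[of "-1" 1]) (use t dh h10 in auto)
    then show ?thesis using h0 by simp
  qed
  then have "w t = 0" if "t \<in> {-1..1}" for t using w1 h[OF that] that
      by (cases "t = 1 \<or> t = -1") auto
  then have "power_integral q w = integral {-1..1} (\<lambda>t::real. 0)"
    unfolding power_integral_def by (intro Henstock_Kurzweil_Integration.integral_cong) simp
  then show False using nz by simp
qed

end

section \<open>Trial functions and the choice of the parity class\<close>

lemma power_integral_normalise:
  assumes q: "q > 0" and v: "admissible \<sigma> v" "finite_energy v" "t \<in> {-1..1}" "v t \<noteq> 0"
  obtains c where "c \<noteq> 0" "power_integral q (\<lambda>t. c * v t) = 1"
proof -
  have "power_integral q v \<noteq> 0" using power_integral_eq_zeroD[OF q v(1) _ v(3)] v(4) by auto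
  then have N: "power_integral q v > 0" using power_integral_nonneg[OF q v(1)] by simp
  define c where "c = power_integral q v powr (- 1 / (q + 1))"
  have c: "c > 0" using N by (simp add: c_def)
  have "c powr (q + 1) = power_integral q v powr (- 1)" using q by (simp add: c_def powr_powr)
  then have "c powr (q + 1) * power_integral q v = 1" using N by (simp add: powr_minus)
  then have "power_integral q (\<lambda>t. c * v t) = 1" unfolding power_integral_scale using c by simp
  from that[OF _ this] show ?thesis using c by simp
qed

lemma grid_Suc_diff: "grid n (Suc i) - grid n i = 1 / 2 ^ n"
  by (simp add: grid_def field_simps)

lemma grid_energy_lipschitz:
  assumes "\<And>s t. s \<in> {-1..1} \<Longrightarrow> t \<in> {-1..1} \<Longrightarrow> \<bar>v t - v s\<bar> \<le> L * \<bar>t - s\<bar>"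
  shows "grid_energy n v \<le> 2 * L\<^sup>2"
proof -
  have "(v (grid n (Suc i)) - v (grid n i)) * (v (grid n (Suc i)) - v (grid n i)) \<le>
      (L * (1 / 2 ^ n))\<^sup>2"
    if "i < 2 * 2 ^ n" for i
  proof -
    have "\<bar>v (grid n (Suc i)) - v (grid n i)\<bar> \<le> L * (1 / 2 ^ n)"
      using assms[of "grid n i" "grid n (Suc i)"] grid_bounds[of i n] grid_bounds[of "Suc i" n] that
      by (simp add: grid_Suc_diff)
    from power_mono[OF this, of 2] show ?thesis by (simp add: power2_eq_square)
  qed
  then have "grid_energy n v \<le> 2 ^ n * (\<Sum>i<2 * 2 ^ n::nat. (L * (1 / 2 ^ n))\<^sup>2)"
    unfolding grid_form_def by (intro mult_left_mono sum_mono) auto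
  also have "\<dots> = 2 * L\<^sup>2" by (simp add: power_mult_distrib power_divide power2_eq_square)
  finally show ?thesis .
qed

text \<open>The bound 8/3 is the integral of 4 t^2. Its ratio 2 to the weighted form is the
  threshold for \<open>\<kappa>\<close> beyond which the minimum is negative.\<close>

lemma even_trial: "admissible 1 (\<lambda>t. 1 - t\<^sup>2)" "finite_energy (\<lambda>t. 1 - t\<^sup>2)"
    "energy (\<lambda>t. 1 - t\<^sup>2) \<le> 8 / 3"
  "weighted_form (\<lambda>t. 1 - t\<^sup>2) (\<lambda>t. 1 - t\<^sup>2) = 4 / 3"
proof -
  show "admissible 1 (\<lambda>t. 1 - t\<^sup>2)" unfolding admissible_def by (auto intro!: continuous_intros)
  have grid_energy: "grid_energy n (\<lambda>t. 1 - t\<^sup>2) \<le> 8 / 3" for n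
  proof -
    have *: "2 ^ n * (((1 - y\<^sup>2) - (1 - x\<^sup>2)) * ((1 - y\<^sup>2) - (1 - x\<^sup>2))) \<le> 4 / 3 * (y ^ 3 - x ^ 3)"
      if xy: "y - x = 1 / 2 ^ n" for x y :: real
    proof -
      have p: "2 ^ n * (y - x) = 1" "y - x > 0" using xy by simp_all
      have "2 ^ n * (((1 - y\<^sup>2) - (1 - x\<^sup>2)) * ((1 - y\<^sup>2) - (1 - x\<^sup>2))) =
          (2 ^ n * (y - x)) * ((y - x) * (x + y)\<^sup>2)"
        by (simp add: power2_eq_square algebra_simps)
      also have "\<dots> = (y - x) * (x + y)\<^sup>2" unfolding p by simp
      \<comment> \<open>The added cube completes the term to the integral of 4 t^2 over the cell, so
        that the sum telescopes.\<close>
      also have "\<dots> \<le> (y - x) * (x + y)\<^sup>2 + (y - x) * ((y - x)\<^sup>2 / 3)" using p(2) by simp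
      also have "\<dots> = 4 / 3 * (y ^ 3 - x ^ 3)"
          by (simp add: power2_eq_square power3_eq_cube field_simps)
      finally show ?thesis .
    qed
    have "grid_energy n (\<lambda>t. 1 - t\<^sup>2) \<le> (\<Sum>i<2 * 2 ^ n. 4 / 3 * (grid n (Suc i) ^ 3 - grid n i ^ 3))"
      unfolding grid_form_def sum_distrib_left by (intro sum_mono * grid_Suc_diff)
    also have "\<dots> = 4 / 3 * (grid n (2 * 2 ^ n) ^ 3 - grid n 0 ^ 3)"
      unfolding sum_distrib_left[symmetric] sum_lessThan_telescope[of "\<lambda>i. grid n i ^ 3"] ..
    also have "\<dots> = 8 / 3" by (simp add: grid_def)
    finally show ?thesis .
  qed
  show "finite_energy (\<lambda>t. 1 - t\<^sup>2)" using grid_energy by (rule finite_energyI)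
  show "energy (\<lambda>t. 1 - t\<^sup>2) \<le> 8 / 3" using grid_energy by (rule energy_leI)
  have "((\<lambda>t. 1 - t\<^sup>2) has_integral (1 - 1 ^ 3 / 3) - (- 1 - (- 1) ^ 3 / 3)) {-1..1::real}"
    by (rule fundamental_theorem_of_calculus)
      (auto intro!: derivative_eq_intros simp:
          has_real_derivative_iff_has_vector_derivative[symmetric])
  then have *: "((\<lambda>t. 1 - t\<^sup>2) has_integral 4 / 3) {-1..1::real}" by simp
  have e: "(1 - t\<^sup>2) * (1 - t\<^sup>2) / (1 - t\<^sup>2) = 1 - t\<^sup>2" for t :: real
    by (cases "1 - t\<^sup>2 = 0") simp_all
  show "weighted_form (\<lambda>t. 1 - t\<^sup>2) (\<lambda>t. 1 - t\<^sup>2) = 4 / 3" unfolding weighted_form_def e using *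
      by (rule integral_unique)
qed

text \<open>Shows that the odd class is nonempty; the multiplier there is handled by
  \<open>multiplier_nonzero_odd\<close> instead of a numerical value of the energy, so a Lipschitz
  bound is enough.\<close>

lemma odd_trial: "admissible (-1) (\<lambda>t. t * (1 - t\<^sup>2))" "finite_energy (\<lambda>t. t * (1 - t\<^sup>2))"
proof -
  show "admissible (-1) (\<lambda>t. t * (1 - t\<^sup>2))" unfolding admissible_def
      by (auto intro!: continuous_intros)
  have "\<bar>t * (1 - t\<^sup>2) - s * (1 - s\<^sup>2)\<bar> \<le> 2 * \<bar>t - s\<bar>" if st: "s \<in> {-1..1}" "t \<in> {-1..1}"
      for s t :: real
  proof -
    have "t * (1 - t\<^sup>2) - s * (1 - s\<^sup>2) = (1 - (t\<^sup>2 + t * s + s\<^sup>2)) * (t - s)"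
      by (simp add: power2_eq_square algebra_simps)
    then have "\<bar>t * (1 - t\<^sup>2) - s * (1 - s\<^sup>2)\<bar> = \<bar>1 - (t\<^sup>2 + t * s + s\<^sup>2)\<bar> * \<bar>t - s\<bar>"
        by (simp add: abs_mult)
    also have "\<dots> \<le> 2 * \<bar>t - s\<bar>"
    proof (rule mult_right_mono)
      have "t\<^sup>2 \<le> 1" "s\<^sup>2 \<le> 1" using one_minus_sq_le st by force+
      moreover have "2 * (t\<^sup>2 + t * s + s\<^sup>2) = t\<^sup>2 + s\<^sup>2 + (t + s)\<^sup>2"
        "2 * (t\<^sup>2 + t * s + s\<^sup>2) = 3 * (t\<^sup>2 + s\<^sup>2) - (t - s)\<^sup>2"
        by (simp_all add: power2_eq_square algebra_simps)
      moreover have "0 \<le> t\<^sup>2" "0 \<le> s\<^sup>2" "0 \<le> (t + s)\<^sup>2" "0 \<le> (t - s)\<^sup>2" by simp_all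
      ultimately have "t\<^sup>2 + t * s + s\<^sup>2 \<le> 3" "t\<^sup>2 + t * s + s\<^sup>2 \<ge> 0" by argo+
      then show "\<bar>1 - (t\<^sup>2 + t * s + s\<^sup>2)\<bar> \<le> 2" by (simp only: abs_le_iff) argo
    qed simp
    finally show ?thesis .
  qed
  then have "grid_energy n (\<lambda>t. t * (1 - t\<^sup>2)) \<le> 2 * 2\<^sup>2" for n by (rule grid_energy_lipschitz)
  then show "finite_energy (\<lambda>t. t * (1 - t\<^sup>2))" by (rule finite_energyI)
qed

lemma profile_exists:
  assumes \<alpha>: "\<alpha> > 2 \<or> \<alpha> < -2" and k: "k = 1 \<or> k = 2 \<and> \<alpha> > 2"
  shows "\<exists>A B P. profile k \<alpha> A B P"
proof -
  define q where "q = (\<alpha> + 2) / (\<alpha> - 2)"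
  define \<kappa> where "\<kappa> = (\<alpha> - 2) * (\<alpha> - 1)"
  have q: "q > 0" using \<alpha> by (auto simp: q_def divide_pos_pos divide_neg_neg)
  have q1: "q > 1" if "\<alpha> > 2" using that by (simp add: q_def)
  have \<alpha>': "\<alpha> \<noteq> 0" "\<alpha> \<noteq> 2" using \<alpha> by auto
  show ?thesis
  \<comment> \<open>For \<open>\<alpha> < -2\<close> one has \<open>\<kappa> > 12\<close>, so the
    second case concerns exactly 2 < \<alpha> \<le> 3.\<close>
  proof (cases "\<kappa> > 2")
    case True
    obtain c where c: "c \<noteq> 0" "power_integral q (\<lambda>t. c * (1 - t\<^sup>2)) = 1"
      by (rule power_integral_normalise[OF q even_trial(1,2), of 0]) (auto intro: that)
    note t = admissible_scale[OF even_trial(1), of c] energy_scale[OF even_trial(2), of c, THEN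
        conjunct1] c(2)
    obtain w where wm: "admissible 1 w" "finite_energy w" "power_integral q w = 1"
      and min: "\<And>v. admissible 1 v \<Longrightarrow> finite_energy v \<Longrightarrow> power_integral q v = 1 \<Longrightarrow>
          energy w - \<kappa> * weighted_form w w \<le> energy v - \<kappa> * weighted_form v v"
      by (rule minimizer_exists[OF q t]) (rule that)
    define \<mu> where "\<mu> = energy w - \<kappa> * weighted_form w w"
    have "\<mu> \<le> c\<^sup>2 * (energy (\<lambda>t. 1 - t\<^sup>2) - \<kappa> * (4 / 3))"
      using min[OF t]
      unfolding \<mu>_def energy_scale[OF even_trial(2), of c, THEN conjunct2] weighted_form_scale[of
          c "\<lambda>t. 1 - t\<^sup>2"] even_trial(4)
      by (simp add: right_diff_distrib mult.left_commute)
    also have "\<dots> < 0" using even_trial(3) True c(1) by (intro mult_pos_neg) auto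
    finally have \<mu>0: "\<mu> \<noteq> 0" by simp
    obtain w' where w': "\<And>t. t \<in> {-1<..<1} \<Longrightarrow> (w has_real_derivative w' t) (at t)"
      "\<And>t. t \<in> {-1<..<1} \<Longrightarrow> (w' has_real_derivative - (\<kappa> * w t / (1 - t\<^sup>2) + \<mu> * spow q (w t))) (at
          t)"
      by (rule minimizer_ode[OF q _ wm min[folded \<mu>_def] \<mu>_def]) (auto intro: that)
    have "ode_profile q 1 \<kappa> \<mu> w w'" by unfold_locales (use q wm w' in auto)
    then obtain W h h1 where "regular_profile q 1 \<kappa> \<mu> w w' W h h1" using ode_profile.regular
        by blast
    then interpret regular_profile q 1 \<kappa> \<mu> w w' W h h1 .
    show ?thesis
      by (rule profile_if_multiplier_nonzero[OF \<alpha>' \<kappa>_def q_def _ \<mu>0]) (use k q1 wm(3) in auto)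
  next
    case False
    obtain c where c: "c \<noteq> 0" "power_integral q (\<lambda>t. c * (t * (1 - t\<^sup>2))) = 1"
      by (rule power_integral_normalise[OF q odd_trial, of "1/2"]) (auto intro: that simp:
          power2_eq_square)
    note t = admissible_scale[OF odd_trial(1), of c] energy_scale[OF odd_trial(2), of c, THEN
        conjunct1] c(2)
    obtain w where wm: "admissible (-1) w" "finite_energy w" "power_integral q w = 1"
      and min: "\<And>v. admissible (-1) v \<Longrightarrow> finite_energy v \<Longrightarrow> power_integral q v = 1 \<Longrightarrow>
          energy w - \<kappa> * weighted_form w w \<le> energy v - \<kappa> * weighted_form v v"
      by (rule minimizer_exists[OF q t]) (rule that)
    define \<mu> where "\<mu> = energy w - \<kappa> * weighted_form w w"
    obtain w' where w': "\<And>t. t \<in> {-1<..<1} \<Longrightarrow> (w has_real_derivative w' t) (at t)"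
      "\<And>t. t \<in> {-1<..<1} \<Longrightarrow> (w' has_real_derivative - (\<kappa> * w t / (1 - t\<^sup>2) + \<mu> * spow q (w t))) (at
          t)"
      by (rule minimizer_ode[OF q _ wm min[folded \<mu>_def] \<mu>_def]) (auto intro: that)
    have "ode_profile q (-1) \<kappa> \<mu> w w'" by unfold_locales (use q wm w' in auto)
    then obtain W h h1 where "regular_profile q (-1) \<kappa> \<mu> w w' W h h1" using ode_profile.regular
        by blast
    then interpret regular_profile q "-1" \<kappa> \<mu> w w' W h h1 .
    have \<mu>0: "\<mu> \<noteq> 0" by (rule multiplier_nonzero_odd) (use False wm(3) in auto)
    show ?thesis
      by (rule profile_if_multiplier_nonzero[OF \<alpha>' \<kappa>_def q_def _ \<mu>0]) (use k q1 wm(3) in auto)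
  qed
qed

section \<open>The flow of a profile\<close>

lemma Ck_on_powr:
  fixes f :: "real^'n::finite \<Rightarrow> real"
  assumes "open S" "Ck_on k f S" "\<And>x. x \<in> S \<Longrightarrow> f x > 0"
  shows "Ck_on k (\<lambda>x. f x powr c) S"
proof -
  define \<Phi> where "\<Phi> = (\<lambda>j y. (\<Prod>i<j. c - real i) * y powr (c - real j))"
  have "Ck_on k (\<lambda>x. \<Phi> 0 (f x)) S"
  proof (rule Ck_on_compose[where \<Phi>=\<Phi> and f=f, OF assms(1) open_greaterThan[of 0] assms(2)])
    show "(\<Phi> j has_real_derivative \<Phi> (Suc j) y) (at y)" if "y \<in> {0<..}" for j y
    proof -
      have "((\<lambda>y. (\<Prod>i<j. c - real i) * y powr (c - real j)) has_real_derivative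
          (\<Prod>i<j. c - real i) * ((c - real j) * y powr (c - real j - 1))) (at y)"
        using that by (intro DERIV_cmult has_real_derivative_powr) auto
      then show ?thesis by (simp add: \<Phi>_def algebra_simps)
    qed
    show "continuous_on {0<..} (\<Phi> k)" unfolding \<Phi>_def by (intro continuous_intros) auto
  qed (use assms in auto)
  then show ?thesis by (simp add: \<Phi>_def)
qed

text \<open>Powers of \<open>x \<bullet> x\<close> avoid differentiating the norm. At the origin
  \<open>0 powr c = 0\<close> makes the field vanish, so homogeneity holds there as well.\<close>

definition flow_u :: "real \<Rightarrow> (real \<Rightarrow> real) \<Rightarrow> (real \<Rightarrow> real) \<Rightarrow> real^3 \<Rightarrow> real^3" where
  "flow_u \<alpha> A B x = ((x \<bullet> x) powr (-(\<alpha>+1)/2) * A (x$3 / sqrt (x \<bullet> x))) *\<^sub>R x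
     + ((x \<bullet> x) powr (-\<alpha>/2) * B (x$3 / sqrt (x \<bullet> x))) *\<^sub>R e_z"

definition flow_p :: "real \<Rightarrow> (real \<Rightarrow> real) \<Rightarrow> real^3 \<Rightarrow> real" where
  "flow_p \<alpha> P x = (x \<bullet> x) powr (-\<alpha>) * P (x$3 / sqrt (x \<bullet> x))"

lemma open_punctured: "open (- {0 :: real^3})"
  by (intro open_Compl closed_singleton)

lemma Ck_on_inner_self: "Ck_on k (\<lambda>x::real^3. x \<bullet> x) (- {0})"
proof -
  have "Ck_on k (\<lambda>x::real^3. x$1 * x$1 + x$2 * x$2 + x$3 * x$3) (- {0})"
    by (intro Ck_on_add Ck_on_mult Ck_on_nth open_punctured)
  then show ?thesis by (simp add: inner_3)
qed

lemma Ck_on_radial: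
  assumes "Ck_seq k \<Phi>"
  shows "Ck_on k (\<lambda>x::real^3. (x \<bullet> x) powr c * \<Phi> 0 (x$3 / sqrt (x \<bullet> x))) (- {0})"
proof (intro Ck_on_mult open_punctured Ck_on_powr Ck_on_inner_self)
  have "Ck_on k (\<lambda>x::real^3. x$3 * (x \<bullet> x) powr (- (1/2))) (- {0})"
    by (intro Ck_on_mult open_punctured Ck_on_powr Ck_on_inner_self Ck_on_nth) auto
  then have "Ck_on k (\<lambda>x::real^3. x$3 / sqrt (x \<bullet> x)) (- {0})"
    by (rule Ck_on_cong[OF open_punctured, rotated])
      (simp only: powr_minus powr_half_sqrt inner_ge_zero divide_inverse[of _ "sqrt _"])
  then show "Ck_on k (\<lambda>x::real^3. \<Phi> 0 (x$3 / sqrt (x \<bullet> x))) (- {0})"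
    by (rule Ck_on_compose[where \<Phi>=\<Phi> and f="\<lambda>x. x$3 / sqrt (x \<bullet> x)", OF open_punctured open_UNIV])
        (use assms in \<open>auto simp: Ck_seq_def\<close>)
qed auto

lemma Ck_on_flow_p: "Ck_seq k P \<Longrightarrow> Ck_on k (flow_p \<alpha> (P 0)) (- {0})"
  unfolding flow_p_def[abs_def] by (rule Ck_on_radial)

lemma Ck_on_flow_u: "Ck_seq k A \<Longrightarrow> Ck_seq k B \<Longrightarrow> Ck_on k (flow_u \<alpha> (A 0) (B 0)) (- {0})"
proof (rule Ck_on_componentwise[OF open_punctured])
  fix i :: 3
  assume "Ck_seq k A" "Ck_seq k B"
  then have "Ck_on k (\<lambda>x::real^3. (x \<bullet> x) powr (-(\<alpha>+1)/2) * A 0 (x$3 / sqrt (x \<bullet> x)) * x $ i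
     + (x \<bullet> x) powr (-\<alpha>/2) * B 0 (x$3 / sqrt (x \<bullet> x)) * e_z $ i) (- {0})"
    by (intro Ck_on_add Ck_on_mult[OF open_punctured Ck_on_radial] Ck_on_nth Ck_on_const
        open_punctured)
  then show "Ck_on k (\<lambda>x. flow_u \<alpha> (A 0) (B 0) x $ i) (- {0})"
    by (simp add: flow_u_def)
qed

lemma has_derivative_radial:
  fixes x :: "real^3"
  assumes r: "r = norm x" "r > 0" and t: "t = x$3 / r" and \<phi>: "(\<phi> has_real_derivative \<phi>') (at t)"
  shows "((\<lambda>y. (y \<bullet> y) powr c * \<phi> (y$3 / sqrt (y \<bullet> y))) has_derivative
    (\<lambda>v. r powr (2 * c) * (2 * c * \<phi> t * (x \<bullet> v) / r\<^sup>2 + \<phi>' * (v$3 / r - t * (x \<bullet> v) / r\<^sup>2)))) (at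
        x)"
proof -
  have s: "x \<bullet> x = r\<^sup>2" "sqrt (x \<bullet> x) = r" using r
      by (simp_all add: power2_norm_eq_inner norm_eq_sqrt_inner)
  have ds: "((\<lambda>y. y \<bullet> y) has_derivative (\<lambda>v. 2 * (x \<bullet> v))) (at x)"
    by (auto intro!: derivative_eq_intros simp: inner_commute)
  have n: "((\<lambda>y. y $ 3) has_derivative (\<lambda>v. v $ 3)) (at x)"
    by (rule bounded_linear_imp_has_derivative[OF bounded_linear_vec_nth])
  have r2: "r\<^sup>2 > 0" using r by simp
  have pw: "((\<lambda>y. (y \<bullet> y) powr c) has_derivative (\<lambda>v. 2 * (x \<bullet> v) * (c * (r\<^sup>2) powr (c - 1)))) (at
      x)"
    using DERIV_compose_FDERIV[OF has_real_derivative_powr[of "r\<^sup>2" c, OF r2, folded s(1)] ds]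
        s(1) by simp
  have "((\<lambda>y. inverse (sqrt y)) has_real_derivative - 1 / (2 * r * r\<^sup>2)) (at (r\<^sup>2))"
    using r(2) by (auto intro!: derivative_eq_intros simp: field_simps power2_eq_square)
  from DERIV_compose_FDERIV[OF this[folded s(1)] ds]
  have "((\<lambda>y. inverse (sqrt (y \<bullet> y))) has_derivative (\<lambda>v. 2 * (x \<bullet> v) * (- 1 / (2 * r * r\<^sup>2))))
      (at x)"
    using s(1) by simp
  from has_derivative_mult[OF n this]
  have "((\<lambda>y. y$3 / sqrt (y \<bullet> y)) has_derivative
      (\<lambda>v. x$3 * (2 * (x \<bullet> v) * (- 1 / (2 * r * r\<^sup>2))) + v$3 * inverse r)) (at x)"
    by (simp only: s(2) divide_inverse[of _ "sqrt _"])
  from DERIV_compose_FDERIV[OF \<phi>[unfolded t, folded s(2)] this]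
  have "((\<lambda>y. \<phi> (y$3 / sqrt (y \<bullet> y))) has_derivative
      (\<lambda>v. (x$3 * (2 * (x \<bullet> v) * (- 1 / (2 * r * r\<^sup>2))) + v$3 * inverse r) * \<phi>')) (at x)" .
  note D = has_derivative_mult[OF pw this]
  have p1: "(r\<^sup>2) powr c = r powr (2 * c)" using r(2) by (simp add: powr_powr flip: powr_numeral)
  have p2: "(r\<^sup>2) powr (c - 1) = r powr (2 * c) / r\<^sup>2"
    by (simp only: powr_diff p1 powr_one less_imp_le[OF r2])
  have aux: "K * ((z * (2 * X * (- 1 / (2 * r * r\<^sup>2))) + v * inverse r) * \<phi>') + 2 * X * (c * (K /
      r\<^sup>2)) * F =
     K * (2 * c * F * X / r\<^sup>2 + \<phi>' * (v / r - z / r * X / r\<^sup>2))" for K z X v F :: real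
    using r(2) by (simp add: field_simps)
  have s3: "sqrt (r\<^sup>2) = r" using r(2) by simp
  show ?thesis
    by (rule has_derivative_eq_rhs[OF D]) (simp only: s s3 p1 p2 t aux)
qed

lemma convection_eq:
  assumes "(u has_derivative D) (at x)"
  shows "convection u x = D (u x)"
proof -
  have l: "linear D" using assms by (rule has_derivative_linear)
  have "D (u x) = D (\<Sum>j\<in>UNIV. u x $ j *\<^sub>R axis j 1)"
    by (rule arg_cong[of _ _ D]) (simp add: vec3_eq_iff sum_3)
  also have "\<dots> = (\<Sum>j\<in>UNIV. u x $ j *\<^sub>R D (axis j 1))"
    by (simp only: linear_sum[OF l] linear_cmul[OF l] o_def)
  finally show ?thesis unfolding convection_def partial_eqI[OF assms] ..
qed

lemma flow_derivatives:
  fixes x :: "real^3" and A A' B B' P P' \<alpha> :: real and fA fB fP :: "real \<Rightarrow> real"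
  assumes r: "r = norm x" "r > 0" and t: "t = x$3 / r" and k: "k = r powr (- \<alpha>)"
    and A: "A = fA t" "(fA has_real_derivative A') (at t)"
    and B: "B = fB t" "(fB has_real_derivative B') (at t)"
    and P: "P = fP t" "(fP has_real_derivative P') (at t)"
  defines "Dg \<equiv> \<lambda>v. k / r * (-(\<alpha> + 1) * A * (x \<bullet> v) / r\<^sup>2 + A' * (v$3 / r - t * (x \<bullet> v) / r\<^sup>2))"
    and "Dh \<equiv> \<lambda>v. k * (-\<alpha> * B * (x \<bullet> v) / r\<^sup>2 + B' * (v$3 / r - t * (x \<bullet> v) / r\<^sup>2))"
    and "Dp \<equiv> \<lambda>v. k\<^sup>2 * (-2 * \<alpha> * P * (x \<bullet> v) / r\<^sup>2 + P' * (v$3 / r - t * (x \<bullet> v) / r\<^sup>2))"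
  shows "flow_u \<alpha> fA fB x = (k / r * A) *\<^sub>R x + (k * B) *\<^sub>R e_z"
    and "(flow_u \<alpha> fA fB has_derivative (\<lambda>v. (k / r * A) *\<^sub>R v + Dg v *\<^sub>R x + Dh v *\<^sub>R e_z)) (at x)"
    and "(flow_p \<alpha> fP has_derivative Dp) (at x)"
proof -
  have s: "x \<bullet> x = r\<^sup>2" "sqrt (x \<bullet> x) = r" using r
      by (simp_all add: power2_norm_eq_inner norm_eq_sqrt_inner)
  have pw: "(r\<^sup>2) powr c = r powr (2 * c)" for c using r(2)
      by (simp add: powr_powr flip: powr_numeral)
  have e1: "2 * (-(\<alpha>+1)/2) = -(\<alpha>+1)" by simp
  have k1: "r powr (-(\<alpha>+1)) = k / r"
  proof -
    have "-(\<alpha>+1) = - \<alpha> - 1" by simp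
    then show ?thesis using r by (simp only: powr_diff k) simp
  qed
  have k2: "r powr (2 * (-\<alpha>/2)) = k" by (simp add: k)
  have k3: "r powr (2 * (-\<alpha>)) = k\<^sup>2" using r by (simp add: k power2_eq_square flip: powr_add)
  show "flow_u \<alpha> fA fB x = (k / r * A) *\<^sub>R x + (k * B) *\<^sub>R e_z"
    unfolding flow_u_def s(2) unfolding s(1) pw e1 k1 k2 A B t ..
  have g: "((\<lambda>y. (y \<bullet> y) powr (-(\<alpha>+1)/2) * fA (y$3 / sqrt (y \<bullet> y))) has_derivative Dg) (at x)"
    by (rule has_derivative_eq_rhs[OF has_derivative_radial[OF r t A(2)]]) (simp only: e1 k1
        Dg_def A)
  have h: "((\<lambda>y. (y \<bullet> y) powr (-\<alpha>/2) * fB (y$3 / sqrt (y \<bullet> y))) has_derivative Dh) (at x)"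
    by (rule has_derivative_eq_rhs[OF has_derivative_radial[OF r t B(2)]]) (simp only: k2 Dh_def
        B, simp)
  have p: "((\<lambda>y. (y \<bullet> y) powr (-\<alpha>) * fP (y$3 / sqrt (y \<bullet> y))) has_derivative Dp) (at x)"
    by (rule has_derivative_eq_rhs[OF has_derivative_radial[OF r t P(2)]]) (simp only: k3 Dp_def
        P, simp)
  then show "(flow_p \<alpha> fP has_derivative Dp) (at x)" unfolding flow_p_def[abs_def] .
  have gx: "(x \<bullet> x) powr (-(\<alpha>+1)/2) * fA (x$3 / sqrt (x \<bullet> x)) = k / r * A"
    unfolding s(2) unfolding s(1) pw e1 k1 A t ..
  show "(flow_u \<alpha> fA fB has_derivative (\<lambda>v. (k / r * A) *\<^sub>R v + Dg v *\<^sub>R x + Dh v *\<^sub>R e_z)) (at x)"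
    unfolding flow_u_def[abs_def]
    by (rule has_derivative_eq_rhs[OF has_derivative_add[OF has_derivative_scaleR[OF g
        has_derivative_ident]
            has_derivative_scaleR[OF h has_derivative_const]]]) (simp only: gx, simp)
qed

lemma flow_homogeneous: "homogeneous_on S \<alpha> (flow_u \<alpha> A B) (flow_p \<alpha> P)"
  unfolding homogeneous_on_def
proof (intro ballI allI impI)
  fix x :: "real^3" and l :: real assume l: "l > 0"
  have s: "(l *\<^sub>R x) \<bullet> (l *\<^sub>R x) = l\<^sup>2 * (x \<bullet> x)" by (simp add: power2_eq_square)
  have t: "(l *\<^sub>R x) $ 3 / sqrt ((l *\<^sub>R x) \<bullet> (l *\<^sub>R x)) = x$3 / sqrt (x \<bullet> x)"
    unfolding s using l by (simp add: real_sqrt_mult)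
  have pw: "(l\<^sup>2 * (x \<bullet> x)) powr c = l powr (2 * c) * (x \<bullet> x) powr c" for c
    using l by (simp add: powr_mult powr_powr flip: powr_numeral)
  have c: "l powr a * l powr (- a) = 1" for a using l by (simp add: powr_minus)
  have c1: "l powr \<alpha> * (l powr (2 * (-(\<alpha>+1)/2)) * l) = 1"
  proof -
    have "l powr \<alpha> * (l powr (2 * (-(\<alpha>+1)/2)) * l) =
        l powr \<alpha> * l powr (2 * (-(\<alpha>+1)/2)) * l powr 1" using l by simp
    also have "\<dots> = l powr (\<alpha> + 2 * (-(\<alpha>+1)/2) + 1)" by (simp only: powr_add)
    also have "\<alpha> + 2 * (-(\<alpha>+1)/2) + 1 = 0" by (simp add: field_simps)
    finally show ?thesis using l by simp
  qed
  have c2: "l powr \<alpha> * l powr (2 * (-\<alpha>/2)) = 1" using c[of \<alpha>] by simp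
  have c3: "l powr (2 * \<alpha>) * l powr (2 * (-\<alpha>)) = 1" using c[of "2 * \<alpha>"] by simp
  have "l powr \<alpha> *\<^sub>R flow_u \<alpha> A B (l *\<^sub>R x) =
     ((l powr \<alpha> * (l powr (2 * (-(\<alpha>+1)/2)) * l)) * ((x \<bullet> x) powr (-(\<alpha>+1)/2) * A (x$3 / sqrt (x \<bullet>
         x)))) *\<^sub>R x
     + ((l powr \<alpha> * l powr (2 * (-\<alpha>/2))) * ((x \<bullet> x) powr (-\<alpha>/2) * B (x$3 / sqrt (x \<bullet> x)))) *\<^sub>R e_z"
    unfolding flow_u_def t unfolding s pw by (simp add: scaleR_add_right mult_ac)
  then show "flow_u \<alpha> A B x = l powr \<alpha> *\<^sub>R flow_u \<alpha> A B (l *\<^sub>R x) \<and>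
     flow_p \<alpha> P x = l powr (2 * \<alpha>) * flow_p \<alpha> P (l *\<^sub>R x)"
    unfolding c1 c2 flow_p_def t unfolding s pw mult.assoc[symmetric] c3 by (simp add: flow_u_def)
qed

lemma flow_axisymmetric: "axisymmetric (flow_u \<alpha> A B) (flow_p \<alpha> P)" "without_swirl (flow_u \<alpha> A B)"
proof -
  define s where "s = (\<lambda>r z::real. r\<^sup>2 + z\<^sup>2)"
  have s: "cyl r \<phi> z \<bullet> cyl r \<phi> z = s r z" for r \<phi> z
  proof -
    have "cyl r \<phi> z \<bullet> cyl r \<phi> z = r\<^sup>2 * ((cos \<phi>)\<^sup>2 + (sin \<phi>)\<^sup>2) + z\<^sup>2"
      by (simp only: inner_3 cyl_nth power2_eq_square) (simp only: algebra_simps)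
    then show ?thesis by (simp add: s_def)
  qed
  have x: "cyl r \<phi> z = r *\<^sub>R e_r \<phi> + z *\<^sub>R e_z" for r \<phi> z by (simp add: vec3_eq_iff)
  show "axisymmetric (flow_u \<alpha> A B) (flow_p \<alpha> P)"
    unfolding axisymmetric_def
  proof (intro exI allI impI conjI)
    fix r \<phi> z :: real
    show "flow_u \<alpha> A B (cyl r \<phi> z) =
      (\<lambda>r z. s r z powr (-(\<alpha>+1)/2) * A (z / sqrt (s r z)) * r) r z *\<^sub>R e_r \<phi> + (\<lambda>r z. 0) r z *\<^sub>R
          e_phi \<phi> +
      (\<lambda>r z. s r z powr (-(\<alpha>+1)/2) * A (z / sqrt (s r z)) * z + s r z powr (-\<alpha>/2) * B (z / sqrt (s
          r z))) r z *\<^sub>R e_z"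
      unfolding flow_u_def s by (simp add: vec3_eq_iff algebra_simps)
    show "flow_p \<alpha> P (cyl r \<phi> z) = (\<lambda>r z. s r z powr (-\<alpha>) * P (z / sqrt (s r z))) r z"
      unfolding flow_p_def s by simp
  qed
  show "without_swirl (flow_u \<alpha> A B)"
    unfolding without_swirl_def
  proof (intro allI impI)
    fix r \<phi> z :: real
    show "flow_u \<alpha> A B (cyl r \<phi> z) \<bullet> e_phi \<phi> = 0"
      unfolding flow_u_def inner_3 by (simp add: algebra_simps)
  qed
qed

lemma profile_deriv:
  assumes "Ck_seq k \<Phi>" "k \<ge> 1"
  shows "(\<Phi> 0 has_real_derivative \<Phi> 1 t) (at t)"
  using assms by (simp add: Ck_seq_def)

text \<open>The momentum residual is a combination of \<open>x\<close> and \<open>e_z\<close>; the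
  two coefficients and the divergence vanish by the profile identities, which apply since |x_3|
  \<le> |x| puts \<open>t\<close> in [-1, 1].\<close>

lemma profile_flow:
  assumes pr: "profile k \<alpha> A B P" and k1: "k \<ge> 1"
  shows "punctured_solution k \<alpha> (flow_u \<alpha> (A 0) (B 0)) (flow_p \<alpha> (P 0))"
proof -
  let ?u = "flow_u \<alpha> (A 0) (B 0)" and ?p = "flow_p \<alpha> (P 0)"
  have C: "Ck_seq k A" "Ck_seq k B" "Ck_seq k P" using pr by (auto simp: profile_def)
  note dd = profile_deriv[OF C(1) k1] profile_deriv[OF C(2) k1] profile_deriv[OF C(3) k1]
  have eul: "convection ?u x + grad ?p x = 0 \<and> divergence ?u x = 0" if x: "x \<in> - {0}" for x
  proof -
    define r where "r = norm x"
    define t where "t = x$3 / r"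
    define k where "k = r powr (- \<alpha>)"
    have r: "r > 0" using x by (simp add: r_def)
    have x3: "x$3 = t * r" using r by (simp add: t_def)
    have xx: "x \<bullet> x = r\<^sup>2" by (simp add: r_def power2_norm_eq_inner)
    have "\<bar>x$3\<bar> \<le> r" unfolding r_def by (rule component_le_norm_cart)
    then have t1: "t \<in> {-1..1}" using r by (auto simp: t_def abs_le_iff field_simps)
    define a a1 b b1 p p1 where d: "a = A 0 t" "a1 = A 1 t" "b = B 0 t" "b1 = B 1 t" "p =
        P 0 t" "p1 = P 1 t"
    have id: "(1 - t\<^sup>2) * b1 = \<alpha> * t * b - (2 - \<alpha>) * a" "p1 = a * b"
      "2 * \<alpha> * p = (1 - t\<^sup>2) * b * a1 - \<alpha> * a\<^sup>2 - (\<alpha> + 2) * t * a * b"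
      using pr t1 unfolding profile_def d by auto
    note fd = flow_derivatives[OF r_def r t_def k_def d(1) dd(1)[of t, folded d] d(3) dd(2)[of t,
        folded d] d(5) dd(3)[of t, folded d]]
    define Dg where "Dg = (\<lambda>v. k / r * (-(\<alpha> + 1) * a * (x \<bullet> v) / r\<^sup>2 + a1 * (v$3 / r - t * (x \<bullet> v)
        / r\<^sup>2)))"
    define Dh where "Dh = (\<lambda>v. k * (-\<alpha> * b * (x \<bullet> v) / r\<^sup>2 + b1 * (v$3 / r - t * (x \<bullet> v) / r\<^sup>2)))"
    note du = fd(2)
    define u where "u = ?u x"
    have u: "u = (k / r * a) *\<^sub>R x + (k * b) *\<^sub>R e_z" unfolding u_def by (rule fd(1))
    have xe: "x \<bullet> e_z = t * r" by (simp add: inner_3 x3)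
    have xu: "x \<bullet> u = k * r * (a + t * b)"
      unfolding u inner_add_right inner_scaleR_right xx xe using r
          by (simp add: field_simps power2_eq_square)
    have u3: "u $ 3 = k * (a * t + b)" unfolding u using r by (simp add: x3 field_simps)
    have w1: "u $ 3 / r - t * (x \<bullet> u) / r\<^sup>2 = k * b * (1 - t\<^sup>2) / r"
      unfolding xu u3 using r by (simp add: field_simps power2_eq_square)
    have Dgu: "Dg u = k\<^sup>2 / r\<^sup>2 * (-(\<alpha> + 1) * a * (a + t * b) + b * (1 - t\<^sup>2) * a1)"
      unfolding Dg_def w1 unfolding xu using r by (simp add: field_simps power2_eq_square)
    have Dhu: "Dh u = k\<^sup>2 / r * (-\<alpha> * b * (a + t * b) + b * ((1 - t\<^sup>2) * b1))"
      unfolding Dh_def w1 unfolding xu using r by (simp add: field_simps power2_eq_square)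
    have conv: "convection ?u x = (k / r * a) *\<^sub>R u + Dg u *\<^sub>R x + Dh u *\<^sub>R e_z"
      unfolding convection_eq[OF du] u_def Dg_def Dh_def ..
    have ax: "x \<bullet> axis i 1 = x $ i" "axis i 1 $ 3 = e_z $ i" for i :: 3
      using exhaust_3[of i] by (auto simp: inner_3)
    have gr: "grad ?p x $ i = k\<^sup>2 * (- 2 * \<alpha> * p * x $ i / r\<^sup>2 + p1 * (e_z $ i / r - t * x $ i /
        r\<^sup>2))" for i
      unfolding grad_def using partial_eqI[OF fd(3), of i] by (simp add: ax)
    have cx: "Dg u + (k / r * a) * (k / r * a) + k\<^sup>2 * (- 2 * \<alpha> * p / r\<^sup>2 - p1 * t / r\<^sup>2) = 0"
    proof -
      have "Dg u + (k / r * a) * (k / r * a) + k\<^sup>2 * (- 2 * \<alpha> * p / r\<^sup>2 - p1 * t / r\<^sup>2) =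
         k\<^sup>2 / r\<^sup>2 * (-(\<alpha> + 1) * a * (a + t * b) + b * (1 - t\<^sup>2) * a1 + a\<^sup>2 - 2 * \<alpha> * p - p1 * t)"
        unfolding Dgu using r by (simp add: field_simps power2_eq_square)
      also have "-(\<alpha> + 1) * a * (a + t * b) + b * (1 - t\<^sup>2) * a1 + a\<^sup>2 - 2 * \<alpha> * p - p1 * t = 0"
        unfolding id(3) id(2) by (simp add: algebra_simps power2_eq_square)
      finally show ?thesis by simp
    qed
    have cz: "Dh u + (k / r * a) * (k * b) + k\<^sup>2 * p1 / r = 0"
    proof -
      have "Dh u + (k / r * a) * (k * b) + k\<^sup>2 * p1 / r =
         k\<^sup>2 / r * (-\<alpha> * b * (a + t * b) + b * ((1 - t\<^sup>2) * b1) + a * b + p1)"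
        unfolding Dhu using r by (simp add: field_simps power2_eq_square)
      also have "-\<alpha> * b * (a + t * b) + b * ((1 - t\<^sup>2) * b1) + a * b + p1 = 0"
        unfolding id(1) id(2) by (simp add: algebra_simps power2_eq_square)
      finally show ?thesis by simp
    qed
    have "(convection ?u x + grad ?p x) $ i = 0" for i
    proof -
      have "(convection ?u x + grad ?p x) $ i =
        (Dg u + (k / r * a) * (k / r * a) + k\<^sup>2 * (- 2 * \<alpha> * p / r\<^sup>2 - p1 * t / r\<^sup>2)) * x $ i
        + (Dh u + (k / r * a) * (k * b) + k\<^sup>2 * p1 / r) * e_z $ i"
        unfolding conv vector_add_component gr u vector_scaleR_component
        by (simp add: algebra_simps diff_divide_distrib add_divide_distrib)
      then show ?thesis unfolding cx cz by simp
    qed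
    then have 1: "convection ?u x + grad ?p x = 0" by (simp add: vec_eq_iff)
    have pd: "partial i ?u x $ i = k / r * a + Dg (axis i 1) * x $ i + Dh (axis i 1) * e_z $ i"
        for i
      unfolding partial_eqI[OF du] Dg_def Dh_def by simp
    have "divergence ?u x = k / r * (3 * a - (\<alpha> + 1) * a * (x \<bullet> x) / r\<^sup>2 + a1 * (t - t * (x \<bullet> x) /
        r\<^sup>2)
        - \<alpha> * b * t + b1 * (1 - t * t))"
      unfolding divergence_def sum_3 pd Dg_def Dh_def ax unfolding inner_3
      using r by (simp add: x3 field_simps power2_eq_square)
    also have "\<dots> = k / r * ((1 - t\<^sup>2) * b1 - (\<alpha> * t * b - (2 - \<alpha>) * a))"
      unfolding xx using r by (simp add: field_simps power2_eq_square)
    also have "\<dots> = 0" unfolding id(1) by simp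
    finally show ?thesis using 1 by simp
  qed
  have "rotational ?u"
  proof -
    obtain t where t: "t \<in> {-1<..<1}" "A 1 t + \<alpha> * B 0 t + t * B 1 t \<noteq> 0"
      using pr unfolding profile_def by blast
    \<comment> \<open>The point of the unit sphere with height \<open>t\<close> in the half-plane
      through the positive x_1 axis; there the second component of the curl is azimuthal.\<close>
    define x :: "real^3" where "x = vector [sqrt (1 - t\<^sup>2), 0, t]"
    have t2: "1 - t\<^sup>2 > 0" by (rule one_minus_sq[OF t(1)])
    have x: "x $ 1 = sqrt (1 - t\<^sup>2)" "x $ 2 = 0" "x $ 3 = t" by (simp_all add: x_def)
    have xx: "x \<bullet> x = 1" using t2 by (simp add: inner_3 x power2_eq_square[symmetric])
    then have r: "1 = norm x" by (simp add: norm_eq_sqrt_inner)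
    have t': "t = x $ 3 / 1" "1 = 1 powr (-\<alpha>)" by (simp_all add: x)
    note du = flow_derivatives(2)[OF r zero_less_one t' refl dd(1) refl dd(2) refl dd(3)]
    have ax: "x \<bullet> axis i 1 = x $ i" "axis i 1 $ 3 = e_z $ i" for i :: 3
      using exhaust_3[of i] by (auto simp: inner_3)
    have "curl ?u x $ 2 = x $ 1 * (A 1 t + \<alpha> * B 0 t + t * B 1 t)"
      unfolding curl_def partial_eqI[OF du]
      by (simp add: ax x) (simp add: algebra_simps power2_eq_square)
    then have "curl ?u x \<noteq> 0" using t t2 x by (metis less_irrefl mult_eq_0_iff real_sqrt_gt_zero
        zero_index)
    moreover have "x \<noteq> 0" using xx by auto
    ultimately show ?thesis unfolding rotational_def by blast
  qed
  then show ?thesis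
    unfolding punctured_solution_def euler_classical_def
    using eul Ck_on_flow_u[OF C(1,2)] Ck_on_flow_p[OF C(3)] flow_homogeneous flow_axisymmetric
        by blast
qed

section \<open>The distributional equations\<close>

lemma partial_homogeneous:
  fixes f :: "real^'n::finite \<Rightarrow> 'b::real_normed_vector"
  assumes hom: "\<And>x l. x \<noteq> 0 \<Longrightarrow> l > 0 \<Longrightarrow> f x = l powr \<gamma> *\<^sub>R f (l *\<^sub>R x)"
    and d: "\<And>x. x \<noteq> 0 \<Longrightarrow> f differentiable (at x)" and x: "x \<noteq> 0" and l: "l > 0"
  shows "partial i f x = (l powr \<gamma> * l) *\<^sub>R partial i f (l *\<^sub>R x)"
proof -
  have lx: "l *\<^sub>R x \<noteq> 0" using x l by simp
  have D: "(f has_derivative frechet_derivative f (at (l *\<^sub>R x))) (at (l *\<^sub>R x))"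
    using d[OF lx] by (simp only: frechet_derivative_works)
  have "((\<lambda>y. l *\<^sub>R y) has_derivative (\<lambda>v. l *\<^sub>R v)) (at x)"
    by (intro has_derivative_scaleR_right has_derivative_ident)
  note D' = has_derivative_scaleR_right[OF has_derivative_compose[OF this D], of "l powr \<gamma>"]
  have "(f has_derivative (\<lambda>v. l powr \<gamma> *\<^sub>R frechet_derivative f (at (l *\<^sub>R x)) (l *\<^sub>R v))) (at x)"
  proof (rule has_derivative_transform_within_open[OF D'])
    show "open (- {0 :: real^'n})" by (intro open_Compl closed_singleton)
    show "l powr \<gamma> *\<^sub>R f (l *\<^sub>R y) = f y" if "y \<in> - {0}" for y using hom[of y, OF _ l] that by simp
  qed (use x in simp)
  from partial_eqI[OF this]
  show ?thesis by (simp add: partial_def linear_cmul[OF has_derivative_linear[OF D]])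
qed

text \<open>Compactness of the unit sphere and scaling; here and below the degree of homogeneity is
  \<open>- \<gamma>\<close>.\<close>

lemma homogeneous_bound:
  fixes f :: "real^'n::finite \<Rightarrow> 'b::real_normed_vector"
  assumes cont: "continuous_on (- {0}) f"
    and hom: "\<And>x l. x \<noteq> 0 \<Longrightarrow> l > 0 \<Longrightarrow> f x = l powr \<gamma> *\<^sub>R f (l *\<^sub>R x)"
  obtains C where "C \<ge> 0" "\<And>x. x \<noteq> 0 \<Longrightarrow> norm (f x) \<le> C * norm x powr (- \<gamma>)"
proof -
  have "compact (f ` sphere 0 1)"
    by (intro compact_continuous_image continuous_on_subset[OF cont]) auto
  then have "bounded (f ` sphere 0 1)" by (rule compact_imp_bounded)
  then obtain C where "\<forall>z\<in>f ` sphere 0 1. norm z \<le> C" unfolding bounded_iff by blast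
  then have C: "\<And>y. y \<in> sphere 0 1 \<Longrightarrow> norm (f y) \<le> C" by blast
  have "norm (f x) \<le> \<bar>C\<bar> * norm x powr (- \<gamma>)" if x: "x \<noteq> 0" for x
  proof -
    have i: "inverse (norm x) > 0" using x by simp
    have "inverse (norm x) *\<^sub>R x \<in> sphere 0 1" using x by simp
    from C[OF this] have c: "norm (f (inverse (norm x) *\<^sub>R x)) \<le> \<bar>C\<bar>" by linarith
    have "norm (f x) = inverse (norm x) powr \<gamma> * norm (f (inverse (norm x) *\<^sub>R x))"
      using arg_cong[OF hom[OF x i], of norm] by simp
    also have "inverse (norm x) powr \<gamma> = norm x powr (- \<gamma>)"
      using x by (simp add: powr_minus inverse_powr)
    finally show ?thesis using mult_left_mono[OF c, of "norm x powr (- \<gamma>)"]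
        by (simp add: mult.commute)
  qed
  then show ?thesis using that[of "\<bar>C\<bar>"] by simp
qed

lemma norm_powr_tendsto_zero:
  fixes f :: "real^'n::finite \<Rightarrow> 'b::real_normed_vector"
  assumes "a > 0" "\<And>x. x \<noteq> 0 \<Longrightarrow> norm (f x) \<le> C * norm x powr a"
  shows "(f \<longlongrightarrow> 0) (at 0)"
proof (rule Lim_null_comparison)
  show "\<forall>\<^sub>F x in at 0. norm (f x) \<le> C * norm x powr a"
    using assms(2) by (simp add: eventually_at_filter)
  have "((\<lambda>x::real^'n. C * norm x powr a) \<longlongrightarrow> C * 0) (at 0)"
    by (intro tendsto_mult tendsto_const tendsto_zero_powrI[OF _ tendsto_const _ assms(1)]
        tendsto_norm_zero tendsto_ident_at) simp
  then show "((\<lambda>x::real^'n. C * norm x powr a) \<longlongrightarrow> 0) (at 0)" by simp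
qed

lemma continuous_on_UNIV_punctured:
  fixes f :: "real^'n::finite \<Rightarrow> 'b::real_normed_vector"
  assumes "continuous_on (- {0}) f" "(f \<longlongrightarrow> f 0) (at 0)"
  shows "continuous_on UNIV f"
proof -
  have "isCont f x" for x
  proof (cases "x = 0")
    case False
    moreover have "open (- {0::real^'n})" by (intro open_Compl closed_singleton)
    ultimately show ?thesis using assms(1) by (simp add: continuous_on_eq_continuous_at)
  qed (use assms(2) in \<open>simp add: isCont_def\<close>)
  then show ?thesis by (intro continuous_at_imp_continuous_on) simp
qed

text \<open>The degree exceeds 1, so \<open>f\<close> is o(|x|) and has derivative 0 at the origin;
  the partial derivatives have positive degree and tend to 0 there.\<close>

lemma homogeneous_C1_extends:
  fixes f :: "real^'n::finite \<Rightarrow> 'b::real_normed_vector"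
  assumes C1: "Ck_on (Suc 0) f (- {0})" and f0: "f 0 = 0" and \<gamma>: "\<gamma> < -1"
    and hom: "\<And>x l. x \<noteq> 0 \<Longrightarrow> l > 0 \<Longrightarrow> f x = l powr \<gamma> *\<^sub>R f (l *\<^sub>R x)"
  shows "Ck_on (Suc 0) f UNIV" "partial i f 0 = 0"
proof -
  have d: "f differentiable (at x)" if "x \<noteq> 0" for x using C1 that by simp
  have pc: "continuous_on (- {0}) (partial i f)" for i using C1 by simp
  have fc: "continuous_on (- {0}) f" using Ck_on_SucD[OF C1] by simp
  obtain C where C: "C \<ge> 0" "\<And>x. x \<noteq> 0 \<Longrightarrow> norm (f x) \<le> C * norm x powr (- \<gamma>)"
    by (rule homogeneous_bound[OF fc hom]) (auto intro: that)
  have D0: "(f has_derivative (\<lambda>_. 0)) (at 0)"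
  proof (rule has_derivativeI)
    have "((\<lambda>y. f y /\<^sub>R norm y) \<longlongrightarrow> 0) (at 0)"
    proof (rule norm_powr_tendsto_zero)
      show "- \<gamma> - 1 > 0" using \<gamma> by simp
      fix y :: "real^'n" assume y: "y \<noteq> 0"
      have "norm (f y /\<^sub>R norm y) \<le> C * norm y powr (- \<gamma>) / norm y"
        using divide_right_mono[OF C(2)[OF y], of "norm y"]
            by (simp add: divide_inverse mult.commute)
      also have "\<dots> = C * norm y powr (- \<gamma> - 1)" using y by (simp add: powr_diff)
      finally show "norm (f y /\<^sub>R norm y) \<le> C * norm y powr (- \<gamma> - 1)" .
    qed
    then show "((\<lambda>y. (f y - f 0 - 0) /\<^sub>R norm (y - 0)) \<longlongrightarrow> 0) (at 0)" by (simp add: f0)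
  qed simp
  have p0: "partial i f 0 = 0" for i using partial_eqI[OF D0] .
  show "partial i f 0 = 0" by (rule p0)
  have "continuous_on UNIV (partial i f)" for i
  proof (rule continuous_on_UNIV_punctured[OF pc])
    have ph: "partial i f x = l powr (\<gamma> + 1) *\<^sub>R partial i f (l *\<^sub>R x)" if "x \<noteq> 0" "l > 0" for x l
      using partial_homogeneous[OF hom d that, of i] that by (simp add: powr_add)
    obtain C' where C': "C' \<ge> 0" "\<And>x. x \<noteq> 0 \<Longrightarrow> norm (partial i f x) \<le> C' * norm x powr (- (\<gamma> + 1))"
      by (rule homogeneous_bound[OF pc ph]) (auto intro: that)
    show "(partial i f \<longlongrightarrow> partial i f 0) (at 0)"
      unfolding p0 by (rule norm_powr_tendsto_zero[OF _ C'(2)]) (use \<gamma> in simp)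
  qed
  moreover have "f differentiable (at x)" for x
    using d D0 by (cases "x = 0") (auto simp: differentiable_def)
  ultimately show "Ck_on (Suc 0) f UNIV" by simp
qed

text \<open>The integral of a difference quotient vanishes by translation invariance.\<close>

lemma integral_partial_eq_zero:
  fixes f :: "real^'n::finite \<Rightarrow> real"
  assumes C1: "Ck_on (Suc 0) f UNIV" and supp: "\<And>x. norm x > R \<Longrightarrow> f x = 0"
  shows "integrable lborel (partial i f)" "(LINT x|lborel. partial i f x) = 0"
proof -
  define e :: "real^'n" where "e = axis i 1"
  have e: "norm e = 1" by (simp add: e_def)
  have d: "f differentiable (at x)" for x using C1 by simp
  have pc: "continuous_on UNIV (partial i f)" using C1 by simp
  have fc: "continuous_on UNIV f" using Ck_on_SucD[OF C1] by simp
  have psupp: "partial i f x = 0" if "norm x > R" for x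
  proof -
    have "open {x::real^'n. norm x > R}" by (intro open_Collect_less continuous_intros)
    from partial_cong_open[OF this, of x f "\<lambda>_. 0" i] that supp d[of x]
    show ?thesis by (simp add: partial_eqI[OF has_derivative_const])
  qed
  have bnd: "\<exists>M\<ge>0. \<forall>x. \<bar>g x\<bar> \<le> M" if g: "continuous_on UNIV g" "\<And>x. norm x > R \<Longrightarrow> g x = 0"
      for g :: "real^'n \<Rightarrow> real"
  proof -
    have "compact (g ` cball 0 R)"
      by (intro compact_continuous_image continuous_on_subset[OF g(1)]) auto
    then have "bounded (g ` cball 0 R)" by (rule compact_imp_bounded)
    then obtain M where "\<forall>z\<in>g ` cball 0 R. norm z \<le> M" unfolding bounded_iff by blast
    then have M: "\<And>y. y \<in> cball 0 R \<Longrightarrow> norm (g y) \<le> M" by blast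
    have "\<bar>g x\<bar> \<le> \<bar>M\<bar>" for x
      using M[of x] g(2)[of x] by (cases "norm x > R") auto
    then show ?thesis by (intro exI[of _ "\<bar>M\<bar>"]) simp
  qed
  obtain M where M: "M \<ge> 0" "\<And>x. \<bar>partial i f x\<bar> \<le> M" using bnd[OF pc psupp] by blast
  obtain M0 where M0: "M0 \<ge> 0" "\<And>x. \<bar>f x\<bar> \<le> M0" using bnd[OF fc supp] by blast
  have meas: "g \<in> borel_measurable lborel" if "continuous_on UNIV g" for g :: "real^'n \<Rightarrow> real"
    using borel_measurable_continuous_onI[OF that] by simp
  have dom: "integrable lborel (\<lambda>x::real^'n. K * indicator (cball 0 S) x)" for K S :: real
    using emeasure_lborel_cball_finite[of "0::real^'n" S]
        by (intro integrable_mult_right integrable_real_indicator) auto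
  have fint: "integrable lborel f"
  proof (rule Bochner_Integration.integrable_bound[OF dom[of M0 R] meas[OF fc]], rule AE_I2)
    show "norm (f x) \<le> norm (M0 * indicator (cball 0 R) x)" for x
      using M0(1) M0(2)[of x] supp[of x] by (cases "norm x > R") auto
  qed
  define D where "D = (\<lambda>n x. (f (inverse (real (Suc n)) *\<^sub>R e + x) - f x) * real (Suc n))"
  have shift: "integrable lborel (\<lambda>x. f (c + x))" "(LINT x|lborel. f (c + x)) =
      (LINT x|lborel. f x)" for c
  proof -
    have m: "(+) c \<in> measurable lborel borel" by simp
    have fm: "f \<in> borel_measurable borel" using meas[OF fc] by simp
    have "integrable (distr lborel borel ((+) c)) f" using fint by (simp add: lborel_distr_plus)
    then show "integrable lborel (\<lambda>x. f (c + x))" using integrable_distr_eq[OF m fm] by simp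
    show "(LINT x|lborel. f (c + x)) = (LINT x|lborel. f x)"
      using integral_distr[OF m fm] by (simp add: lborel_distr_plus)
  qed
  have D0: "(LINT x|lborel. D n x) = 0" for n
    unfolding D_def using shift fint by simp
  have lim: "(\<lambda>n. D n x) \<longlonglongrightarrow> partial i f x" for x
  proof -
    have "((\<lambda>t. f (x + t *\<^sub>R e)) has_real_derivative partial i f x) (at 0)"
      using partial_has_vector_derivative[OF d[of x], of i]
          by (simp add: e_def has_real_derivative_iff_has_vector_derivative)
    then have "((\<lambda>h. (f (x + h *\<^sub>R e) - f x) / h) \<longlongrightarrow> partial i f x) (at 0)"
      by (simp add: DERIV_def)
    moreover have "filterlim (\<lambda>n. inverse (real (Suc n))) (at 0) sequentially"
      unfolding filterlim_at using LIMSEQ_inverse_real_of_nat by simp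
    ultimately have "(\<lambda>n. (f (x + inverse (real (Suc n)) *\<^sub>R e) - f x) / inverse (real (Suc n))) \<longlonglongrightarrow>
        partial i f x"
      by (rule filterlim_compose)
    then show ?thesis by (simp add: D_def divide_inverse add.commute)
  qed
  \<comment> \<open>The shifts have length at most 1, so all difference quotients vanish outside
    radius \<open>R + 1\<close>; inside, the mean value theorem bounds them by the maximum of the
    derivative.\<close>
  have bound: "norm (D n x) \<le> M * indicator (cball 0 (R + 1)) x" for n x
  proof (cases "norm x > R + 1")
    case True
    have "norm (inverse (real (Suc n)) *\<^sub>R e + x) \<ge> norm x - norm (inverse (real (Suc n)) *\<^sub>R e)"
      by (metis add.commute norm_diff_ineq)
    moreover have "norm (inverse (real (Suc n)) *\<^sub>R e) \<le> 1" by (simp add: e field_simps)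
    ultimately have "norm (inverse (real (Suc n)) *\<^sub>R e + x) > R" using True by linarith
    then show ?thesis using supp[of x] supp[of "inverse (real (Suc n)) *\<^sub>R e + x"] True
        by (simp add: D_def)
  next
    case False
    define h where "h = inverse (real (Suc n))"
    have h: "h > 0" by (simp add: h_def)
    have der: "((\<lambda>t. f (x + t *\<^sub>R e)) has_real_derivative partial i f (x + t *\<^sub>R e)) (at t)" for t
    proof -
      have "((\<lambda>s. f (x + (s + t) *\<^sub>R e)) has_real_derivative partial i f (x + t *\<^sub>R e)) (at 0)"
        using partial_has_vector_derivative[OF d[of "x + t *\<^sub>R e"], of i]
        by (simp add: e_def has_real_derivative_iff_has_vector_derivative algebra_simps)
      then show ?thesis using DERIV_shift[of "\<lambda>t. f (x + t *\<^sub>R e)" _ 0 t] by simp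
    qed
    obtain z where "f (x + h *\<^sub>R e) - f (x + 0 *\<^sub>R e) = (h - 0) * partial i f (x + z *\<^sub>R e)"
      using MVT2[OF h der] by blast
    then have "D n x = partial i f (x + z *\<^sub>R e)"
      using h by (simp add: D_def h_def[symmetric] add.commute) (simp add: h_def field_simps)
    then show ?thesis using M(2)[of "x + z *\<^sub>R e"] False by simp
  qed
  have Dm: "D n \<in> borel_measurable lborel" for n
    unfolding D_def by (intro meas continuous_intros continuous_on_compose2[OF fc]) auto
  note dct = integral_dominated_convergence[where f="partial i f" and s=D
      and w="\<lambda>x. M * indicator (cball 0 (R + 1)) x",
      OF meas[OF pc] Dm dom AE_I2[OF lim] AE_I2[OF bound]]
  have "(\<lambda>n. LINT x|lborel. D n x) \<longlonglongrightarrow> (LINT x|lborel. partial i f x)" by (rule dct)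
  then show "(LINT x|lborel. partial i f x) = 0" unfolding D0 by (simp add: LIMSEQ_const_iff)
  show "integrable lborel (partial i f)"
    by (rule integrable_dominated_convergence[where f="partial i f" and s=D and
        w="\<lambda>x. M * indicator (cball 0 (R + 1)) x",
      OF meas[OF pc] Dm dom AE_I2[OF lim] AE_I2[OF bound]])
qed

text \<open>A C^1 solution needs no cut-off at the origin: each integrand is the divergence of a
  compactly supported C^1 field, up to terms containing the equations.\<close>

lemma C1_euler_distributional:
  assumes u: "Ck_on (Suc 0) u UNIV" and p: "Ck_on (Suc 0) p UNIV"
    and e: "\<And>x. convection u x + grad p x = 0" "\<And>x. divergence u x = 0"
  shows "euler_distributional u p"
proof -
  have du: "u differentiable (at x)" for x using u by simp
  have dp: "p differentiable (at x)" for x using p by simp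
  have nthC: "Ck_on (Suc 0) (\<lambda>x. f x $ j) UNIV" if "Ck_on (Suc 0) f UNIV"
      for f :: "real^3 \<Rightarrow> real^3" and j
  proof -
    have d: "f differentiable (at x)" for x using that by simp
    have "continuous_on UNIV (partial i f)" for i using that by simp
    then have "continuous_on UNIV (\<lambda>x. partial i f x $ j)" for i by (intro continuous_intros)
    then show ?thesis using d by (simp add: partial_nth differentiable_nth fun_eq_iff cong:
        continuous_on_cong)
  qed
  have supp: "\<exists>R. \<forall>x. norm x > R \<longrightarrow> v x = 0" if "test_function v"
      for v :: "real^3 \<Rightarrow> 'b::real_normed_vector"
  proof -
    have "bounded (closure {x. v x \<noteq> 0})" using that compact_imp_bounded
        by (auto simp: test_function_def)
    then obtain R where "\<And>x. x \<in> closure {x. v x \<noteq> 0} \<Longrightarrow> norm x \<le> R" by (auto simp: bounded_iff)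
    then have "norm x > R \<longrightarrow> v x = 0" for x using closure_subset[of "{x. v x \<noteq> 0}"] by force
    then show ?thesis by blast
  qed
  show ?thesis unfolding euler_distributional_def
  proof (intro conjI allI impI)
    fix v :: "real^3 \<Rightarrow> real^3" assume v: "test_function v"
    have vC: "Ck_on (Suc 0) v UNIV" using v unfolding test_function_def by blast
    have dv: "v differentiable (at x)" for x using vC by simp
    obtain R where R: "\<And>x. norm x > R \<Longrightarrow> v x = 0" using supp[OF v] by blast
    \<comment> \<open>The flux u (u . v) + p v. Its divergence is the tested integrand plus (div u)
      (u . v) and the momentum residual paired with \<open>v\<close>.\<close>
    define F where "F = (\<lambda>i x. u x $ i * (u x \<bullet> v x) + p x * v x $ i)"
    have FC: "Ck_on (Suc 0) (F i) UNIV" for i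
      unfolding F_def
      by (intro Ck_on_add Ck_on_mult Ck_on_bilinear[OF bounded_bilinear_inner] nthC u vC p
          open_UNIV)
    have Fs: "F i x = 0" if "norm x > R" for i x using R[OF that] by (simp add: F_def)
    have diff: "(\<lambda>x. u x $ i) differentiable (at x)" "(\<lambda>x. u x \<bullet> v x) differentiable (at x)"
      "(\<lambda>x. v x $ i) differentiable (at x)" for i x
      using du dv by (simp_all add: differentiable_nth differentiable_inner)
    have pF: "partial i (F i) x = u x $ i * (u x \<bullet> partial i v x + partial i u x \<bullet> v x)
       + partial i u x $ i * (u x \<bullet> v x) + (p x * partial i v x $ i + partial i p x * v x $
           i)" for i x
      unfolding F_def
      using partial_add[OF differentiable_mult[OF diff(1)[of i x] diff(2)[of x]]
          differentiable_mult[OF dp[of x] diff(3)[of i x]], of i]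
        partial_bilinear[OF bounded_bilinear_mult diff(1)[of i x] diff(2)[of x], of i]
        partial_bilinear[OF bounded_bilinear_mult dp[of x] diff(3)[of i x], of i]
        partial_bilinear[OF bounded_bilinear_inner du[of x] dv[of x], of i]
        partial_nth[OF du[of x]] partial_nth[OF dv[of x]]
      by simp
    have "(\<Sum>i\<in>UNIV. \<Sum>j\<in>UNIV. u x $ i * u x $ j * (partial j v x $ i)) + p x * divergence v x =
       partial 1 (F 1) x + partial 2 (F 2) x + partial 3 (F 3) x" for x
    proof -
      have "partial 1 (F 1) x + partial 2 (F 2) x + partial 3 (F 3) x =
        divergence u x * (u x \<bullet> v x) + (convection u x + grad p x) \<bullet> v x
        + ((\<Sum>i\<in>UNIV. \<Sum>j\<in>UNIV. u x $ i * u x $ j * (partial j v x $ i)) + p x * divergence v x)"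
        unfolding pF divergence_def convection_def grad_def sum_3 inner_3
            by (simp add: algebra_simps)
      then show ?thesis unfolding e by simp
    qed
    moreover note I = integral_partial_eq_zero[OF FC Fs]
    ultimately show "(LINT x|lborel. (\<Sum>i\<in>UNIV. \<Sum>j\<in>UNIV. u x $ i * u x $ j * (partial j v x $ i))
                          + p x * divergence v x) = 0"
      by (simp add: I)
  next
    fix g :: "real^3 \<Rightarrow> real" assume g: "test_function g"
    have gC: "Ck_on (Suc 0) g UNIV" using g unfolding test_function_def by blast
    have dg: "g differentiable (at x)" for x using gC by simp
    obtain R where R: "\<And>x. norm x > R \<Longrightarrow> g x = 0" using supp[OF g] by blast
    define F where "F = (\<lambda>i x. u x $ i * g x)"
    have FC: "Ck_on (Suc 0) (F i) UNIV" for i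
      unfolding F_def by (intro Ck_on_mult nthC u gC open_UNIV)
    have Fs: "F i x = 0" if "norm x > R" for i x using R[OF that] by (simp add: F_def)
    have pF: "partial i (F i) x = u x $ i * partial i g x + partial i u x $ i * g x" for i x
      unfolding F_def
      using partial_bilinear[OF bounded_bilinear_mult differentiable_nth[OF du] dg, of i i x]
          partial_nth[OF du]
      by simp
    have "u x \<bullet> grad g x = partial 1 (F 1) x + partial 2 (F 2) x + partial 3 (F 3) x" for x
    proof -
      have "partial 1 (F 1) x + partial 2 (F 2) x + partial 3 (F 3) x =
          u x \<bullet> grad g x + divergence u x * g x"
        unfolding pF by (simp add: divergence_def sum_3 inner_3 grad_def algebra_simps)
      then show ?thesis unfolding e(2) by simp
    qed
    moreover note I = integral_partial_eq_zero[OF FC Fs]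
    ultimately show "(LINT x|lborel. u x \<bullet> grad g x) = 0" by (simp add: I)
  qed
qed

text \<open>The degrees \<open>- \<alpha>\<close> and \<open>- 2 * \<alpha>\<close> both exceed 1,
  so velocity and pressure are C^1 with all values and first derivatives zero at the origin, where
  the classical equations thus hold trivially.\<close>

lemma flow_global_solution:
  assumes pr: "profile 1 \<alpha> A B P" and \<alpha>: "\<alpha> < -2"
  defines "u \<equiv> flow_u \<alpha> (A 0) (B 0)" and "p \<equiv> flow_p \<alpha> (P 0)"
  shows "continuous_on UNIV u" "continuous_on UNIV p" "euler_distributional u p"
proof -
  have ps: "punctured_solution 1 \<alpha> u p" unfolding u_def p_def by (rule profile_flow[OF pr]) simp
  then have C1: "Ck_on (Suc 0) u (- {0})" "Ck_on (Suc 0) p (- {0})"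
    and e: "euler_classical (- {0}) u p" unfolding punctured_solution_def One_nat_def by blast+
  have hom: "homogeneous_on UNIV \<alpha> u p" unfolding u_def p_def by (rule flow_homogeneous)
  have hu: "u x = l powr \<alpha> *\<^sub>R u (l *\<^sub>R x)" if "l > 0" for x l
    using hom that unfolding homogeneous_on_def by blast
  have hp: "p x = l powr (2 * \<alpha>) *\<^sub>R p (l *\<^sub>R x)" if "l > 0" for x l
    using hom that unfolding homogeneous_on_def real_scaleR_def by blast
  have z: "u 0 = 0" "p 0 = 0" by (simp_all add: u_def p_def flow_u_def flow_p_def)
  have a: "\<alpha> < -1" "2 * \<alpha> < -1" using \<alpha> by auto
  note U = homogeneous_C1_extends[OF C1(1) z(1) a(1) hu]
      and P = homogeneous_C1_extends[OF C1(2) z(2) a(2) hp]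
  show "continuous_on UNIV u" "continuous_on UNIV p" using Ck_on_SucD[OF U(1)] Ck_on_SucD[OF P(1)]
      by simp_all
  show "euler_distributional u p"
  proof (rule C1_euler_distributional[OF U(1) P(1)])
    fix x :: "real^3"
    have "convection u x + grad p x = 0 \<and> divergence u x = 0"
    proof (cases "x = 0")
      case True
      show ?thesis unfolding True
        by (simp add: convection_def grad_def divergence_def z U(2) P(2) vec_eq_iff)
    next
      case False
      then have "x \<in> - {0}" by simp
      then show ?thesis using e unfolding euler_classical_def by blast
    qed
    then show "convection u x + grad p x = 0" "divergence u x = 0" by blast+
  qed
qed

theorem theorem1p4:
  "(\<forall>\<alpha>. 1 \<le> \<alpha> \<and> \<alpha> \<le> 2 \<longrightarrow> \<not> (\<exists>u p. punctured_solution 1 \<alpha> u p)) \<and>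
   (\<forall>\<alpha>. - 2 < \<alpha> \<and> \<alpha> < 1 \<longrightarrow> \<not> (\<exists>u p. punctured_solution 2 \<alpha> u p)) \<and>
   \<not> (\<exists>u p. punctured_solution 2 (- 2) u p \<and> vorticity_over_r_vanishes_on_axis u) \<and>
   (\<forall>\<alpha>. \<alpha> > 2 \<longrightarrow> (\<exists>u p. punctured_solution 2 \<alpha> u p)) \<and>
   (\<forall>\<alpha>. \<alpha> < - 2 \<longrightarrow> (\<exists>u p. punctured_solution 1 \<alpha> u p \<and>
      continuous_on UNIV u \<and> continuous_on UNIV p \<and>
      homogeneous_on UNIV \<alpha> u p \<and> euler_distributional u p))"
proof (intro conjI allI impI)
  fix \<alpha> :: real assume "1 \<le> \<alpha> \<and> \<alpha> \<le> 2"
  then show "\<not> (\<exists>u p. punctured_solution 1 \<alpha> u p)"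
    using no_punctured_solution_C1[of \<alpha>] by auto
next
  fix \<alpha> :: real assume "- 2 < \<alpha> \<and> \<alpha> < 1"
  then show "\<not> (\<exists>u p. punctured_solution 2 \<alpha> u p)"
    using no_punctured_solution_C2[of \<alpha>] by auto
next
  show "\<not> (\<exists>u p. punctured_solution 2 (- 2) u p \<and> vorticity_over_r_vanishes_on_axis u)"
    using no_punctured_solution_minus2 by blast
next
  fix \<alpha> :: real assume \<alpha>: "\<alpha> > 2"
  then obtain A B P where "profile 2 \<alpha> A B P" using profile_exists[of \<alpha> 2] by auto
  from profile_flow[OF this] show "\<exists>u p. punctured_solution 2 \<alpha> u p" by auto
next
  fix \<alpha> :: real assume \<alpha>: "\<alpha> < - 2"
  then obtain A B P where pr: "profile 1 \<alpha> A B P" using profile_exists[of \<alpha> 1] by auto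
  show "\<exists>u p. punctured_solution 1 \<alpha> u p \<and> continuous_on UNIV u \<and> continuous_on UNIV p \<and>
      homogeneous_on UNIV \<alpha> u p \<and> euler_distributional u p"
    using profile_flow[OF pr order_refl] flow_global_solution[OF pr \<alpha>] flow_homogeneous by blast
qed

end
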